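(* Let $k\ge1$ and let $J_\infty^{(0)}$ be a $k$-periodic Jacobi matrix with entries $a_n^{(0)}>0$, $b_n^{(0)}\in\mathbb R$, and let $\theta(\mathbf a,\mathbf b)$ be its generating function (see the context). Let $J_\infty$ be an infinite complex Jacobi matrix with entries $a_n,b_n,c_n\in\mathbb C$ which is trace class asymptotically $k$-periodic with background $J_\infty^{(0)}$, i.e. $$\limsup_{n\to\infty}\sum_{j=1}^n\bigl(|a_j-a_j^{(0)}|+|b_j-b_j^{(0)}|+|c_j-a_j^{(0)}|\bigr)<\infty,$$ and let $J_n$ be the principal (leading) $n\times n$ block of $J_\infty$. Then $\{J_n\}$ is strongly clustered at $S(\theta(\mathbf a,\mathbf b))$, and every point $s\in S(\theta(\mathbf a,\mathbf b))$ strongly attracts $\{J_n\}$ with infinite order.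
   Context: $J_\infty$ is the infinite tridiagonal matrix $$J_\infty=\begin{pmatrix} b_0&c_1&&&\\ a_1&b_1&c_2&&\\ &a_2&b_2&c_3&\\ &&\ddots&\ddots&\ddots\end{pmatrix},$$ and $J_\infty^{(0)}$ is the infinite symmetric tridiagonal matrix with diagonal $b_0^{(0)},b_1^{(0)},b_2^{(0)},\dots$ and both off-diagonals $a_1^{(0)},a_2^{(0)},\dots$, where $a_n^{(0)}>0$, $b_n^{(0)}\in\mathbb R$ and $a_{n+k}^{(0)}=a_n^{(0)}$, $b_{n+k}^{(0)}=b_n^{(0)}$ for all $n\ge0$. Put $\mathbf a=(a_0^{(0)},\dots,a_{k-1}^{(0)})$, $\mathbf b=(b_0^{(0)},\dots,b_{k-1}^{(0)})$, and let $J_k[\mathbf a,\mathbf b]$ be the leading $k\times k$ block of $J_\infty^{(0)}$. The generating function is the $k\times k$ Hermitian-matrix-valued trigonometric polynomial, defined on $[-\pi,\pi]$, $$\theta(\mathbf a,\mathbf b,t)=J_k[\mathbf a,\mathbf b]+a_0^{(0)}e^{it}E_{1,k}+a_0^{(0)}e^{-it}E_{k,1},$$ where $E_{p,q}$ is the $k\times k$ matrix unit (for $k=1$ this is $b_0^{(0)}+2a_0^{(0)}\cos t$). Essential range: for a $k\times k$ matrix-valued function $\theta$ on $G$ with eigenvalues $\lambda_1(\theta(t)),\dots,\lambda_k(\theta(t))$ labelled so as to be measurable in $t$, $S(\theta)=\bigcup_{j=1}^kS(\lambda_j(\theta))$, where for a scalar measurable function $f$ on $G$, $S(f)$ is the set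 of $s\in\mathbb C$ such that $\{t\in G:|f(t)-s|<\varepsilon\}$ has positive Lebesgue measure for every $\varepsilon>0$. Here $G=[-\pi,\pi]$. A matrix sequence $\{A_n\}$ is a sequence of complex matrices with $A_n$ of size $n\times n$; $\lambda_1(A_n),\dots,\lambda_n(A_n)$ are its eigenvalues counted with multiplicity. Strong clustering: for a nonempty closed $S\subset\mathbb C$ and $\varepsilon>0$ let $D(S,\varepsilon)=\bigcup_{s\in S}\{z\in\mathbb C:|z-s|<\varepsilon\}$. $\{A_n\}$ is strongly clustered at $S$ if for every $\varepsilon>0$ the number of indices $j$ with $\lambda_j(A_n)\notin D(S,\varepsilon)$ is $O(1)$ as $n\to\infty$ (bounded by a constant that may depend on $\varepsilon$ but not on $n$). Attraction: a point $s\in\mathbb C$ strongly attracts $\{A_n\}$ with infinite order if, ordering the eigenvalues so that $|\lambda_1(A_n)-s|\le\cdots\le|\lambda_n(A_n)-s|$, one has $\lim_{n\to\infty}|\lambda_j(A_n)-s|=0$ for every fixed $j$. *)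

theory Defs
  imports
    "HOL-Analysis.Analysis"
    "Jordan_Normal_Form.Char_Poly"
begin

(* Infinite matrices are functions nat => nat => complex; all matrix positions (also those of the
   finite matrices) are counted from 0. The values a 0 and c 0 do not occur in the matrix. *)

definition jacobi_matrix ::
  "(nat \<Rightarrow> complex) \<Rightarrow> (nat \<Rightarrow> complex) \<Rightarrow> (nat \<Rightarrow> complex) \<Rightarrow> nat \<Rightarrow> nat \<Rightarrow> complex" where
  "jacobi_matrix a b c i j =
     (if i = j then b i else if i = j + 1 then a i else if j = i + 1 then c j else 0)"

definition symmetric_jacobi_matrix ::
  "(nat \<Rightarrow> real) \<Rightarrow> (nat \<Rightarrow> real) \<Rightarrow> nat \<Rightarrow> nat \<Rightarrow> complex" where
  "symmetric_jacobi_matrix a b =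
     jacobi_matrix (\<lambda>n. complex_of_real (a n)) (\<lambda>n. complex_of_real (b n))
       (\<lambda>n. complex_of_real (a n))"

definition leading_block :: "(nat \<Rightarrow> nat \<Rightarrow> complex) \<Rightarrow> nat \<Rightarrow> complex mat" where
  "leading_block M n = Matrix.mat n n (\<lambda>(i, j). M i j)"

definition matrix_unit :: "nat \<Rightarrow> nat \<Rightarrow> nat \<Rightarrow> complex mat" where
  "matrix_unit k p q = Matrix.mat k k (\<lambda>(i, j). if i = p \<and> j = q then 1 else 0)"

(* Only a 0, ..., a (k - 1) and b 0, ..., b (k - 1) enter. The three summands are added, so for
   k = 1 all of them contribute to the single entry and for k = 2 both off-diagonal entries
   have two contributions. *)
definition generating_function ::
  "nat \<Rightarrow> (nat \<Rightarrow> real) \<Rightarrow> (nat \<Rightarrow> real) \<Rightarrow> real \<Rightarrow> complex mat" where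
  "generating_function k a b t =
     leading_block (symmetric_jacobi_matrix a b) k
     + (complex_of_real (a 0) * exp (\<i> * complex_of_real t)) \<cdot>\<^sub>m matrix_unit k 0 (k - 1)
     + (complex_of_real (a 0) * exp (- (\<i> * complex_of_real t))) \<cdot>\<^sub>m matrix_unit k (k - 1) 0"

(* with algebraic multiplicity *)
definition eigvals :: "complex mat \<Rightarrow> complex multiset" where
  "eigvals A = proots (char_poly A)"

definition ess_range :: "real set \<Rightarrow> (real \<Rightarrow> complex) \<Rightarrow> complex set" where
  "ess_range G f = {s. \<forall>\<epsilon>>0. emeasure lebesgue {t \<in> G. cmod (f t - s) < \<epsilon>} > 0}"

definition measurable_eigenvalue_labelling ::
  "nat \<Rightarrow> real set \<Rightarrow> (real \<Rightarrow> complex mat) \<Rightarrow> (nat \<Rightarrow> real \<Rightarrow> complex) \<Rightarrow> bool" where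
  "measurable_eigenvalue_labelling k G F lam \<longleftrightarrow>
     (\<forall>j<k. lam j \<in> borel_measurable (lebesgue_on G)) \<and>
     (\<forall>t\<in>G. image_mset (\<lambda>j. lam j t) (mset_set {..<k}) = eigvals (F t))"

(* The union over j < k of the essential ranges of the j-th eigenvalue functions does not depend on
   the measurable labelling (matrix_ess_range_eq below). *)
definition matrix_ess_range :: "nat \<Rightarrow> real set \<Rightarrow> (real \<Rightarrow> complex mat) \<Rightarrow> complex set" where
  "matrix_ess_range k G F =
     {s. \<exists>lam. measurable_eigenvalue_labelling k G F lam \<and> s \<in> (\<Union>j<k. ess_range G (lam j))}"

definition disc_nbhd :: "complex set \<Rightarrow> real \<Rightarrow> complex set" where
  "disc_nbhd S \<epsilon> = (\<Union>s\<in>S. {z. cmod (z - s) < \<epsilon>})"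

(* The notion is defined only for nonempty closed S; this requirement is part of the predicate. *)
definition strongly_clustered :: "(nat \<Rightarrow> complex mat) \<Rightarrow> complex set \<Rightarrow> bool" where
  "strongly_clustered A S \<longleftrightarrow> S \<noteq> {} \<and> closed S \<and>
     (\<forall>\<epsilon>>0. \<exists>C::nat. \<forall>n. size {#z \<in># eigvals (A n). z \<notin> disc_nbhd S \<epsilon>#} \<le> C)"

(* lam n lists the eigenvalues of A n by increasing distance to s. Such lists exist, and two of them
   have the same distances at each position. The list has length n, so the value at position j is
   unspecified only for the finitely many n <= j. *)
definition strongly_attracts :: "complex \<Rightarrow> (nat \<Rightarrow> complex mat) \<Rightarrow> bool" where
  "strongly_attracts s A \<longleftrightarrow>
     (\<exists>lam :: nat \<Rightarrow> complex list.
        (\<forall>n. mset (lam n) = eigvals (A n) \<and> sorted (map (\<lambda>z. cmod (z - s)) (lam n))) \<and>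
        (\<forall>j. (\<lambda>n. cmod (lam n ! j - s)) \<longlonglongrightarrow> 0))"

lemma labelling_ess_range:
  assumes G: "G \<in> sets lebesgue" and lam: "measurable_eigenvalue_labelling k G F lam"
  shows "(\<Union>j<k. ess_range G (lam j)) =
    {s. \<forall>\<epsilon>>0. emeasure lebesgue {t \<in> G. \<exists>z\<in>set_mset (eigvals (F t)). cmod (z - s) < \<epsilon>} > 0}"
    (is "?L = ?R")
proof -
  have sets: "{t \<in> G. cmod (lam j t - s) < e} \<in> sets lebesgue" if "j < k" for j s e
  proof -
    have [measurable]: "lam j \<in> borel_measurable (lebesgue_on G)"
      using lam that by (auto simp: measurable_eigenvalue_labelling_def)
    have "{t \<in> space (lebesgue_on G). cmod (lam j t - s) < e} \<in> sets (lebesgue_on G)"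
      by measurable
    then show ?thesis
      using G by (simp add: space_restrict_space sets_restrict_space_iff)
  qed
  have eq: "{t \<in> G. \<exists>z\<in>set_mset (eigvals (F t)). cmod (z - s) < e} =
      (\<Union>j<k. {t \<in> G. cmod (lam j t - s) < e})" for s e
  proof -
    have "(\<exists>z\<in>set_mset (eigvals (F t)). cmod (z - s) < e) \<longleftrightarrow> (\<exists>j<k. cmod (lam j t - s) < e)"
      if "t \<in> G" for t
    proof -
      have "eigvals (F t) = image_mset (\<lambda>j. lam j t) (mset_set {..<k})"
        using lam that unfolding measurable_eigenvalue_labelling_def by metis
      then have "set_mset (eigvals (F t)) = (\<lambda>j. lam j t) ` {..<k}" by simp
      then show ?thesis by (simp only: bex_simps(7)) auto
    qed
    then have "{t \<in> G. \<exists>z\<in>set_mset (eigvals (F t)). cmod (z - s) < e} =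
        {t \<in> G. \<exists>j<k. cmod (lam j t - s) < e}"
      by (intro Collect_cong conj_cong refl)
    then show ?thesis by auto
  qed
  show ?thesis
  proof (intro equalityI subsetI)
    fix s assume "s \<in> ?L"
    then obtain j where j: "j < k" "s \<in> ess_range G (lam j)" by auto
    have "emeasure lebesgue {t \<in> G. \<exists>z\<in>set_mset (eigvals (F t)). cmod (z - s) < e} > 0"
      if "e > 0" for e
    proof -
      have "0 < emeasure lebesgue {t \<in> G. cmod (lam j t - s) < e}"
        using j that by (auto simp: ess_range_def)
      also have "\<dots> \<le> emeasure lebesgue (\<Union>j<k. {t \<in> G. cmod (lam j t - s) < e})"
        using j(1) sets by (intro emeasure_mono sets.finite_UN) auto
      finally show ?thesis by (simp only: eq)
    qed
    then show "s \<in> ?R" by auto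
  next
    fix s assume s: "s \<in> ?R"
    show "s \<in> ?L"
    proof (rule ccontr)
      assume "s \<notin> ?L"
      then have "\<forall>j\<in>{..<k}. \<exists>e>0. emeasure lebesgue {t \<in> G. cmod (lam j t - s) < e} = 0"
        by (auto simp: ess_range_def not_less)
      from bchoice[OF this] obtain e where e: "\<forall>j\<in>{..<k}. e j > (0::real) \<and>
          emeasure lebesgue {t \<in> G. cmod (lam j t - s) < e j} = 0"
        by blast
      define d where "d = Min (insert 1 (e ` {..<k}))"
      have d: "d > 0" "\<And>j. j < k \<Longrightarrow> d \<le> e j"
        using e by (auto simp: d_def)
      have "{t \<in> G. cmod (lam j t - s) < d} \<in> null_sets lebesgue" if "j < k" for j
      proof (rule null_sets_subset)
        show "{t \<in> G. cmod (lam j t - s) < e j} \<in> null_sets lebesgue"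
          using e that sets[OF that] by (intro null_setsI) blast+
      qed (use sets[OF that] d(2)[OF that] in auto)
      then have "(\<Union>j<k. {t \<in> G. cmod (lam j t - s) < d}) \<in> null_sets lebesgue"
        by (intro null_sets.finite_UN) auto
      then have "emeasure lebesgue {t \<in> G. \<exists>z\<in>set_mset (eigvals (F t)). cmod (z - s) < d} = 0"
        unfolding eq by blast
      moreover have "emeasure lebesgue {t \<in> G. \<exists>z\<in>set_mset (eigvals (F t)). cmod (z - s) < d} > 0"
        using s d(1) by blast
      ultimately show False by simp
    qed
  qed
qed

lemma matrix_ess_range_eq:
  assumes "G \<in> sets lebesgue" and "measurable_eigenvalue_labelling k G F lam"
  shows "matrix_ess_range k G F = (\<Union>j<k. ess_range G (lam j))"
proof -
  define R where "R = {s. \<forall>\<epsilon>>0.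
    emeasure lebesgue {t \<in> G. \<exists>z\<in>set_mset (eigvals (F t)). cmod (z - s) < \<epsilon>} > 0}"
  have L: "(\<Union>j<k. ess_range G (l j)) = R" if "measurable_eigenvalue_labelling k G F l" for l
    unfolding R_def by (rule labelling_ess_range[OF assms(1) that])
  have eq: "s \<in> matrix_ess_range k G F \<longleftrightarrow> s \<in> R" for s
  proof
    assume "s \<in> matrix_ess_range k G F"
    then obtain l where l: "measurable_eigenvalue_labelling k G F l"
        and s: "s \<in> (\<Union>j<k. ess_range G (l j))"
      unfolding matrix_ess_range_def mem_Collect_eq by (elim exE conjE)
    show "s \<in> R" using s unfolding L[OF l] .
  next
    assume "s \<in> R"
    then have "s \<in> (\<Union>j<k. ess_range G (lam j))" unfolding L[OF assms(2)] .
    with assms(2) show "s \<in> matrix_ess_range k G F"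
      unfolding matrix_ess_range_def mem_Collect_eq by (intro exI conjI)
  qed
  show ?thesis unfolding L[OF assms(2)] by (rule Set.set_eqI) (rule eq)
qed

end

theory Submission
  imports Defs "Jordan_Normal_Form.Schur_Decomposition"
begin

text \<open>The matrix J_n is compared with a Hermitian matrix C_n whose spectrum lies in S and is explicitly
  known. Write n = m k + r with r < k. The first m k rows and columns of C_n carry the periodic Jacobi
  matrix closed up to a block circulant, and the last r diagonal entries are all equal to one chosen point of S. The
  discrete Fourier transform turns the circulant part into the direct sum of the symbol values
  \<theta>(2 \<pi> l / m), l < m, so that all eigenvalues of C_n are eigenvalues of some \<theta>(t) and hence
  points of S. The entries of J_n - C_n are those of the perturbation, two corner entries and boundedly
  many entries from the last r rows and columns; therefore the sum of their moduli is bounded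
  independently of n.

  Since J_n is not normal, perturbation theory for eigenvalues of Hermitian matrices is replaced by a
  Schur frame: an orthonormal basis u_j with <p(J_n) u_j, u_j> = p(\<lambda>_j) for every polynomial p. If
  Re p \<le> 0 on S, then p(C_n) has nonpositive real part, and Re p(\<lambda>_j) is at most the modulus of
  <(p(J_n) - p(C_n)) u_j, u_j>. The sum over j of these moduli is at most the entrywise sum norm of
  p(J_n) - p(C_n), which is bounded in n. So at most a bounded number of eigenvalues satisfy
  Re p(\<lambda>) \<ge> \<delta> (lemma eigval_count_le_l1). As S is a closed set of reals, every point outside S is
  separated from S by a polynomial of degree at most two, and compactness yields strong clustering.

  For attraction to s in S, take p(z) = (1 - (z - s)^2 / R^2)^d. The traces of p(J_n) and p(C_n) differ
  by a bounded amount. A positive proportion of the sampling points 2 \<pi> l / m gives an eigenvalue of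
  C_n close to s, so the trace of p(C_n) is at least c \<alpha>^d n. Eigenvalues of J_n near S but not near s
  contribute at most \<beta>^d n with \<beta> < \<alpha>, and for large d the remaining linear growth can only come
  from eigenvalues near s.

  Finally, S is described without a labelling of the eigenvalues: s lies in S iff, for every \<epsilon>, the set
  of t for which \<theta>(t) has an eigenvalue \<epsilon>-close to s has positive measure. This needs one measurable
  labelling to exist, which is obtained by splitting off the smallest root again and again.\<close>

section \<open>Unitary triangularisation\<close>

lemma mat_adjoint_carrier [simp]:
  "A \<in> carrier_mat n m \<Longrightarrow> mat_adjoint A \<in> carrier_mat m n"
  by (auto simp: mat_adjoint_def mat_of_rows_def)

lemma mat_adjoint_dim [simp]: 
  "dim_row (mat_adjoint A) = dim_col A" "dim_col (mat_adjoint A) = dim_row A"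
  by (auto simp: mat_adjoint_def mat_of_rows_def)

lemma mat_adjoint_index [simp]:
  fixes A :: "complex mat"
  shows "i < dim_col A \<Longrightarrow> j < dim_row A \<Longrightarrow> mat_adjoint A $$ (i, j) = cnj (A $$ (j, i))"
  by (simp add: mat_adjoint_def mat_of_rows_def conjugate_vec_def)

lemma mat_mult_index_sum:
  assumes "A \<in> carrier_mat n m" "B \<in> carrier_mat m p" "i < n" "j < p"
  shows "(A * B) $$ (i, j) = (\<Sum>l<m. A $$ (i, l) * B $$ (l, j))"
  using assms by (auto simp: scalar_prod_def lessThan_atLeast0 intro!: sum.cong)

lemma mat_adjoint_mult:
  fixes A B :: "complex mat"
  assumes A: "A \<in> carrier_mat n m" and B: "B \<in> carrier_mat m p"
  shows "mat_adjoint (A * B) = mat_adjoint B * mat_adjoint A"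
proof (rule eq_matI)
  fix i j assume ij: "i < dim_row (mat_adjoint B * mat_adjoint A)" "j < dim_col (mat_adjoint B * mat_adjoint A)"
  then have ij: "i < p" "j < n" using A B by auto
  have "mat_adjoint (A * B) $$ (i, j) = cnj ((A * B) $$ (j, i))"
    using A B ij by (intro mat_adjoint_index) auto
  also have "\<dots> = (\<Sum>l<m. cnj (B $$ (l, i)) * cnj (A $$ (j, l)))"
    by (simp add: mat_mult_index_sum[OF A B ij(2,1)] mult.commute)
  also have "\<dots> = (mat_adjoint B * mat_adjoint A) $$ (i, j)"
    using A B ij by (subst mat_mult_index_sum[of _ p m _ n]) (auto intro!: sum.cong)
  finally show "mat_adjoint (A * B) $$ (i, j) = (mat_adjoint B * mat_adjoint A) $$ (i, j)" .
qed (use A B in auto)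

text \<open>A Gram-Schmidt basis that starts with an eigenvector is normalised, so that its inverse is its adjoint.\<close>

lemma unitary_completion:
  fixes v :: "complex vec"
  assumes v: "v \<in> carrier_vec n" "v \<noteq> 0\<^sub>v n"
    and A: "A \<in> carrier_mat n n" and ev: "A *\<^sub>v v = e \<cdot>\<^sub>v v"
  obtains W where "W \<in> carrier_mat n n" "mat_adjoint W * W = 1\<^sub>m n" "W * mat_adjoint W = 1\<^sub>m n"
    "col (mat_adjoint W * A * W) 0 = vec n (\<lambda>i. if i = 0 then e else 0)"
proof -
  interpret cof_vec_space n "TYPE(complex)" .
  define b where "b = basis_completion v"
  define ws where "ws = gram_schmidt n b"
  from basis_completion[OF v, folded b_def]
  have dist_b: "distinct b" 
    and indep: "\<not> lin_dep (set b)" and b: "set b \<subseteq> carrier_vec n" and hdb: "hd b = v" 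
    and len_b: "length b = n" by auto
  have n: "n \<noteq> 0" using v by auto
  from hdb len_b n obtain vs where bv: "b = v # vs" by (cases b, auto)
  from gram_schmidt_result[OF b dist_b indep refl, folded ws_def]
  have ws: "set ws \<subseteq> carrier_vec n" "corthogonal ws" "length ws = n" 
    by (auto simp: len_b)
  from gram_schmidt_hd[OF v(1), of vs, folded bv] have hdws: "hd ws = v" unfolding ws_def .
  define nrm where "nrm w = complex_of_real (1 / sqrt (Re (w \<bullet>c w)))" for w :: "complex vec"
  define us where "us = map (\<lambda>w. nrm w \<cdot>\<^sub>v w) ws"
  have wsi: "ws ! i \<in> carrier_vec n" if "i < n" for i using ws that by auto
  have orth: "ws ! i \<bullet>c ws ! j = 0 \<longleftrightarrow> i \<noteq> j" if "i < n" "j < n" for i j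
    using corthogonalD[OF ws(2)] ws(3) that by auto
  have usi: "us ! i = nrm (ws ! i) \<cdot>\<^sub>v ws ! i" if "i < n" for i using that ws(3) by (simp add: us_def)
  have prod: "us ! i \<bullet>c us ! j = nrm (ws ! i) * nrm (ws ! j) * (ws ! i \<bullet>c ws ! j)" if "i < n" "j < n" for i j
  proof -
    have "us ! i \<bullet>c us ! j = (\<Sum>l<n. nrm (ws ! i) * nrm (ws ! j) * (ws ! i $ l * cnj (ws ! j $ l)))"
      using wsi[OF that(1)] wsi[OF that(2)] that
      by (simp add: usi scalar_prod_def conjugate_vec_def lessThan_atLeast0 nrm_def mult_ac)
    also have "\<dots> = nrm (ws ! i) * nrm (ws ! j) * (ws ! i \<bullet>c ws ! j)"
      using wsi[OF that(1)] wsi[OF that(2)] that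
      by (simp add: scalar_prod_def conjugate_vec_def lessThan_atLeast0 sum_distrib_left)
    finally show ?thesis .
  qed
  have one: "us ! i \<bullet>c us ! i = 1" if "i < n" for i
  proof -
    have eq: "ws ! i \<bullet>c ws ! i = complex_of_real (\<Sum>l<n. (cmod (ws ! i $ l))\<^sup>2)"
      using wsi[OF that] by (simp add: scalar_prod_def conjugate_vec_def lessThan_atLeast0
          complex_norm_square[symmetric])
    have "(\<Sum>l<n. (cmod (ws ! i $ l))\<^sup>2) \<noteq> 0" using orth[OF that that] unfolding eq by (metis of_real_0)
    moreover have "(\<Sum>l<n. (cmod (ws ! i $ l))\<^sup>2) \<ge> 0" by (intro sum_nonneg) simp
    ultimately have "(\<Sum>l<n. (cmod (ws ! i $ l))\<^sup>2) > 0" by linarith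
    then have "(1 / sqrt (\<Sum>l<n. (cmod (ws ! i $ l))\<^sup>2))^2 * (\<Sum>l<n. (cmod (ws ! i $ l))\<^sup>2) = 1"
      by (simp add: power_divide)
    then show ?thesis unfolding prod[OF that that] nrm_def eq Re_complex_of_real
      by (simp only: power2_eq_square flip: of_real_mult) simp
  qed
  have us: "set us \<subseteq> carrier_vec n" "length us = n" using ws by (auto simp: us_def)
  have cor: "corthogonal us"
  proof (rule corthogonalI)
    fix i j assume ij: "i < length us" "j < length us"
    show "us ! i \<bullet>c us ! j = 0 \<longleftrightarrow> i \<noteq> j"
      using ij us(2) one[of i] prod[of i j] orth[of i j] by (cases "i = j") auto
  qed
  define W where "W = mat_of_cols n us"
  have W: "W \<in> carrier_mat n n" using us unfolding W_def using mat_of_cols_carrier(1)[of n us] by auto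
  have orth_W: "corthogonal_mat W" using orthogonal_mat_of_cols[OF us(1) cor us(2)] unfolding W_def .
  have cols: "cols W = us" unfolding W_def using us by simp
  have "map vec_inv us = map conjugate us"
  proof (intro map_cong refl)
    fix x assume "x \<in> set us"
    then obtain i where "i < n" "x = us ! i" using us(2) by (auto simp: in_set_conv_nth)
    then have "x \<bullet>c x = 1" using one by simp
    then show "vec_inv x = conjugate x" by (simp add: vec_inv_def)
  qed
  then have inv: "corthogonal_inv W = mat_adjoint W"
    by (simp only: corthogonal_inv_def mat_adjoint_def cols)
  have WW: "mat_adjoint W * W = 1\<^sub>m n"
    using corthogonal_inv_result[OF orth_W] W unfolding inv inverts_mat_def by simp
  have WW': "W * mat_adjoint W = 1\<^sub>m n" 
    by (rule mat_mult_left_right_inverse[OF _ W WW]) (use W in simp)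
  have hdus: "hd us = nrm v \<cdot>\<^sub>v v" using hdws ws(3) n by (cases ws) (auto simp: us_def)
  have nz: "nrm v \<noteq> 0"
  proof -
    have "ws ! 0 = v" using hdws ws(3) n by (cases ws) auto
    then show ?thesis using one[of 0] n prod[of 0 0] by auto
  qed
  have v': "nrm v \<cdot>\<^sub>v v \<in> carrier_vec n" "nrm v \<cdot>\<^sub>v v \<noteq> 0\<^sub>v n"
    using v nz by (auto simp: vec_eq_iff)
  have ev': "A *\<^sub>v (nrm v \<cdot>\<^sub>v v) = e \<cdot>\<^sub>v (nrm v \<cdot>\<^sub>v v)"
    using ev v A by (simp add: mult_mat_vec smult_smult_assoc mult.commute)
  have "col (mat_adjoint W * A * W) 0 = vec n (\<lambda>i. if i = 0 then e else 0)"
    using corthogonal_col_ev_0[OF A v' ev' n hdus us(1) cor us(2), folded W_def, unfolded inv] .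
  with that[OF W WW WW'] show ?thesis .
qed

text \<open>In an orthonormal basis that starts with an eigenvector, the first column of A vanishes below the
  diagonal, and the induction hypothesis triangularises the remaining block. A unitary matrix, rather
  than an arbitrary similarity, is what keeps entrywise estimates independent of the dimension.\<close>

theorem unitary_schur:
  fixes A :: "complex mat"
  assumes A: "A \<in> carrier_mat n n"
  shows "\<exists>T U. similar_mat_wit A T U (mat_adjoint U) \<and> upper_triangular T"
  using A
proof (induction n arbitrary: A)
  case 0
  have "similar_mat_wit A A (1\<^sub>m 0) (1\<^sub>m 0)" using similar_mat_wit_refl[OF 0] .
  moreover have "mat_adjoint (1\<^sub>m 0) = (1\<^sub>m 0 :: complex mat)" by (rule eq_matI) auto
  ultimately show ?case using 0 by (intro exI[of _ A] exI[of _ "1\<^sub>m 0"]) auto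
next
  case (Suc n)
  note A = Suc.prems
  obtain as where as: "char_poly A = (\<Prod>a\<leftarrow>as. [:- a, 1:])" "length as = Suc n"
    using char_poly_factorized[OF A] by auto
  then obtain e es where "as = e # es" by (cases as) auto
  then have "eigenvalue A e" unfolding eigenvalue_root_char_poly[OF A] as by simp
  then obtain v where "eigenvector A v e" by (auto simp: eigenvalue_def)
  then have v: "v \<in> carrier_vec (Suc n)" "v \<noteq> 0\<^sub>v (Suc n)" "A *\<^sub>v v = e \<cdot>\<^sub>v v"
    using A by (auto simp: eigenvector_def)
  obtain W where W: "W \<in> carrier_mat (Suc n) (Suc n)"
    and WW: "mat_adjoint W * W = 1\<^sub>m (Suc n)" "W * mat_adjoint W = 1\<^sub>m (Suc n)"
    and col0: "col (mat_adjoint W * A * W) 0 = vec (Suc n) (\<lambda>i. if i = 0 then e else 0)"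
    using unitary_completion[OF v(1,2) A v(3)] .
  define A' where "A' = mat_adjoint W * A * W"
  have W': "mat_adjoint W \<in> carrier_mat (Suc n) (Suc n)" using W by simp
  have A': "A' \<in> carrier_mat (Suc n) (Suc n)" using A W W' by (auto simp: A'_def)
  have "similar_mat_wit A' A (mat_adjoint W) W"
    by (rule similar_mat_witI[OF WW A'_def A' A W' W])
  then have simAA': "similar_mat_wit A A' W (mat_adjoint W)" by (rule similar_mat_wit_sym)
  obtain A1 A2 A0 A3 where splitA': "split_block A' 1 1 = (A1,A2,A0,A3)"
    by (cases "split_block A' 1 1", auto)
  from A' have "dim_row A' = 1 + n" "dim_col A' = 1 + n" by auto
  from split_block[OF splitA' this] have A1: "A1 \<in> carrier_mat 1 1" and A2: "A2 \<in> carrier_mat 1 n"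
    and A3: "A3 \<in> carrier_mat n n" and A0: "A0 \<in> carrier_mat n 1"
    and A'block: "A' = four_block_mat A1 A2 A0 A3" by auto
  have ut1: "upper_triangular A1" using A1 by auto
  have "A' $$ (Suc i, 0) = 0" if "i < n" for i
    using arg_cong[OF col0, of "\<lambda>v. v $ Suc i"] A' that unfolding A'_def[symmetric] by auto
  then have A0id: "A0 = 0\<^sub>m n 1"
    using splitA'[unfolded split_block_def Let_def] A' by auto
  obtain B P where sB: "similar_mat_wit A3 B P (mat_adjoint P)" and ut: "upper_triangular B"
    using Suc.IH[OF A3] by auto
  from similar_mat_witD2[OF A3 sB] have B: "B \<in> carrier_mat n n" and P: "P \<in> carrier_mat n n" 
    and PP: "P * mat_adjoint P = 1\<^sub>m n" by auto
  have P': "mat_adjoint P \<in> carrier_mat n n" using P by simp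
  let ?P' = "four_block_mat (1\<^sub>m 1) (0\<^sub>m 1 n) (0\<^sub>m n 1) P"
  let ?Q' = "four_block_mat (1\<^sub>m 1) (0\<^sub>m 1 n) (0\<^sub>m n 1) (mat_adjoint P)"
  let ?C = "four_block_mat A1 (A2 * P) A0 B"
  have A0_eq: "A0 = P * A0 * 1\<^sub>m 1" unfolding A0id using P by auto
  have A2_eq: "A2 = 1\<^sub>m 1 * (A2 * P) * mat_adjoint P" 
    using A2 P P' PP by (simp add: assoc_mult_mat[OF A2 P P'])
  have simA'C: "similar_mat_wit A' ?C ?P' ?Q'" unfolding A'block
    by (rule similar_mat_wit_four_block[OF similar_mat_wit_refl[OF A1] sB A2_eq A0_eq A1 A3 A0])
      (use A2 P in auto)
  have utC: "upper_triangular ?C" unfolding A0id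
    by (rule upper_triangular_four_block[OF A1 B ut1 ut])
  have P'c: "?P' \<in> carrier_mat (Suc n) (Suc n)" using P by auto
  have "?Q' = mat_adjoint ?P'"
    by (rule eq_matI) (use P in \<open>auto simp: Suc_diff_Suc\<close>)
  then have "?Q' * mat_adjoint W = mat_adjoint (W * ?P')"
    by (simp only: mat_adjoint_mult[OF W P'c])
  with similar_mat_wit_trans[OF simAA' simA'C] utC show ?case by auto
qed

section \<open>Polynomials of a matrix in a Schur frame\<close>

text \<open>Horner evaluation: facts about p(A) follow by induction on p from one product and one sum.\<close>

definition poly_mat :: "complex poly \<Rightarrow> complex mat \<Rightarrow> complex mat" where
  "poly_mat p A = fold_coeffs (\<lambda>c X. c \<cdot>\<^sub>m 1\<^sub>m (dim_row A) + A * X) p (0\<^sub>m (dim_row A) (dim_row A))"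

lemma poly_mat_0: "A \<in> carrier_mat n n \<Longrightarrow> poly_mat 0 A = 0\<^sub>m n n"
  by (simp add: poly_mat_def)

lemma poly_mat_pCons:
  assumes "A \<in> carrier_mat n n"
  shows "poly_mat (pCons c p) A = c \<cdot>\<^sub>m 1\<^sub>m n + A * poly_mat p A"
proof (cases "c = 0 \<and> p = 0")
  case True
  have "0\<^sub>m n n = (0 :: complex) \<cdot>\<^sub>m 1\<^sub>m n + A * 0\<^sub>m n n" by (rule eq_matI) (use assms in auto)
  then show ?thesis using True poly_mat_0[OF assms] by simp
next
  case False
  then show ?thesis using assms by (auto simp: poly_mat_def)
qed

lemma poly_mat_carrier:
  assumes "A \<in> carrier_mat n n"
  shows "poly_mat p A \<in> carrier_mat n n"
  by (induction p) (use assms in \<open>auto simp: poly_mat_0 poly_mat_pCons\<close>)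

lemma poly_mat_X:
  assumes A: "A \<in> carrier_mat n n"
  shows "poly_mat [:0, 1:] A = A"
proof -
  have "poly_mat [:0, 1:] A = 0 \<cdot>\<^sub>m 1\<^sub>m n + A * (1 \<cdot>\<^sub>m 1\<^sub>m n + A * 0\<^sub>m n n)"
    using A by (simp add: poly_mat_pCons[of _ n] poly_mat_0[of _ n])
  also have "1 \<cdot>\<^sub>m 1\<^sub>m n + A * 0\<^sub>m n n = 1\<^sub>m n" by (rule eq_matI) (use A in auto)
  also have "0 \<cdot>\<^sub>m 1\<^sub>m n + A * 1\<^sub>m n = A" by (rule eq_matI) (use A in auto)
  finally show ?thesis .
qed

lemma poly_mat_similar:
  assumes U: "U \<in> carrier_mat n n" and V: "V \<in> carrier_mat n n" and T: "T \<in> carrier_mat n n"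
    and UV: "U * V = 1\<^sub>m n" "V * U = 1\<^sub>m n"
  shows "poly_mat p (U * T * V) = U * poly_mat p T * V"
proof (induction p)
  case 0
  then show ?case using assms by (simp add: poly_mat_0[of _ n])
next
  case (pCons c p)
  let ?X = "poly_mat p T"
  have X: "?X \<in> carrier_mat n n" using T by (rule poly_mat_carrier)
  have UTV: "U * T * V \<in> carrier_mat n n" using U T V by simp
  note mm = mult_carrier_mat[of _ n n _ n] and assoc = assoc_mult_mat[of _ n n _ n _ n]
  have "U * T * V * (U * ?X * V) = U * (T * (V * U * (?X * V)))"
    using U V T X by (simp add: assoc mm)
  then have e1: "U * T * V * (U * ?X * V) = U * (T * (?X * V))"
    unfolding UV using X V by (simp add: mm)
  have "U * (c \<cdot>\<^sub>m 1\<^sub>m n + T * ?X) * V = U * (c \<cdot>\<^sub>m 1\<^sub>m n) * V + U * (T * ?X) * V"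
    using U V T X by (simp add: mm mult_add_distrib_mat[of _ n n _ n] add_mult_distrib_mat[of _ n n _ _ n])
  also have "U * (c \<cdot>\<^sub>m 1\<^sub>m n) * V = c \<cdot>\<^sub>m 1\<^sub>m n"
    using U V UV by (simp add: mm mult_smult_distrib[of _ n n _ n] mult_smult_assoc_mat[of _ n n _ n])
  also have "U * (T * ?X) * V = U * (T * (?X * V))"
    using U V T X by (simp add: assoc mm)
  finally show ?case
    by (simp only: poly_mat_pCons[OF UTV] poly_mat_pCons[OF T] pCons.IH e1)
qed

text \<open>The diagonal of a product of triangular matrices is the product of the diagonals.\<close>

lemma poly_mat_triangular:
  assumes T: "T \<in> carrier_mat n n" and ut: "\<And>i j. i < n \<Longrightarrow> j < i \<Longrightarrow> T $$ (i, j) = 0"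
  shows "(\<forall>i<n. \<forall>j<i. poly_mat p T $$ (i, j) = 0) \<and> (\<forall>i<n. poly_mat p T $$ (i, i) = poly p (T $$ (i, i)))"
proof (induction p)
  case 0
  then show ?case using T by (simp add: poly_mat_0[of _ n])
next
  case (pCons c p)
  let ?X = "poly_mat p T"
  have X: "?X \<in> carrier_mat n n" using T by (rule poly_mat_carrier)
  have ent: "poly_mat (pCons c p) T $$ (i, j) = (if i = j then c else 0) + (\<Sum>l<n. T $$ (i, l) * ?X $$ (l, j))"
    if "i < n" "j < n" for i j
    using that X T by (simp add: poly_mat_pCons[of _ n] mat_mult_index_sum[OF T X] del: index_mult_mat(1))
  have off: "(\<Sum>l<n. T $$ (i, l) * ?X $$ (l, j)) = 0" if "i < n" "j < i" for i j
  proof (intro sum.neutral ballI)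
    fix l assume "l \<in> {..<n}"
    then show "T $$ (i, l) * ?X $$ (l, j) = 0"
      using ut[of i l] pCons.IH that by (cases "l < i") auto
  qed
  have diag: "(\<Sum>l<n. T $$ (i, l) * ?X $$ (l, i)) = T $$ (i, i) * ?X $$ (i, i)" if "i < n" for i
  proof -
    have "T $$ (i, l) * ?X $$ (l, i) = 0" if "l \<in> {..<n} - {i}" for l
      using ut[of i l] pCons.IH that \<open>i < n\<close> by (cases "l < i") auto
    then have "(\<Sum>l\<in>{..<n} - {i}. T $$ (i, l) * ?X $$ (l, i)) = 0" by (intro sum.neutral ballI)
    then show ?thesis using that by (subst sum.remove[of _ i]) auto
  qed
  show ?case using pCons.IH by (auto simp: ent off diag)
qed

definition qform :: "nat \<Rightarrow> complex mat \<Rightarrow> (nat \<Rightarrow> complex) \<Rightarrow> complex" where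
  "qform n E v = (\<Sum>a<n. \<Sum>b<n. cnj (v a) * E $$ (a, b) * v b)"

text \<open>The vectors are u 0, ..., u (n - 1). The first relation is their orthonormality, the second one says
  that they span.\<close>

definition orthonormal_frame :: "nat \<Rightarrow> (nat \<Rightarrow> nat \<Rightarrow> complex) \<Rightarrow> bool" where
  "orthonormal_frame n u \<longleftrightarrow>
    (\<forall>i<n. \<forall>j<n. (\<Sum>a<n. cnj (u i a) * u j a) = (if i = j then 1 else 0)) \<and>
    (\<forall>a<n. \<forall>b<n. (\<Sum>j<n. u j a * cnj (u j b)) = (if a = b then 1 else 0))"

lemma conj_index:
  assumes U: "U \<in> carrier_mat n n" and X: "X \<in> carrier_mat n n" and "i < n" "j < n"
  shows "(mat_adjoint U * X * U) $$ (i, j) = (\<Sum>a<n. \<Sum>b<n. cnj (U $$ (a, i)) * X $$ (a, b) * U $$ (b, j))"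
proof -
  have U': "mat_adjoint U \<in> carrier_mat n n" using U by simp
  have UX: "mat_adjoint U * X \<in> carrier_mat n n" using U' X by simp
  have "(mat_adjoint U * X * U) $$ (i, j) = (\<Sum>b<n. (\<Sum>a<n. cnj (U $$ (a, i)) * X $$ (a, b)) * U $$ (b, j))"
    using U X assms(3,4)
    by (simp add: mat_mult_index_sum[OF UX U] mat_mult_index_sum[OF U' X] del: index_mult_mat(1) assoc_mult_mat)
  also have "\<dots> = (\<Sum>b<n. \<Sum>a<n. cnj (U $$ (a, i)) * X $$ (a, b) * U $$ (b, j))"
    by (simp add: sum_distrib_right)
  finally show ?thesis by (subst sum.swap)
qed

lemma proots_linear_factors: "proots (\<Prod>a\<leftarrow>as. [:- a, 1:]) = mset as"
  for as :: "complex list"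
proof (induction as)
  case (Cons a as)
  have "(\<Prod>a\<leftarrow>as. [:- a, 1:]) \<noteq> 0" by (auto simp: prod_list_zero_iff)
  then show ?case using Cons by (simp add: proots_mult del: mult_pCons_left)
qed simp

text \<open>One frame serves all polynomials at once, because the unitary matrix that conjugates A to T also
  conjugates p(A) to p(T).\<close>

lemma schur_triangular_frame:
  assumes A: "A \<in> carrier_mat n n"
  obtains u T where "orthonormal_frame n u" "T \<in> carrier_mat n n"
    "\<And>i j. i < n \<Longrightarrow> j < i \<Longrightarrow> T $$ (i, j) = 0"
    "eigvals A = image_mset (\<lambda>j. T $$ (j, j)) (mset_set {..<n})"
    "\<And>p i j. i < n \<Longrightarrow> j < n \<Longrightarrow>
      (\<Sum>a<n. \<Sum>b<n. cnj (u i a) * poly_mat p A $$ (a, b) * u j b) = poly_mat p T $$ (i, j)"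
proof -
  obtain T U where sim: "similar_mat_wit A T U (mat_adjoint U)" and ut: "upper_triangular T"
    using unitary_schur[OF A] by auto
  note D = similar_mat_witD2[OF A sim]
  note UU = D(1,2) and AU = D(3) and T = D(5) and U = D(6) and U' = D(7)
  define u where "u j a = U $$ (a, j)" for j a
  have "orthonormal_frame n u"
    unfolding orthonormal_frame_def
  proof (intro conjI allI impI)
    fix i j assume "i < n" "j < n"
    then show "(\<Sum>a<n. cnj (u i a) * u j a) = (if i = j then 1 else 0)"
      using arg_cong[OF UU(2), of "\<lambda>M. M $$ (i, j)"] U U'
      by (simp add: mat_mult_index_sum[OF U' U] u_def del: index_mult_mat(1))
  next
    fix a b assume "a < n" "b < n"
    then show "(\<Sum>j<n. u j a * cnj (u j b)) = (if a = b then 1 else 0)"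
      using arg_cong[OF UU(1), of "\<lambda>M. M $$ (a, b)"] U U'
      by (simp add: mat_mult_index_sum[OF U U'] u_def del: index_mult_mat(1))
  qed
  moreover have "\<And>i j. i < n \<Longrightarrow> j < i \<Longrightarrow> T $$ (i, j) = 0" using ut T by auto
  moreover have "eigvals A = image_mset (\<lambda>j. T $$ (j, j)) (mset_set {..<n})"
  proof -
    have "char_poly A = char_poly T"
      using sim by (intro char_poly_similar) (auto simp: similar_mat_def)
    also have "\<dots> = (\<Prod>a\<leftarrow>diag_mat T. [:- a, 1:])" by (rule char_poly_upper_triangular[OF T ut])
    finally have "eigvals A = mset (diag_mat T)" by (simp add: eigvals_def proots_linear_factors)
    also have "\<dots> = image_mset (\<lambda>j. T $$ (j, j)) (mset [0..<n])" using T by (simp add: diag_mat_def)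
    also have "mset [0..<n] = mset_set {..<n}" by (simp add: lessThan_atLeast0)
    finally show ?thesis .
  qed
  moreover have "(\<Sum>a<n. \<Sum>b<n. cnj (u i a) * poly_mat p A $$ (a, b) * u j b) = poly_mat p T $$ (i, j)"
    if "i < n" "j < n" for p i j
  proof -
    have X: "poly_mat p T \<in> carrier_mat n n" using T by (rule poly_mat_carrier)
    have "poly_mat p A = U * poly_mat p T * mat_adjoint U"
      by (subst AU) (rule poly_mat_similar[OF U U' T UU])
    then have "mat_adjoint U * poly_mat p A * U = mat_adjoint U * (U * poly_mat p T * mat_adjoint U) * U"
      by simp
    also have "\<dots> = (mat_adjoint U * U) * (poly_mat p T * (mat_adjoint U * U))"
      using U U' X by (simp add: assoc_mult_mat[of _ n n _ n _ n] mult_carrier_mat[of _ n n _ n])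
    also have "\<dots> = poly_mat p T" unfolding UU using X by simp
    finally show ?thesis using conj_index[OF U poly_mat_carrier[OF A] that, of p]
      by (simp add: u_def)
  qed
  ultimately show ?thesis using T that by blast
qed

text \<open>A nonnormal matrix has no orthonormal eigenbasis, but the diagonal entries of its Schur form still
  express p(\<lambda>_j) as a value of the quadratic form of p(A) at a unit vector. This is how spectral
  information is compared with a Hermitian matrix below.\<close>

lemma schur_frame:
  assumes A: "A \<in> carrier_mat n n"
  obtains u lam where "orthonormal_frame n u"
    "eigvals A = image_mset lam (mset_set {..<n})"
    "\<And>p j. j < n \<Longrightarrow> qform n (poly_mat p A) (u j) = poly p (lam j)"
proof -
  obtain u T where uT: "orthonormal_frame n u" "T \<in> carrier_mat n n"
    "\<And>i j. i < n \<Longrightarrow> j < i \<Longrightarrow> T $$ (i, j) = 0"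
    "eigvals A = image_mset (\<lambda>j. T $$ (j, j)) (mset_set {..<n})"
    "\<And>p i j. i < n \<Longrightarrow> j < n \<Longrightarrow>
      (\<Sum>a<n. \<Sum>b<n. cnj (u i a) * poly_mat p A $$ (a, b) * u j b) = poly_mat p T $$ (i, j)"
    using schur_triangular_frame[OF A] by blast
  show ?thesis
    by (rule that[OF uT(1,4)])
      (use uT(5) poly_mat_triangular[OF uT(2,3)] in \<open>auto simp: qform_def\<close>)
qed

lemma frame_expand:
  assumes u: "orthonormal_frame n u" and "a < n"
  shows "v a = (\<Sum>j<n. u j a * (\<Sum>b<n. cnj (u j b) * v b))"
proof -
  have "(\<Sum>j<n. u j a * (\<Sum>b<n. cnj (u j b) * v b)) = (\<Sum>b<n. (\<Sum>j<n. u j a * cnj (u j b)) * v b)"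
    unfolding sum_distrib_left sum_distrib_right by (subst sum.swap) (simp add: mult_ac)
  also have "\<dots> = (\<Sum>b<n. (if a = b then 1 else 0) * v b)"
    using u \<open>a < n\<close> by (intro sum.cong) (auto simp: orthonormal_frame_def)
  also have "\<dots> = (\<Sum>b<n. if b = a then v b else 0)" by (intro sum.cong) auto
  also have "\<dots> = v a" using \<open>a < n\<close> by (simp add: sum.delta)
  finally show ?thesis by simp
qed

lemma qform_frame_expand:
  assumes u: "orthonormal_frame n u"
  shows "qform n E v = (\<Sum>i<n. \<Sum>j<n. cnj (\<Sum>b<n. cnj (u i b) * v b) *
      (\<Sum>a<n. \<Sum>b<n. cnj (u i a) * E $$ (a, b) * u j b) * (\<Sum>b<n. cnj (u j b) * v b))"
proof -
  define w where "w j = (\<Sum>b<n. cnj (u j b) * v b)" for j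
  have v: "v a = (\<Sum>j<n. u j a * w j)" if "a < n" for a
    using frame_expand[OF u that] by (simp add: w_def)
  have "qform n E v = (\<Sum>a<n. \<Sum>b<n. cnj (\<Sum>i<n. u i a * w i) * E $$ (a, b) * (\<Sum>j<n. u j b * w j))"
    unfolding qform_def by (intro sum.cong refl) (simp add: v)
  also have "\<dots> = (\<Sum>a<n. \<Sum>b<n. \<Sum>i<n. \<Sum>j<n. cnj (w i) * (cnj (u i a) * E $$ (a, b) * u j b) * w j)"
    by (simp add: sum_distrib_left sum_distrib_right mult_ac)
  also have "\<dots> = (\<Sum>a<n. \<Sum>i<n. \<Sum>b<n. \<Sum>j<n. cnj (w i) * (cnj (u i a) * E $$ (a, b) * u j b) * w j)"
    by (rule sum.cong[OF refl], rule sum.swap)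
  also have "\<dots> = (\<Sum>i<n. \<Sum>a<n. \<Sum>j<n. \<Sum>b<n. cnj (w i) * (cnj (u i a) * E $$ (a, b) * u j b) * w j)"
    by (rule trans[OF sum.swap], rule sum.cong[OF refl], rule sum.cong[OF refl], rule sum.swap)
  also have "\<dots> = (\<Sum>i<n. \<Sum>j<n. \<Sum>a<n. \<Sum>b<n. cnj (w i) * (cnj (u i a) * E $$ (a, b) * u j b) * w j)"
    by (rule sum.cong[OF refl], rule sum.swap)
  also have "\<dots> = (\<Sum>i<n. \<Sum>j<n. cnj (w i) * (\<Sum>a<n. \<Sum>b<n. cnj (u i a) * E $$ (a, b) * u j b) * w j)"
    by (simp add: sum_distrib_left sum_distrib_right)
  finally show ?thesis by (simp add: w_def)
qed

text \<open>The triangular matrix T of a Hermitian matrix is itself Hermitian, hence diagonal with real entries,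
  and the quadratic form of p(A) becomes a combination of the p(\<lambda>_j) with nonnegative weights.\<close>

lemma hermitian_spectral:
  assumes A: "A \<in> carrier_mat n n" and herm: "\<And>i j. i < n \<Longrightarrow> j < n \<Longrightarrow> A $$ (j, i) = cnj (A $$ (i, j))"
  shows "\<forall>z\<in>#eigvals A. Im z = 0"
    and "(\<And>z. z \<in># eigvals A \<Longrightarrow> Re (poly p z) \<le> 0) \<Longrightarrow> Re (qform n (poly_mat p A) v) \<le> 0"
proof -
  obtain u T where uT: "orthonormal_frame n u" "T \<in> carrier_mat n n"
    "\<And>i j. i < n \<Longrightarrow> j < i \<Longrightarrow> T $$ (i, j) = 0"
    "eigvals A = image_mset (\<lambda>j. T $$ (j, j)) (mset_set {..<n})"
    "\<And>p i j. i < n \<Longrightarrow> j < n \<Longrightarrow>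
      (\<Sum>a<n. \<Sum>b<n. cnj (u i a) * poly_mat p A $$ (a, b) * u j b) = poly_mat p T $$ (i, j)"
    using schur_triangular_frame[OF A] by blast
  have Tij: "T $$ (i, j) = (\<Sum>a<n. \<Sum>b<n. cnj (u i a) * A $$ (a, b) * u j b)" if "i < n" "j < n" for i j
    using uT(5)[OF that, of "[:0, 1:]"] by (simp add: poly_mat_X[OF A] poly_mat_X[OF uT(2)])
  have Tc: "T $$ (j, i) = cnj (T $$ (i, j))" if "i < n" "j < n" for i j
  proof -
    have "cnj (T $$ (i, j)) = (\<Sum>a<n. \<Sum>b<n. cnj (u j b) * A $$ (b, a) * u i a)"
      unfolding Tij[OF that] cnj_sum by (intro sum.cong refl) (simp add: mult_ac herm[symmetric])
    also have "\<dots> = T $$ (j, i)" unfolding Tij[OF that(2,1)] by (rule sum.swap)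
    finally show ?thesis by simp
  qed
  have real: "Im (T $$ (j, j)) = 0" if "j < n" for j
    using arg_cong[OF Tc[OF that that], of Im] by simp
  then show "\<forall>z\<in>#eigvals A. Im z = 0" by (auto simp: uT(4))
  have off: "T $$ (i, j) = 0" if "i < n" "j < n" "i \<noteq> j" for i j
  proof (cases "j < i")
    case False
    then have "T $$ (j, i) = 0" using that by (intro uT(3)) auto
    then show ?thesis using Tc[OF that(2,1)] by simp
  qed (use uT(3) that in blast)
  have diag: "poly_mat p T $$ (i, j) = (if i = j then poly p (T $$ (i, i)) else 0)" if "i < n" "j < n" for i j
  proof (cases "i = j \<or> j < i")
    case True
    then show ?thesis using poly_mat_triangular[OF uT(2,3), of p] that by auto
  next
    case False
    have *: "\<forall>j<n. \<forall>i<j. poly_mat p T $$ (i, j) = 0"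
    proof (induction p)
      case 0
      then show ?case using uT(2) by (simp add: poly_mat_0[of _ n])
    next
      case (pCons c p)
      have X: "poly_mat p T \<in> carrier_mat n n" using uT(2) by (rule poly_mat_carrier)
      have "(\<Sum>l<n. T $$ (i, l) * poly_mat p T $$ (l, j)) = 0" if "j < n" "i < j" for i j
      proof (intro sum.neutral ballI)
        fix l assume "l \<in> {..<n}"
        then show "T $$ (i, l) * poly_mat p T $$ (l, j) = 0"
          using off[of i l] pCons.IH that by (cases "i = l") auto
      qed
      then show ?case using X uT(2)
        by (auto simp: poly_mat_pCons[of _ n] mat_mult_index_sum[OF uT(2) X] simp del: index_mult_mat(1))
    qed
    then show ?thesis using False that by auto
  qed
  assume p: "\<And>z. z \<in># eigvals A \<Longrightarrow> Re (poly p z) \<le> 0"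
  define w where "w j = (\<Sum>b<n. cnj (u j b) * v b)" for j
  have "qform n (poly_mat p A) v = (\<Sum>i<n. \<Sum>j<n. cnj (w i) * (if i = j then poly p (T $$ (i, i)) else 0) * w j)"
    unfolding qform_frame_expand[OF uT(1)] w_def[symmetric] by (intro sum.cong refl) (simp add: uT(5) diag)
  also have "\<dots> = (\<Sum>i<n. \<Sum>j<n. if j = i then cnj (w i) * poly p (T $$ (i, i)) * w i else 0)"
    by (intro sum.cong refl) auto
  also have "\<dots> = (\<Sum>i<n. cnj (w i) * poly p (T $$ (i, i)) * w i)" by (simp add: sum.delta)
  also have "\<dots> = (\<Sum>i<n. complex_of_real ((cmod (w i))\<^sup>2) * poly p (T $$ (i, i)))"
    unfolding complex_norm_square by (intro sum.cong refl) (simp add: mult_ac)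
  finally have "Re (qform n (poly_mat p A) v) = (\<Sum>i<n. (cmod (w i))\<^sup>2 * Re (poly p (T $$ (i, i))))"
    by simp
  also have "\<dots> \<le> 0" using p by (intro sum_nonpos) (auto simp: uT(4) mult_nonneg_nonpos)
  finally show "Re (qform n (poly_mat p A) v) \<le> 0" .
qed

section \<open>Entrywise summation norm and eigenvalue counts\<close>

text \<open>An upper bound for the trace norm that is computed from the entries alone.\<close>

definition l1_norm :: "nat \<Rightarrow> complex mat \<Rightarrow> real" where
  "l1_norm n E = (\<Sum>a<n. \<Sum>b<n. cmod (E $$ (a, b)))"

definition row_bounded :: "nat \<Rightarrow> real \<Rightarrow> complex mat \<Rightarrow> bool" where
  "row_bounded n K E \<longleftrightarrow> (\<forall>a<n. (\<Sum>b<n. cmod (E $$ (a, b))) \<le> K)"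

definition col_bounded :: "nat \<Rightarrow> real \<Rightarrow> complex mat \<Rightarrow> bool" where
  "col_bounded n K E \<longleftrightarrow> (\<forall>b<n. (\<Sum>a<n. cmod (E $$ (a, b))) \<le> K)"

lemma l1_add:
  assumes "A \<in> carrier_mat n n" "B \<in> carrier_mat n n"
  shows "l1_norm n (A + B) \<le> l1_norm n A + l1_norm n B"
proof -
  have "l1_norm n (A + B) \<le> (\<Sum>a<n. \<Sum>b<n. cmod (A $$ (a, b)) + cmod (B $$ (a, b)))"
    unfolding l1_norm_def using assms by (intro sum_mono) (simp add: norm_triangle_ineq)
  then show ?thesis by (simp add: l1_norm_def sum.distrib)
qed

lemma l1_mult_left:
  assumes A: "A \<in> carrier_mat n n" and X: "X \<in> carrier_mat n n" and "col_bounded n K A"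
  shows "l1_norm n (A * X) \<le> K * l1_norm n X"
proof -
  have "l1_norm n (A * X) \<le> (\<Sum>a<n. \<Sum>b<n. \<Sum>l<n. cmod (A $$ (a, l)) * cmod (X $$ (l, b)))"
    unfolding l1_norm_def
    by (intro sum_mono) (auto simp: mat_mult_index_sum[OF A X] norm_mult[symmetric] simp del: index_mult_mat(1)
        intro!: norm_sum)
  also have "\<dots> = (\<Sum>a<n. \<Sum>l<n. \<Sum>b<n. cmod (A $$ (a, l)) * cmod (X $$ (l, b)))"
    by (rule sum.cong[OF refl], rule sum.swap)
  also have "\<dots> = (\<Sum>l<n. \<Sum>a<n. \<Sum>b<n. cmod (A $$ (a, l)) * cmod (X $$ (l, b)))"
    by (rule sum.swap)
  also have "\<dots> = (\<Sum>l<n. (\<Sum>a<n. cmod (A $$ (a, l))) * (\<Sum>b<n. cmod (X $$ (l, b))))"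
    by (simp only: sum_product)
  also have "\<dots> \<le> (\<Sum>l<n. K * (\<Sum>b<n. cmod (X $$ (l, b))))"
    using assms(3) by (intro sum_mono mult_right_mono) (auto simp: col_bounded_def sum_nonneg)
  also have "\<dots> = K * l1_norm n X" by (simp add: l1_norm_def sum_distrib_left)
  finally show ?thesis .
qed

lemma l1_mult_right:
  assumes X: "X \<in> carrier_mat n n" and Y: "Y \<in> carrier_mat n n" and "row_bounded n K Y"
  shows "l1_norm n (X * Y) \<le> l1_norm n X * K"
proof -
  have "l1_norm n (X * Y) \<le> (\<Sum>a<n. \<Sum>b<n. \<Sum>l<n. cmod (X $$ (a, l)) * cmod (Y $$ (l, b)))"
    unfolding l1_norm_def
    by (intro sum_mono) (auto simp: mat_mult_index_sum[OF X Y] norm_mult[symmetric] simp del: index_mult_mat(1)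
        intro!: norm_sum)
  also have "\<dots> = (\<Sum>a<n. \<Sum>l<n. \<Sum>b<n. cmod (X $$ (a, l)) * cmod (Y $$ (l, b)))"
    by (rule sum.cong[OF refl], rule sum.swap)
  also have "\<dots> = (\<Sum>a<n. \<Sum>l<n. cmod (X $$ (a, l)) * (\<Sum>b<n. cmod (Y $$ (l, b))))"
    by (simp add: sum_distrib_left)
  also have "\<dots> \<le> (\<Sum>a<n. \<Sum>l<n. cmod (X $$ (a, l)) * K)"
    using assms(3) by (intro sum_mono mult_left_mono) (auto simp: row_bounded_def)
  also have "\<dots> = l1_norm n X * K" by (simp add: l1_norm_def sum_distrib_right)
  finally show ?thesis .
qed

lemma row_bounded_mult:
  assumes A: "A \<in> carrier_mat n n" and B: "B \<in> carrier_mat n n"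
    and "row_bounded n K A" "row_bounded n L B" "L \<ge> 0"
  shows "row_bounded n (K * L) (A * B)"
  unfolding row_bounded_def
proof (intro allI impI)
  fix a assume a: "a < n"
  have "(\<Sum>b<n. cmod ((A * B) $$ (a, b))) \<le> (\<Sum>b<n. \<Sum>l<n. cmod (A $$ (a, l)) * cmod (B $$ (l, b)))"
    using a by (intro sum_mono) (auto simp: mat_mult_index_sum[OF A B] norm_mult[symmetric] simp del: index_mult_mat(1)
        intro!: norm_sum)
  also have "\<dots> = (\<Sum>l<n. cmod (A $$ (a, l)) * (\<Sum>b<n. cmod (B $$ (l, b))))"
    by (subst sum.swap) (simp add: sum_distrib_left)
  also have "\<dots> \<le> (\<Sum>l<n. cmod (A $$ (a, l)) * L)"
    using assms(4) by (intro sum_mono mult_left_mono) (auto simp: row_bounded_def)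
  also have "\<dots> = (\<Sum>l<n. cmod (A $$ (a, l))) * L" by (simp add: sum_distrib_right)
  also have "\<dots> \<le> K * L" using assms(3,5) a by (intro mult_right_mono) (auto simp: row_bounded_def)
  finally show "(\<Sum>b<n. cmod ((A * B) $$ (a, b))) \<le> K * L" .
qed

lemma poly_mat_row_bounded:
  assumes "K \<ge> 0"
  shows "\<exists>L\<ge>0. \<forall>n B. B \<in> carrier_mat n n \<longrightarrow> row_bounded n K B \<longrightarrow> row_bounded n L (poly_mat p B)"
proof (induction p)
  case 0
  show ?case by (rule exI[of _ 0]) (auto simp: poly_mat_0 row_bounded_def)
next
  case (pCons c p)
  then obtain L where L: "L \<ge> 0"
    "\<And>n B. B \<in> carrier_mat n n \<Longrightarrow> row_bounded n K B \<Longrightarrow> row_bounded n L (poly_mat p B)" by auto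
  have "row_bounded n (cmod c + K * L) (poly_mat (pCons c p) B)"
    if B: "B \<in> carrier_mat n n" "row_bounded n K B" for n B
    unfolding row_bounded_def
  proof (intro allI impI)
    fix a assume a: "a < n"
    have X: "poly_mat p B \<in> carrier_mat n n" using B(1) by (rule poly_mat_carrier)
    have "(\<Sum>b<n. cmod (poly_mat (pCons c p) B $$ (a, b))) \<le>
        (\<Sum>b<n. (if b = a then cmod c else 0) + cmod ((B * poly_mat p B) $$ (a, b)))"
      using a B(1) X by (intro sum_mono)
        (auto simp: poly_mat_pCons[OF B(1)] intro: norm_triangle_ineq simp del: index_mult_mat(1))
    also have "\<dots> = cmod c + (\<Sum>b<n. cmod ((B * poly_mat p B) $$ (a, b)))"
      using a by (simp add: sum.distrib sum.delta)
    also have "\<dots> \<le> cmod c + K * L"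
      using row_bounded_mult[OF B(1) X B(2) L(2)[OF B] L(1)] a by (simp add: row_bounded_def)
    finally show "(\<Sum>b<n. cmod (poly_mat (pCons c p) B $$ (a, b))) \<le> cmod c + K * L" .
  qed
  then show ?case using L assms by (intro exI[of _ "cmod c + K * L"]) auto
qed

text \<open>The step is A X - B Y = A (X - Y) + (A - B) Y. The constant depends on p and K only; its independence
  of n is what makes perturbations of bounded size harmless.\<close>

lemma poly_mat_l1_lipschitz:
  assumes K: "K \<ge> 0"
  shows "\<exists>L\<ge>0. \<forall>n A B. A \<in> carrier_mat n n \<longrightarrow> B \<in> carrier_mat n n \<longrightarrow> col_bounded n K A \<longrightarrow>
    row_bounded n K B \<longrightarrow> l1_norm n (poly_mat p A - poly_mat p B) \<le> L * l1_norm n (A - B)"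
proof (induction p)
  case 0
  have "l1_norm n (poly_mat 0 A - poly_mat 0 B) \<le> 0 * l1_norm n (A - B)" 
    if "A \<in> carrier_mat n n" "B \<in> carrier_mat n n" for n A B
    using that by (simp add: poly_mat_0 l1_norm_def)
  then show ?case by blast
next
  case (pCons c p)
  then obtain L where L: "L \<ge> 0"
    "\<And>n A B. A \<in> carrier_mat n n \<Longrightarrow> B \<in> carrier_mat n n \<Longrightarrow> col_bounded n K A \<Longrightarrow> row_bounded n K B
      \<Longrightarrow> l1_norm n (poly_mat p A - poly_mat p B) \<le> L * l1_norm n (A - B)" by blast
  obtain M where M: "M \<ge> 0"
    "\<And>n B. B \<in> carrier_mat n n \<Longrightarrow> row_bounded n K B \<Longrightarrow> row_bounded n M (poly_mat p B)"
    using poly_mat_row_bounded[OF K, of p] by blast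
  have "l1_norm n (poly_mat (pCons c p) A - poly_mat (pCons c p) B) \<le> (K * L + M) * l1_norm n (A - B)"
    if A: "A \<in> carrier_mat n n" and B: "B \<in> carrier_mat n n" and cA: "col_bounded n K A"
      and rB: "row_bounded n K B" for n A B
  proof -
    define X Y where "X = poly_mat p A" and "Y = poly_mat p B"
    have X: "X \<in> carrier_mat n n" and Y: "Y \<in> carrier_mat n n"
      using A B by (auto simp: X_def Y_def intro: poly_mat_carrier)
    have XY: "X - Y \<in> carrier_mat n n" and AB: "A - B \<in> carrier_mat n n" using X Y A B by auto
    have "poly_mat (pCons c p) A - poly_mat (pCons c p) B = A * (X - Y) + (A - B) * Y"
      unfolding poly_mat_pCons[OF A] poly_mat_pCons[OF B] X_def[symmetric] Y_def[symmetric]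
      unfolding mult_minus_distrib_mat[OF A X Y] minus_mult_distrib_mat[OF A B Y]
      by (rule eq_matI) (use A B X Y in auto)
    then have "l1_norm n (poly_mat (pCons c p) A - poly_mat (pCons c p) B) \<le> l1_norm n (A * (X - Y)) + l1_norm n ((A - B) * Y)"
      using l1_add[of "A * (X - Y)" n "(A - B) * Y"] A AB XY Y by auto
    also have "\<dots> \<le> K * l1_norm n (X - Y) + l1_norm n (A - B) * M"
      using l1_mult_left[OF A XY cA] l1_mult_right[OF AB Y] M(2)[OF B rB] by (fastforce simp: Y_def)
    also have "K * l1_norm n (X - Y) \<le> K * (L * l1_norm n (A - B))"
      using L(2)[OF A B cA rB] K by (intro mult_left_mono) (auto simp: X_def Y_def)
    finally show ?thesis by (simp add: algebra_simps)
  qed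
  then show ?case using L M K by (intro exI[of _ "K * L + M"]) auto
qed

lemma frame_row_norm:
  assumes "orthonormal_frame n u" "a < n"
  shows "(\<Sum>j<n. (cmod (u j a))\<^sup>2) = 1"
proof -
  have "complex_of_real (\<Sum>j<n. (cmod (u j a))\<^sup>2) = (\<Sum>j<n. u j a * cnj (u j a))"
    by (simp add: complex_norm_square del: of_real_power flip: of_real_power)
  also have "\<dots> = 1" using assms by (simp add: orthonormal_frame_def)
  finally show ?thesis by (simp only: of_real_eq_1_iff)
qed

lemma frame_col_norm:
  assumes "orthonormal_frame n u" "j < n"
  shows "(\<Sum>a<n. (cmod (u j a))\<^sup>2) = 1"
proof -
  have "complex_of_real (\<Sum>a<n. (cmod (u j a))\<^sup>2) = (\<Sum>a<n. cnj (u j a) * u j a)"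
    by (simp add: complex_norm_square mult.commute del: of_real_power flip: of_real_power)
  also have "\<dots> = 1" using assms by (simp add: orthonormal_frame_def)
  finally show ?thesis by (simp only: of_real_eq_1_iff)
qed

lemma mult_le_mean_squares: "x * y \<le> (x\<^sup>2 + y\<^sup>2) / 2" for x y :: real
  using sum_squares_bound[of x y] by simp

lemma norm_qform_le:
  "cmod (qform n E v) \<le> (\<Sum>a<n. \<Sum>b<n. cmod (E $$ (a, b)) * (((cmod (v a))\<^sup>2 + (cmod (v b))\<^sup>2) / 2))"
proof -
  have "cmod (qform n E v) \<le> (\<Sum>a<n. \<Sum>b<n. cmod (cnj (v a) * E $$ (a, b) * v b))"
    unfolding qform_def by (intro order_trans[OF norm_sum] sum_mono norm_sum)
  also have "\<dots> \<le> (\<Sum>a<n. \<Sum>b<n. cmod (E $$ (a, b)) * (((cmod (v a))\<^sup>2 + (cmod (v b))\<^sup>2) / 2))"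
  proof (intro sum_mono)
    fix a b
    have "cmod (cnj (v a) * E $$ (a, b) * v b) = cmod (E $$ (a, b)) * (cmod (v a) * cmod (v b))"
      by (simp add: norm_mult)
    also have "\<dots> \<le> cmod (E $$ (a, b)) * (((cmod (v a))\<^sup>2 + (cmod (v b))\<^sup>2) / 2)"
      by (intro mult_left_mono mult_le_mean_squares) simp
    finally show "cmod (cnj (v a) * E $$ (a, b) * v b) \<le> \<dots>" .
  qed
  finally show ?thesis .
qed

text \<open>By the inequality between the arithmetic and the geometric mean, each entry E(a,b) is weighted with
  the mean of the squared moduli of u j a and u j b; summed over j these weights are 1.\<close>

lemma sum_norm_qform_le_l1:
  assumes u: "orthonormal_frame n u"
  shows "(\<Sum>j<n. cmod (qform n E (u j))) \<le> l1_norm n E"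
proof -
  have "(\<Sum>j<n. cmod (qform n E (u j))) \<le>
      (\<Sum>j<n. \<Sum>a<n. \<Sum>b<n. cmod (E $$ (a, b)) * (((cmod (u j a))\<^sup>2 + (cmod (u j b))\<^sup>2) / 2))"
    by (intro sum_mono norm_qform_le)
  also have "\<dots> = (\<Sum>a<n. \<Sum>j<n. \<Sum>b<n. cmod (E $$ (a, b)) * (((cmod (u j a))\<^sup>2 + (cmod (u j b))\<^sup>2) / 2))"
    by (rule sum.swap)
  also have "\<dots> = (\<Sum>a<n. \<Sum>b<n. \<Sum>j<n. cmod (E $$ (a, b)) * (((cmod (u j a))\<^sup>2 + (cmod (u j b))\<^sup>2) / 2))"
    by (rule sum.cong[OF refl], rule sum.swap)
  also have "\<dots> = (\<Sum>a<n. \<Sum>b<n. cmod (E $$ (a, b)) *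
      (((\<Sum>j<n. (cmod (u j a))\<^sup>2) + (\<Sum>j<n. (cmod (u j b))\<^sup>2)) / 2))"
    by (simp only: sum_distrib_left[symmetric] sum.distrib sum_divide_distrib[symmetric])
  also have "\<dots> = l1_norm n E"
    unfolding l1_norm_def by (intro sum.cong refl) (simp add: frame_row_norm[OF u])
  finally show ?thesis .
qed

lemma sum_qform_eq_trace:
  assumes u: "orthonormal_frame n u"
  shows "(\<Sum>j<n. qform n E (u j)) = (\<Sum>a<n. E $$ (a, a))"
proof -
  have "(\<Sum>j<n. qform n E (u j)) = (\<Sum>a<n. \<Sum>j<n. \<Sum>b<n. cnj (u j a) * E $$ (a, b) * u j b)"
    unfolding qform_def by (rule sum.swap)
  also have "\<dots> = (\<Sum>a<n. \<Sum>b<n. \<Sum>j<n. cnj (u j a) * E $$ (a, b) * u j b)"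
    by (rule sum.cong[OF refl], rule sum.swap)
  also have "\<dots> = (\<Sum>a<n. \<Sum>b<n. E $$ (a, b) * (\<Sum>j<n. u j b * cnj (u j a)))"
    by (simp add: sum_distrib_left mult_ac)
  also have "\<dots> = (\<Sum>a<n. \<Sum>b<n. if b = a then E $$ (a, a) else 0)"
    using u by (intro sum.cong refl) (auto simp: orthonormal_frame_def)
  also have "\<dots> = (\<Sum>a<n. E $$ (a, a))" by (simp add: sum.delta)
  finally show ?thesis .
qed

lemma sum_mset_image_mset_set:
  "(\<Sum>z\<in>#image_mset f (mset_set {..<n::nat}). g z) = (\<Sum>j<n. g (f j))"
  by (simp add: sum_unfold_sum_mset multiset.map_comp o_def)

lemma trace_poly_mat:
  assumes A: "A \<in> carrier_mat n n"
  shows "(\<Sum>a<n. poly_mat p A $$ (a, a)) = (\<Sum>z\<in>#eigvals A. poly p z)"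
proof -
  obtain u lam where u: "orthonormal_frame n u" "eigvals A = image_mset lam (mset_set {..<n})"
    "\<And>p j. j < n \<Longrightarrow> qform n (poly_mat p A) (u j) = poly p (lam j)"
    using schur_frame[OF A] by blast
  show ?thesis unfolding u(2) sum_mset_image_mset_set sum_qform_eq_trace[OF u(1), symmetric]
    by (intro sum.cong refl) (simp add: u(3))
qed

lemma size_eigvals: "A \<in> carrier_mat n n \<Longrightarrow> size (eigvals A) = n"
  using size_proots_complex[of "char_poly A"] degree_monic_char_poly[of A n] by (simp add: eigvals_def)

text \<open>This is Schur's test, applied to the quadratic form at a vector of the Schur frame.\<close>

lemma norm_eigval_le:
  assumes A: "A \<in> carrier_mat n n" and b: "row_bounded n K A" "col_bounded n K A" and z: "z \<in># eigvals A"
  shows "cmod z \<le> K"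
proof -
  obtain u lam where u: "orthonormal_frame n u" "eigvals A = image_mset lam (mset_set {..<n})"
    "\<And>p j. j < n \<Longrightarrow> qform n (poly_mat p A) (u j) = poly p (lam j)"
    using schur_frame[OF A] by blast
  obtain j where j: "j < n" "z = lam j" using z by (auto simp: u(2))
  have "z = qform n A (u j)" using u(3)[OF j(1), of "[:0, 1:]"] j by (simp add: poly_mat_X[OF A])
  then have "cmod z \<le> (\<Sum>a<n. \<Sum>b<n. cmod (A $$ (a, b)) * (((cmod (u j a))\<^sup>2 + (cmod (u j b))\<^sup>2) / 2))"
    using norm_qform_le by simp
  also have "\<dots> = (\<Sum>a<n. \<Sum>b<n. cmod (A $$ (a, b)) * ((cmod (u j a))\<^sup>2 / 2)) +
      (\<Sum>a<n. \<Sum>b<n. cmod (A $$ (a, b)) * ((cmod (u j b))\<^sup>2 / 2))"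
    by (simp only: add_divide_distrib distrib_left sum.distrib)
  also have "(\<Sum>a<n. \<Sum>b<n. cmod (A $$ (a, b)) * ((cmod (u j b))\<^sup>2 / 2)) =
      (\<Sum>b<n. \<Sum>a<n. cmod (A $$ (a, b)) * ((cmod (u j b))\<^sup>2 / 2))"
    by (rule sum.swap)
  also have "(\<Sum>a<n. \<Sum>b<n. cmod (A $$ (a, b)) * ((cmod (u j a))\<^sup>2 / 2)) \<le> (\<Sum>a<n. K * ((cmod (u j a))\<^sup>2 / 2))"
    unfolding sum_distrib_right[symmetric] using b(1)
    by (intro sum_mono mult_right_mono) (auto simp: row_bounded_def)
  also have "(\<Sum>b<n. \<Sum>a<n. cmod (A $$ (a, b)) * ((cmod (u j b))\<^sup>2 / 2)) \<le> (\<Sum>a<n. K * ((cmod (u j a))\<^sup>2 / 2))"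
    unfolding sum_distrib_right[symmetric] using b(2)
    by (intro sum_mono mult_right_mono) (auto simp: col_bounded_def)
  also have "(\<Sum>a<n. K * ((cmod (u j a))\<^sup>2 / 2)) = K / 2 * (\<Sum>a<n. (cmod (u j a))\<^sup>2)"
    by (simp add: sum_distrib_left)
  also have "\<dots> = K / 2" by (simp add: frame_col_norm[OF u(1) j(1)])
  finally show ?thesis by simp
qed

text \<open>For each vector of a Schur frame of A, Re p(\<lambda>_j) is the value of the form of H, which is nonpositive,
  plus the value of the form of p(A) - H. The moduli of the latter values add up to at most the
  entrywise norm of p(A) - H.\<close>

lemma eigval_count_le_l1:
  assumes A: "A \<in> carrier_mat n n" and H: "H \<in> carrier_mat n n"
    and neg: "\<And>v. Re (qform n H v) \<le> 0" and d: "\<delta> > 0"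
  shows "\<delta> * size {#z \<in># eigvals A. Re (poly p z) \<ge> \<delta>#} \<le> l1_norm n (poly_mat p A - H)"
proof -
  obtain u lam where u: "orthonormal_frame n u" "eigvals A = image_mset lam (mset_set {..<n})"
    "\<And>p j. j < n \<Longrightarrow> qform n (poly_mat p A) (u j) = poly p (lam j)"
    using schur_frame[OF A] by blast
  define E where "E = poly_mat p A - H"
  have X: "poly_mat p A \<in> carrier_mat n n" using A by (rule poly_mat_carrier)
  have qE: "qform n (poly_mat p A) v = qform n H v + qform n E v" for v
    unfolding qform_def sum.distrib[symmetric]
    by (intro sum.cong refl) (use X H in \<open>simp add: E_def algebra_simps\<close>)
  have le: "Re (poly p (lam j)) \<le> cmod (qform n E (u j))" if "j < n" for j
    using arg_cong[OF u(3)[OF that, of p], of Re] neg[of "u j"] complex_Re_le_cmod[of "qform n E (u j)"] by (simp add: qE)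
  define I where "I = {j\<in>{..<n}. Re (poly p (lam j)) \<ge> \<delta>}"
  have "size {#z \<in># eigvals A. Re (poly p z) \<ge> \<delta>#} = card I"
    by (simp add: u(2) filter_mset_image_mset I_def)
  then have "\<delta> * size {#z \<in># eigvals A. Re (poly p z) \<ge> \<delta>#} = (\<Sum>j\<in>I. \<delta>)" by simp
  also have "\<dots> \<le> (\<Sum>j\<in>I. cmod (qform n E (u j)))" using le by (intro sum_mono) (force simp: I_def)
  also have "\<dots> \<le> (\<Sum>j<n. cmod (qform n E (u j)))" by (intro sum_mono2) (auto simp: I_def)
  also have "\<dots> \<le> l1_norm n E" by (rule sum_norm_qform_le_l1[OF u(1)])
  finally show ?thesis by (simp add: E_def)
qed

lemma trace_le_l1: "cmod (\<Sum>a<n. E $$ (a, a)) \<le> l1_norm n E"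
proof -
  have "cmod (\<Sum>a<n. E $$ (a, a)) \<le> (\<Sum>a<n. cmod (E $$ (a, a)))" by (rule norm_sum)
  also have "\<dots> \<le> l1_norm n E" unfolding l1_norm_def
  proof (rule sum_mono)
    fix a assume "a \<in> {..<n}"
    then show "cmod (E $$ (a, a)) \<le> (\<Sum>b<n. cmod (E $$ (a, b)))" 
      by (intro member_le_sum[of a "{..<n}" "\<lambda>b. cmod (E $$ (a, b))"]) auto
  qed
  finally show ?thesis .
qed

section \<open>Clustering and attraction from a Hermitian model\<close>

lemma size_filter_le_sum:
  assumes "finite T" "\<And>z. z \<in># M \<Longrightarrow> P z \<Longrightarrow> \<exists>t\<in>T. Q t z"
  shows "size (filter_mset P M) \<le> (\<Sum>t\<in>T. size (filter_mset (Q t) M))"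
  using assms(2)
proof (induction M)
  case (add x M)
  have IH: "size (filter_mset P M) \<le> (\<Sum>t\<in>T. size (filter_mset (Q t) M))"
    using add by auto
  have "(if P x then 1 else 0) \<le> (\<Sum>t\<in>T. if Q t x then 1 else (0::nat))"
  proof (cases "P x")
    case True
    then obtain t where t: "t \<in> T" "Q t x" using add.prems[of x] by auto
    have "(if Q t x then 1 else (0::nat)) \<le> (\<Sum>t\<in>T. if Q t x then 1 else (0::nat))"
      using t(1) assms(1) by (intro member_le_sum[of t T "\<lambda>t. if Q t x then 1 else (0::nat)"]) auto
    then show ?thesis using t(2) by simp
  qed simp
  moreover have "size (filter_mset R (add_mset x M)) = (if R x then 1 else 0) + size (filter_mset R M)" for R
    by simp
  ultimately show ?case using IH by (simp only: sum.distrib add_mono)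
qed simp

text \<open>A sequence A of arbitrary matrices is compared with matrices C whose spectrum is confined to a closed
  set S of reals. The confinement is expressed by the last assumption, through quadratic forms, which
  needs no diagonalisation of C.\<close>

locale hermitian_model =
  fixes A C :: "nat \<Rightarrow> complex mat" and S :: "complex set" and K B :: real
  assumes carrier: "\<And>n. A n \<in> carrier_mat n n" "\<And>n. C n \<in> carrier_mat n n"
    and rows: "\<And>n. row_bounded n K (A n)" "\<And>n. row_bounded n K (C n)"
    and cols: "\<And>n. col_bounded n K (A n)"
    and l1_diff: "\<And>n. l1_norm n (A n - C n) \<le> B"
    and S: "S \<noteq> {}" "closed S" "\<And>s. s \<in> S \<Longrightarrow> Im s = 0" "\<And>s. s \<in> S \<Longrightarrow> cmod s \<le> K"
    and neg: "\<And>p n v. (\<And>s. s \<in> S \<Longrightarrow> Re (poly p s) \<le> 0) \<Longrightarrow> Re (qform n (poly_mat p (C n)) v) \<le> 0"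
begin

lemma K_nonneg: "K \<ge> 0"
  using S(1,4) norm_ge_zero order_trans by blast

lemma poly_l1_diff: "\<exists>L. \<forall>n. l1_norm n (poly_mat p (A n) - poly_mat p (C n)) \<le> L"
proof -
  obtain L where L: "L \<ge> 0" "\<And>n A B. A \<in> carrier_mat n n \<Longrightarrow> B \<in> carrier_mat n n \<Longrightarrow> col_bounded n K A \<Longrightarrow>
    row_bounded n K B \<Longrightarrow> l1_norm n (poly_mat p A - poly_mat p B) \<le> L * l1_norm n (A - B)"
    using poly_mat_l1_lipschitz[OF K_nonneg, of p] by blast
  have "l1_norm n (poly_mat p (A n) - poly_mat p (C n)) \<le> L * B" for n
    using L(2)[OF carrier(1,2) cols rows(2)] mult_left_mono[OF l1_diff L(1)] by (rule order_trans)
  then show ?thesis by blast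
qed

lemma poly_count_bounded:
  assumes p: "\<And>s. s \<in> S \<Longrightarrow> Re (poly p s) \<le> 0" and d: "\<delta> > 0"
  shows "\<exists>c::nat. \<forall>n. size {#z \<in># eigvals (A n). Re (poly p z) \<ge> \<delta>#} \<le> c"
proof -
  obtain L where L: "\<And>n. l1_norm n (poly_mat p (A n) - poly_mat p (C n)) \<le> L"
    using poly_l1_diff by blast
  have "size {#z \<in># eigvals (A n). Re (poly p z) \<ge> \<delta>#} \<le> nat \<lceil>L / \<delta>\<rceil>" for n
  proof -
    have "\<delta> * size {#z \<in># eigvals (A n). Re (poly p z) \<ge> \<delta>#} \<le> L"
      using eigval_count_le_l1[OF carrier(1) poly_mat_carrier[OF carrier(2)] neg[OF p] d] L by (rule order_trans)
    then have "real (size {#z \<in># eigvals (A n). Re (poly p z) \<ge> \<delta>#}) \<le> L / \<delta>"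
      using d by (simp add: field_simps)
    then show ?thesis by linarith
  qed
  then show ?thesis by blast
qed

text \<open>For nonreal z a purely imaginary multiple of x works: its real part vanishes on the real line. For
  real z at distance d from S the parabola d^2 - (x - z)^2 works.\<close>

lemma separating_polynomial:
  assumes "z \<notin> S"
  shows "\<exists>p. (\<forall>s\<in>S. Re (poly p s) \<le> 0) \<and> Re (poly p z) > 0"
proof (cases "Im z = 0")
  case False
  have "Re (poly [:0, - \<i> * of_real (Im z):] s) = Im z * Im s" for s by simp
  moreover have "Im z * Im z > 0" using False by (simp add: zero_less_mult_iff) linarith
  ultimately show ?thesis using S(3) by (intro exI[of _ "[:0, - \<i> * of_real (Im z):]"]) auto
next
  case True
  obtain d where d: "d > 0" "\<And>s. s \<in> S \<Longrightarrow> d \<le> dist z s"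
    using separate_point_closed[OF S(2) assms] by auto
  have p: "poly [:of_real (d\<^sup>2) - z\<^sup>2, 2 * z, -1:] x = of_real (d\<^sup>2) - (x - z)\<^sup>2" for x
    by (simp add: power2_eq_square algebra_simps)
  have "Re (of_real (d\<^sup>2) - (s - z)\<^sup>2) \<le> 0" if s: "s \<in> S" for s
  proof -
    have "d \<le> \<bar>Re s - Re z\<bar>" using d(2)[OF s] S(3)[OF s] True
      by (simp add: dist_norm cmod_def power2_commute[of "Re z"])
    then have "d\<^sup>2 \<le> (Re s - Re z)\<^sup>2" using d(1) by (metis abs_le_square_iff abs_of_pos)
    then show ?thesis using S(3)[OF s] True by (simp add: power2_eq_square)
  qed
  then show ?thesis using d(1)
    by (intro exI[of _ "[:of_real (d\<^sup>2) - z\<^sup>2, 2 * z, -1:]"]) (simp add: p del: poly_pCons of_real_power)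
qed

text \<open>The eigenvalues lie in a fixed disc. The part of the disc away from S is compact and is covered by
  finitely many sets Re p > \<delta> with p nonpositive on S, each containing boundedly many eigenvalues.\<close>

theorem clustered: "strongly_clustered A S"
  unfolding strongly_clustered_def
proof (intro conjI allI impI)
  fix \<epsilon> :: real assume e: "\<epsilon> > 0"
  have openD: "open (disc_nbhd S \<epsilon>)"
  proof -
    have "disc_nbhd S \<epsilon> = (\<Union>s\<in>S. ball s \<epsilon>)"
      by (auto simp: disc_nbhd_def dist_norm norm_minus_commute)
    then show ?thesis by (auto intro: open_UN)
  qed
  define Z where "Z = cball 0 K - disc_nbhd S \<epsilon>"
  have Z: "compact Z" unfolding Z_def by (intro compact_diff openD compact_cball)
  define T where "T = {(p, \<delta>). (\<forall>s\<in>S. Re (poly p s) \<le> 0) \<and> (\<delta>::real) > 0}"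
  define f where "f t = {z. Re (poly (fst t) z) > snd t}" for t :: "complex poly \<times> real"
  have cover: "Z \<subseteq> (\<Union>t\<in>T. f t)"
  proof
    fix z assume "z \<in> Z"
    then have "z \<notin> S" using e by (auto simp: Z_def disc_nbhd_def)
    then obtain p where "\<forall>s\<in>S. Re (poly p s) \<le> 0" "Re (poly p z) > 0" using separating_polynomial by blast
    then have "(p, Re (poly p z) / 2) \<in> T" "z \<in> f (p, Re (poly p z) / 2)" by (auto simp: T_def f_def)
    then show "z \<in> (\<Union>t\<in>T. f t)" by blast
  qed
  have opn: "open (f t)" for t unfolding f_def
    by (intro open_Collect_less continuous_intros)
  obtain T' where T': "T' \<subseteq> T" "finite T'" "Z \<subseteq> (\<Union>t\<in>T'. f t)"
    using compactE_image[OF Z opn cover] by metis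
  have "\<exists>c. \<forall>n. size {#z \<in># eigvals (A n). Re (poly (fst t) z) \<ge> snd t#} \<le> c" if "t \<in> T'" for t
    using T'(1) that by (intro poly_count_bounded) (auto simp: T_def)
  then obtain c where c: "\<And>t n. t \<in> T' \<Longrightarrow> size {#z \<in># eigvals (A n). Re (poly (fst t) z) \<ge> snd t#} \<le> c t"
    by metis
  have "size {#z \<in># eigvals (A n). z \<notin> disc_nbhd S \<epsilon>#} \<le> (\<Sum>t\<in>T'. c t)" for n
  proof -
    have "size {#z \<in># eigvals (A n). z \<notin> disc_nbhd S \<epsilon>#} \<le>
        (\<Sum>t\<in>T'. size {#z \<in># eigvals (A n). Re (poly (fst t) z) \<ge> snd t#})"
    proof (rule size_filter_le_sum[OF T'(2)])
      fix z assume "z \<in># eigvals (A n)" "z \<notin> disc_nbhd S \<epsilon>"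
      then have "z \<in> Z" using norm_eigval_le[OF carrier(1) rows(1) cols] by (auto simp: Z_def)
      then show "\<exists>t\<in>T'. Re (poly (fst t) z) \<ge> snd t" using T'(3) by (force simp: f_def)
    qed
    also have "\<dots> \<le> (\<Sum>t\<in>T'. c t)" by (intro sum_mono c)
    finally show ?thesis .
  qed
  then show "\<exists>C. \<forall>n. size {#z \<in># eigvals (A n). z \<notin> disc_nbhd S \<epsilon>#} \<le> C" by blast
qed (use S in auto)

end

lemma sum_mset_indicator: "(\<Sum>z\<in>#M. if P z then c else 0) = c * size (filter_mset P M)" for c :: real
  by (induction M) (auto simp: algebra_simps)

lemma Re_sum_mset: "Re (\<Sum>z\<in>#M. f z) = (\<Sum>z\<in>#M. Re (f z))"
  by (induction M) auto

lemma strongly_attractsI: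
  assumes "\<And>\<epsilon> N. \<epsilon> > 0 \<Longrightarrow> eventually (\<lambda>n. size {#z \<in># eigvals (A n). cmod (z - s) < \<epsilon>#} \<ge> N) sequentially"
  shows "strongly_attracts s A"
proof -
  have "\<forall>n. \<exists>xs. mset xs = eigvals (A n)" using ex_mset by blast
  then obtain xs where xs: "\<And>n. mset (xs n) = eigvals (A n)" by metis
  define lam where "lam n = sort_key (\<lambda>z. cmod (z - s)) (xs n)" for n
  have lam: "mset (lam n) = eigvals (A n)" "sorted (map (\<lambda>z. cmod (z - s)) (lam n))" for n
    by (simp_all add: lam_def xs)
  have "(\<lambda>n. cmod (lam n ! j - s)) \<longlonglongrightarrow> 0" for j
    unfolding tendsto_iff
  proof (intro allI impI)
    fix e :: real assume "e > 0"
    from assms[OF this, of "Suc j"] show "\<forall>\<^sub>F n in sequentially. dist (cmod (lam n ! j - s)) 0 < e"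
    proof eventually_elim
      case (elim n)
      have sz: "size {#z \<in># eigvals (A n). cmod (z - s) < e#} = length (filter (\<lambda>z. cmod (z - s) < e) (lam n))"
        unfolding lam(1)[symmetric] mset_filter[symmetric] size_mset ..
      then have len: "j < length (lam n)"
        using elim length_filter_le[of "\<lambda>z. cmod (z - s) < e" "lam n"] by linarith
      show ?case
      proof (rule ccontr)
        assume "\<not> ?case"
        then have ge: "cmod (lam n ! j - s) \<ge> e" by simp
        have "filter (\<lambda>z. cmod (z - s) < e) (drop j (lam n)) = []"
        proof -
          have "cmod (z - s) \<ge> e" if z: "z \<in> set (drop j (lam n))" for z
          proof -
            obtain i where i: "i < length (lam n) - j" "z = lam n ! (j + i)"
              using z by (auto simp: in_set_conv_nth)
            have "map (\<lambda>z. cmod (z - s)) (lam n) ! j \<le> map (\<lambda>z. cmod (z - s)) (lam n) ! (j + i)"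
              using i len by (intro sorted_nth_mono[OF lam(2)]) auto
            then show ?thesis using i len ge by simp
          qed
          then show ?thesis by (force simp: filter_empty_conv)
        qed
        then have "filter (\<lambda>z. cmod (z - s) < e) (lam n) = filter (\<lambda>z. cmod (z - s) < e) (take j (lam n))"
          by (metis append_take_drop_id filter_append append_Nil2)
        then have "length (filter (\<lambda>z. cmod (z - s) < e) (lam n)) \<le> j"
          by (metis length_filter_le length_take min.coboundedI2 min.commute order_trans min.cobounded2)
        with elim sz show False by simp
      qed
    qed
  qed
  with lam show ?thesis unfolding strongly_attracts_def by blast
qed

context hermitian_model
begin

text \<open>The trace assumption says that C has at least c n eigenvalues near s, tested on polynomials that are
  nonnegative on S. It is applied to a high power of 1 - (z - s)^2 / R^2, which is small on eigenvalues
  near S but away from s; the count of eigenvalues away from S is bounded by the clustering.\<close>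

theorem attracted:
  assumes s: "s \<in> S"
    and trace: "\<And>\<epsilon>. \<epsilon> > 0 \<Longrightarrow> \<exists>c>0. \<exists>n0. \<forall>n\<ge>n0. \<forall>p \<alpha>. \<alpha> \<ge> 0 \<longrightarrow> (\<forall>x\<in>S. Re (poly p x) \<ge> 0) \<longrightarrow>
      (\<forall>x\<in>S. cmod (x - s) < \<epsilon> \<longrightarrow> Re (poly p x) \<ge> \<alpha>) \<longrightarrow>
      Re (\<Sum>a<n. poly_mat p (C n) $$ (a, a)) \<ge> \<alpha> * c * real n"
  shows "strongly_attracts s A"
proof (rule strongly_attractsI)
  fix \<epsilon>' :: real and N :: nat assume e': "\<epsilon>' > 0"
  define \<epsilon> where "\<epsilon> = min \<epsilon>' 1"
  have e: "\<epsilon> > 0" "\<epsilon> \<le> 1" "\<epsilon> \<le> \<epsilon>'" using e' by (auto simp: \<epsilon>_def)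
  define R where "R = 2 * K + 1"
  have R: "R \<ge> 1" "2 * K \<le> R" using K_nonneg by (auto simp: R_def)
  \<comment> \<open>The choice 4 R \<eta> = \<epsilon>^2 lets the imaginary parts consume at most half of the gain \<epsilon>^2 / R^2.\<close>
  define \<eta> where "\<eta> = \<epsilon>\<^sup>2 / (4 * R)"
  have eta: "\<eta> > 0" using e R by (simp add: \<eta>_def)
  \<comment> \<open>The lower bound \<alpha> refers to points of S within \<epsilon> / 2 of s, the upper bound \<beta> to eigenvalues
    that are close to S and at distance at least \<epsilon> from s.\<close>
  define \<alpha> \<beta> where "\<alpha> = 1 - \<epsilon>\<^sup>2 / (4 * R\<^sup>2)" and "\<beta> = 1 - \<epsilon>\<^sup>2 / (2 * R\<^sup>2)"
  have eR: "\<epsilon>\<^sup>2 / R\<^sup>2 > 0" "\<epsilon>\<^sup>2 / R\<^sup>2 \<le> 1"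
    using e R by (auto simp: divide_le_eq power_mono)
  have ab: "\<alpha> = 1 - \<epsilon>\<^sup>2 / R\<^sup>2 / 4" "\<beta> = 1 - \<epsilon>\<^sup>2 / R\<^sup>2 / 2" by (auto simp: \<alpha>_def \<beta>_def)
  have ab': "0 < \<beta>" "\<beta> < \<alpha>" using eR by (auto simp: ab)
  define q0 where "q0 z = 1 - (z - s)\<^sup>2 / of_real (R\<^sup>2)" for z
  have Ims: "Im s = 0" using S(3)[OF s] .
  have Re_q0: "Re (q0 z) = 1 - ((Re z - Re s)\<^sup>2 - (Im z)\<^sup>2) / R\<^sup>2" for z
    unfolding q0_def using Ims by (simp add: Re_divide_of_real del: of_real_power) (simp add: power2_eq_square)
  have Im_q0: "Im (q0 z) = - (2 * (Re z - Re s) * Im z) / R\<^sup>2" for z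
    unfolding q0_def using Ims by (simp add: Im_divide_of_real del: of_real_power) (simp add: power2_eq_square)
  have dist2K: "cmod (z - s) \<le> 2 * K" if "cmod z \<le> K" for z
    using norm_triangle_ineq4[of z s] S(4)[OF s] that by linarith
  have q0_2: "cmod (q0 z) \<le> 2" if "cmod z \<le> K" for z
  proof -
    have "cmod ((z - s)\<^sup>2 / of_real (R\<^sup>2)) = (cmod (z - s) / R)\<^sup>2"
      using R by (simp add: norm_divide norm_power power_divide)
    also have "\<dots> \<le> 1" using dist2K[OF that] R by (intro power_le_one) (auto simp: divide_le_eq)
    finally show ?thesis using norm_triangle_ineq4[of 1 "(z - s)\<^sup>2 / of_real (R\<^sup>2)"] by (simp add: q0_def)
  qed
  have q0_beta: "cmod (q0 z) \<le> \<beta>" if z: "cmod z \<le> K" "\<bar>Im z\<bar> \<le> \<eta>" "cmod (z - s) \<ge> \<epsilon>" for z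
  proof -
    define x y where "x = Re z - Re s" and "y = Im z"
    have xK: "\<bar>x\<bar> \<le> 2 * K" using abs_Re_le_cmod[of "z - s"] dist2K[OF z(1)] by (simp add: x_def)
    have "x\<^sup>2 \<le> R\<^sup>2" using xK R by (simp add: abs_le_square_iff[symmetric])
    have "(cmod (z - s))\<^sup>2 = x\<^sup>2 + y\<^sup>2" using Ims by (simp add: cmod_power2 x_def y_def)
    moreover have "\<epsilon>\<^sup>2 \<le> (cmod (z - s))\<^sup>2" using z(3) e by (intro power_mono) auto
    ultimately have xy: "\<epsilon>\<^sup>2 \<le> x\<^sup>2 + y\<^sup>2" by simp
    have y2: "y\<^sup>2 \<le> \<eta>\<^sup>2" using z(2) eta by (simp add: abs_le_square_iff[symmetric] y_def)
    have "\<eta> \<le> 1" 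
    proof -
      have "\<epsilon>\<^sup>2 \<le> 1" using e by (simp add: power_le_one)
      then show ?thesis using R by (simp add: \<eta>_def divide_le_eq)
    qed
    then have "\<eta>\<^sup>2 \<le> \<eta>" using eta by (simp add: power2_eq_square mult_left_le)
    have xyK: "\<bar>x\<bar> * \<bar>y\<bar> \<le> 2 * K * \<eta>" using xK z(2) K_nonneg by (intro mult_mono) (auto simp: y_def)
    have four: "4 * R * \<eta> = \<epsilon>\<^sup>2" using R by (simp add: \<eta>_def)
    have "cmod (q0 z) \<le> \<bar>Re (q0 z)\<bar> + \<bar>Im (q0 z)\<bar>" by (rule cmod_le)
    also have "\<bar>Re (q0 z)\<bar> = 1 - (x\<^sup>2 - y\<^sup>2) / R\<^sup>2"
    proof -
      have "(x\<^sup>2 - y\<^sup>2) / R\<^sup>2 \<le> 1" using \<open>x\<^sup>2 \<le> R\<^sup>2\<close> R by (simp add: divide_le_eq) (smt (verit) zero_le_power2)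
      then show ?thesis by (simp add: Re_q0 x_def y_def)
    qed
    also have "\<bar>Im (q0 z)\<bar> = 2 * (\<bar>x\<bar> * \<bar>y\<bar>) / R\<^sup>2"
      unfolding Im_q0 x_def y_def abs_divide abs_minus_cancel abs_mult by simp
    also have "1 - (x\<^sup>2 - y\<^sup>2) / R\<^sup>2 + 2 * (\<bar>x\<bar> * \<bar>y\<bar>) / R\<^sup>2 = 1 - (x\<^sup>2 - y\<^sup>2 - 2 * (\<bar>x\<bar> * \<bar>y\<bar>)) / R\<^sup>2"
      by (simp add: diff_divide_distrib)
    also have "\<dots> \<le> 1 - (\<epsilon>\<^sup>2 / 2) / R\<^sup>2"
    proof -
      have "4 * K * \<eta> + 2 * \<eta> = \<epsilon>\<^sup>2 / 2" using four by (simp add: R_def algebra_simps)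
      then have "\<epsilon>\<^sup>2 / 2 \<le> x\<^sup>2 - y\<^sup>2 - 2 * (\<bar>x\<bar> * \<bar>y\<bar>)"
        using xy y2 \<open>\<eta>\<^sup>2 \<le> \<eta>\<close> xyK by linarith
      then show ?thesis using R by (intro diff_left_mono divide_right_mono) auto
    qed
    finally show ?thesis by (simp add: \<beta>_def)
  qed
  obtain c n0 where c: "c > 0" and tr: "\<And>n p \<alpha>. n \<ge> n0 \<Longrightarrow> \<alpha> \<ge> 0 \<Longrightarrow> (\<forall>x\<in>S. Re (poly p x) \<ge> 0) \<Longrightarrow>
      (\<forall>x\<in>S. cmod (x - s) < \<epsilon> / 2 \<longrightarrow> Re (poly p x) \<ge> \<alpha>) \<Longrightarrow>
      Re (\<Sum>a<n. poly_mat p (C n) $$ (a, a)) \<ge> \<alpha> * c * real n"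
    using trace[of "\<epsilon> / 2"] e by force
  obtain m where m: "(\<beta> / \<alpha>) ^ m < c / 2"
    using real_arch_pow_inv[of "c / 2" "\<beta> / \<alpha>"] c ab' by auto
  have bm: "\<beta> ^ m < c / 2 * \<alpha> ^ m"
    using m ab' by (simp add: power_divide field_simps)
  define q where "q = [:1 - s\<^sup>2 / of_real (R\<^sup>2), 2 * s / of_real (R\<^sup>2), - 1 / of_real (R\<^sup>2):] ^ m"
  have q: "poly q z = q0 z ^ m" for z
  proof -
    have "poly [:1 - s\<^sup>2 / of_real (R\<^sup>2), 2 * s / of_real (R\<^sup>2), - 1 / of_real (R\<^sup>2):] z = q0 z"
      by (simp add: q0_def power2_eq_square algebra_simps diff_divide_distrib add_divide_distrib)
    then show ?thesis unfolding q_def poly_power by simp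
  qed
  have qS: "\<exists>r. poly q x = of_real (r ^ m) \<and> r \<ge> 0 \<and> (cmod (x - s) < \<epsilon> / 2 \<longrightarrow> r \<ge> \<alpha>)" if x: "x \<in> S" for x
  proof -
    define r where "r = 1 - (Re x - Re s)\<^sup>2 / R\<^sup>2"
    have Imx: "Im x = 0" using S(3)[OF x] .
    have "q0 x = of_real r" by (rule complex_eqI) (simp_all add: Re_q0 Im_q0 Imx r_def)
    moreover have "r \<ge> 0"
    proof -
      have "\<bar>Re x - Re s\<bar> \<le> R" using abs_Re_le_cmod[of "x - s"] dist2K[OF S(4)[OF x]] R by simp
      then have "(Re x - Re s)\<^sup>2 \<le> R\<^sup>2" using R by (simp add: abs_le_square_iff[symmetric])
      then show ?thesis using R by (simp add: r_def divide_le_eq)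
    qed
    moreover have "r \<ge> \<alpha>" if "cmod (x - s) < \<epsilon> / 2"
    proof -
      have "\<bar>Re x - Re s\<bar> \<le> \<epsilon> / 2" using abs_Re_le_cmod[of "x - s"] that by simp
      then have "(Re x - Re s)\<^sup>2 \<le> (\<epsilon> / 2)\<^sup>2" using e by (simp add: abs_le_square_iff[symmetric])
      then have "(Re x - Re s)\<^sup>2 / R\<^sup>2 \<le> (\<epsilon> / 2)\<^sup>2 / R\<^sup>2" by (intro divide_right_mono) auto
      then show ?thesis by (simp add: r_def \<alpha>_def power_divide)
    qed
    ultimately show ?thesis by (auto simp: q)
  qed
  obtain L where L: "\<And>n. l1_norm n (poly_mat q (A n) - poly_mat q (C n)) \<le> L"
    using poly_l1_diff by blast
  obtain M :: nat where M: "\<And>n. size {#z \<in># eigvals (A n). z \<notin> disc_nbhd S \<eta>#} \<le> M"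
    using clustered eta unfolding strongly_clustered_def by blast
  define cnt where "cnt n = real (size {#z \<in># eigvals (A n). cmod (z - s) < \<epsilon>#})" for n
  have lower: "2 ^ m * cnt n \<ge> (c / 2 * \<alpha> ^ m) * real n - 2 ^ m * real M - L" if n: "n \<ge> n0" for n
  proof -
    have XA: "poly_mat q (A n) \<in> carrier_mat n n" and XC: "poly_mat q (C n) \<in> carrier_mat n n"
      using carrier by (auto intro: poly_mat_carrier)
    have "\<alpha> ^ m * c * real n \<le> Re (\<Sum>a<n. poly_mat q (C n) $$ (a, a))"
    proof (rule tr[OF n])
      show "\<forall>x\<in>S. 0 \<le> Re (poly q x)" using qS by fastforce
      show "\<forall>x\<in>S. cmod (x - s) < \<epsilon> / 2 \<longrightarrow> \<alpha> ^ m \<le> Re (poly q x)"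
      proof (intro ballI impI)
        fix x assume "x \<in> S" "cmod (x - s) < \<epsilon> / 2"
        then obtain r where "poly q x = of_real (r ^ m)" "r \<ge> \<alpha>" using qS by blast
        then show "\<alpha> ^ m \<le> Re (poly q x)" using ab' by (simp add: power_mono del: of_real_power)
      qed
    qed (use ab' in auto)
    also have "(\<Sum>a<n. poly_mat q (C n) $$ (a, a)) =
        (\<Sum>a<n. poly_mat q (A n) $$ (a, a)) - (\<Sum>a<n. (poly_mat q (A n) - poly_mat q (C n)) $$ (a, a))"
      unfolding sum_subtractf[symmetric] using XA XC by (intro sum.cong refl) auto
    also have "Re \<dots> \<le> Re (\<Sum>a<n. poly_mat q (A n) $$ (a, a)) + L"
      using trace_le_l1[of "poly_mat q (A n) - poly_mat q (C n)" n] L[of n]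
        abs_Re_le_cmod[of "\<Sum>a<n. (poly_mat q (A n) - poly_mat q (C n)) $$ (a, a)"]
      unfolding minus_complex.sel by linarith
    also have "(\<Sum>a<n. poly_mat q (A n) $$ (a, a)) = (\<Sum>z\<in>#eigvals (A n). poly q z)"
      by (rule trace_poly_mat[OF carrier(1)])
    also have "Re \<dots> = (\<Sum>z\<in>#eigvals (A n). Re (poly q z))"
      by (rule Re_sum_mset)
    also have "\<dots> \<le> (\<Sum>z\<in>#eigvals (A n). (if cmod (z - s) < \<epsilon> then 2 ^ m else 0) +
        ((if z \<notin> disc_nbhd S \<eta> then 2 ^ m else 0) + \<beta> ^ m))"
    proof (rule sum_mset_mono)
      fix z assume z: "z \<in># eigvals (A n)"
      then have zK: "cmod z \<le> K" using norm_eigval_le[OF carrier(1) rows(1) cols] by blast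
      have "Re (poly q z) \<le> cmod (q0 z) ^ m" using complex_Re_le_cmod[of "poly q z"] by (simp add: q norm_power)
      also have "\<dots> \<le> (if cmod (z - s) < \<epsilon> then 2 ^ m else 0) + ((if z \<notin> disc_nbhd S \<eta> then 2 ^ m else 0) + \<beta> ^ m)"
      proof (cases "cmod (z - s) < \<epsilon> \<or> z \<notin> disc_nbhd S \<eta>")
        case True
        have "cmod (q0 z) ^ m \<le> 2 ^ m" using q0_2[OF zK] by (intro power_mono) auto
        moreover have "0 \<le> \<beta> ^ m" "(0::real) \<le> 2 ^ m" using ab' by auto
        ultimately show ?thesis using True by (smt (verit))
      next
        case False
        then obtain w where w: "w \<in> S" "cmod (z - w) < \<eta>" by (auto simp: disc_nbhd_def)
        then have "\<bar>Im z\<bar> \<le> \<eta>" using abs_Im_le_cmod[of "z - w"] S(3)[OF w(1)] by simp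
        then have "cmod (q0 z) ^ m \<le> \<beta> ^ m" using False zK by (intro power_mono q0_beta) auto
        then show ?thesis using False by simp
      qed
      finally show "Re (poly q z) \<le> (if cmod (z - s) < \<epsilon> then 2 ^ m else 0) + ((if z \<notin> disc_nbhd S \<eta> then 2 ^ m else 0) + \<beta> ^ m)" .
    qed
    also have "\<dots> = 2 ^ m * cnt n + (2 ^ m * real (size {#z \<in># eigvals (A n). z \<notin> disc_nbhd S \<eta>#}) + real n * \<beta> ^ m)"
      by (simp only: sum_mset.distrib sum_mset_indicator cnt_def)
        (simp add: size_eigvals[OF carrier(1)])
    also have "\<dots> \<le> 2 ^ m * cnt n + (2 ^ m * real M + real n * (c / 2 * \<alpha> ^ m))"
      using M[of n] bm by (intro add_mono mult_left_mono order_refl) auto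
    finally show ?thesis by (simp add: algebra_simps)
  qed
  define \<kappa> where "\<kappa> = c / 2 * \<alpha> ^ m"
  have kappa: "\<kappa> > 0" using c ab' by (simp add: \<kappa>_def)
  obtain n1 :: nat where n1: "(2 ^ m * real N + 2 ^ m * real M + L) / \<kappa> \<le> real n1"
    using real_arch_simple by blast
  from eventually_ge_at_top[of "max n0 n1"]
  show "eventually (\<lambda>n. size {#z \<in># eigvals (A n). cmod (z - s) < \<epsilon>'#} \<ge> N) sequentially"
  proof eventually_elim
    case (elim n)
    have "2 ^ m * real N + 2 ^ m * real M + L \<le> \<kappa> * real n1" using n1 kappa by (simp add: field_simps)
    also have "\<dots> \<le> \<kappa> * real n" using elim kappa by (intro mult_left_mono) auto
    finally have "2 ^ m * real N + 2 ^ m * real M + L \<le> \<kappa> * real n" .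
    moreover have "n0 \<le> n" using elim by simp
    ultimately have "2 ^ m * real N \<le> 2 ^ m * cnt n" using lower[of n] unfolding \<kappa>_def by linarith
    then have "N \<le> size {#z \<in># eigvals (A n). cmod (z - s) < \<epsilon>#}" by (simp add: cnt_def)
    also have "\<dots> \<le> size {#z \<in># eigvals (A n). cmod (z - s) < \<epsilon>'#}"
      using e(3) by (intro size_mset_mono filter_mset_mono_strong) auto
    finally show ?case .
  qed
qed

end

section \<open>Block circulant matrices and the discrete Fourier transform\<close>

text \<open>The characters of the integers modulo m.\<close>

definition fourier :: "nat \<Rightarrow> nat \<Rightarrow> nat \<Rightarrow> complex" where
  "fourier m l p = cis (2 * pi * real l * real p / real m)"

lemma fourier_add: "fourier m l (p + q) = fourier m l p * fourier m l q"
  by (simp add: fourier_def cis_mult ring_distribs add_divide_distrib)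

lemma fourier_sym: "fourier m l p = fourier m p l"
  by (simp add: fourier_def mult_ac)

lemma fourier_period: "m > 0 \<Longrightarrow> fourier m l m = 1"
  by (simp add: fourier_def cis_multiple_2pi)

lemma fourier_0 [simp]: "fourier m l 0 = 1"
  by (simp add: fourier_def)

lemma fourier_orthogonal:
  assumes "p < m" "q < m"
  shows "(\<Sum>l<m. cnj (fourier m l p) * fourier m l q) = (if p = q then of_nat m else 0)"
proof -
  have m: "m > 0" using assms by simp
  define x where "x = cis (2 * pi * (real q - real p) / real m)"
  have pow: "cnj (fourier m l p) * fourier m l q = x ^ l" for l
    by (simp add: x_def fourier_def cis_cnj cis_mult Complex.DeMoivre) (simp add: field_simps diff_divide_distrib)
  show ?thesis
  proof (cases "p = q")
    case True
    then have "x = 1" by (simp add: x_def)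
    then have "(\<Sum>l<m. cnj (fourier m l p) * fourier m l q) = (\<Sum>l<m. 1)"
      unfolding pow by simp
    then show ?thesis using True by simp
  next
    case False
    have "x \<noteq> 1"
    proof
      assume "x = 1"
      then have "cos (2 * pi * (real q - real p) / real m) = 1" by (simp add: x_def complex_eq_iff)
      then obtain i :: int where "2 * pi * (real q - real p) / real m = of_int i * 2 * pi"
        by (auto simp: cos_one_2pi_int)
      then have "2 * pi * (real q - real p) = 2 * pi * (of_int i * real m)" using m by (simp add: field_simps)
      then have "real q - real p = of_int i * real m" by simp
      then have eq: "int q - int p = i * int m" by (metis of_int_diff of_int_eq_iff of_int_mult of_int_of_nat_eq)
      have "\<bar>int q - int p\<bar> < int m" using assms by linarith
      then have "\<bar>i\<bar> * int m < 1 * int m" unfolding eq abs_mult by simp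
      then have "i = 0" using m by (simp only: mult_less_cancel_right) auto
      with eq False show False by simp
    qed
    moreover have "x ^ m = 1"
    proof -
      have "x ^ m = cis (2 * pi * of_int (int q - int p))" using m by (simp add: x_def Complex.DeMoivre)
      also have "\<dots> = 1" by (rule cis_multiple_2pi) simp
      finally show ?thesis .
    qed
    ultimately show ?thesis using False by (simp add: pow sum_gp_strict)
  qed
qed

lemma sum_split_at:
  fixes f :: "nat \<Rightarrow> 'a::comm_monoid_add"
  assumes "m \<le> n"
  shows "(\<Sum>x<n. f x) = (\<Sum>x<m. f x) + (\<Sum>x=m..<n. f x)"
  using assms by (metis lessThan_atLeast0 sum.atLeastLessThan_concat zero_le)

lemma sum_blocks:
  fixes f :: "nat \<Rightarrow> 'a::comm_monoid_add"
  shows "(\<Sum>j<m * k. f j) = (\<Sum>p<m. \<Sum>r<k. f (p * k + r))"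
proof -
  have "(\<Sum>j<m * k. f j) = (\<Sum>p<m. sum f {p * k ..< p * k + k})" by (simp add: sum.nat_group)
  also have "\<dots> = (\<Sum>p<m. \<Sum>r<k. f (p * k + r))"
    by (rule sum.cong[OF refl], subst sum.atLeastLessThan_shift_0) (simp add: lessThan_atLeast0 o_def)
  finally show ?thesis .
qed

lemma block_index_less:
  assumes "p < m" "r < (k::nat)"
  shows "p * k + r < m * k"
proof -
  have "p * k + r < Suc p * k" using assms(2) by simp
  also have "\<dots> \<le> m * k" using assms(1) by (intro mult_le_mono1) simp
  finally show ?thesis .
qed

text \<open>The block (p,q) is the Fourier coefficient of index p - q of the matrix-valued function F on the m
  frequencies. When m k < n, the matrix is filled up with z on the diagonal.\<close>

definition block_circulant :: "nat \<Rightarrow> nat \<Rightarrow> nat \<Rightarrow> complex \<Rightarrow> (nat \<Rightarrow> complex mat) \<Rightarrow> complex mat" where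
  "block_circulant n k m z F = mat n n (\<lambda>(i, j).
     if i < m * k \<and> j < m * k
     then (\<Sum>l<m. cnj (fourier m l (i div k)) * fourier m l (j div k) * F l $$ (i mod k, j mod k)) / of_nat m
     else if i = j then z else 0)"

lemma block_circulant_carrier [simp]: "block_circulant n k m z F \<in> carrier_mat n n"
  by (simp add: block_circulant_def)

lemma block_circulant_index:
  "i < n \<Longrightarrow> j < n \<Longrightarrow> block_circulant n k m z F $$ (i, j) =
    (if i < m * k \<and> j < m * k
     then (\<Sum>l<m. cnj (fourier m l (i div k)) * fourier m l (j div k) * F l $$ (i mod k, j mod k)) / of_nat m
     else if i = j then z else 0)"
  by (simp add: block_circulant_def)

lemma block_circulant_block_index:
  assumes "p < m" "q < m" "r < k" "s < k" "m * k \<le> n"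
  shows "block_circulant n k m z F $$ (p * k + r, q * k + s) =
     (\<Sum>l<m. cnj (fourier m l p) * fourier m l q * F l $$ (r, s)) / of_nat m"
proof -
  have "p * k + r < m * k" "q * k + s < m * k"
    using assms by (auto intro: block_index_less)
  then show ?thesis using assms by (subst block_circulant_index) auto
qed

lemma block_circulant_cong:
  assumes "k > 0" "\<And>l. l < m \<Longrightarrow> F l = G l"
  shows "block_circulant n k m z F = block_circulant n k m z G"
  unfolding block_circulant_def using assms(2) by (intro cong_mat refl) auto

text \<open>Orthogonality of the characters turns the convolution of the blocks into the pointwise product of the
  symbols; the diagonal remainder multiplies separately.\<close>

lemma block_circulant_mult:
  assumes k: "k > 0" and mk: "m * k \<le> n"
    and F: "\<And>l. l < m \<Longrightarrow> F l \<in> carrier_mat k k" and G: "\<And>l. l < m \<Longrightarrow> G l \<in> carrier_mat k k"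
  shows "block_circulant n k m z F * block_circulant n k m w G = block_circulant n k m (z * w) (\<lambda>l. F l * G l)"
    (is "?F * ?G = ?H")
proof (rule eq_matI)
  fix i j assume "i < dim_row ?H" "j < dim_col ?H"
  then have i: "i < n" and j: "j < n" by (auto simp: block_circulant_def)
  have "(?F * ?G) $$ (i, j) = (\<Sum>x<n. ?F $$ (i, x) * ?G $$ (x, j))"
    using i j by (rule mat_mult_index_sum[OF block_circulant_carrier block_circulant_carrier])
  also have "\<dots> = ?H $$ (i, j)"
  proof (cases "i < m * k \<and> j < m * k")
    case False
    show ?thesis
    proof (cases "i < m * k")
      case True
      then show ?thesis using False i j by (intro trans[OF sum.neutral]) (auto simp: block_circulant_index)
    next
      case ige: False
      have "(\<Sum>x<n. ?F $$ (i, x) * ?G $$ (x, j)) = (\<Sum>x<n. if x = i then z * ?G $$ (i, j) else 0)"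
        using ige i by (intro sum.cong refl) (auto simp: block_circulant_index)
      also have "\<dots> = z * ?G $$ (i, j)" using i by (simp add: sum.delta)
      finally show ?thesis using ige i j by (simp add: block_circulant_index)
    qed
  next
    case True
    define p r q s where "p = i div k" and "r = i mod k" and "q = j div k" and "s = j mod k"
    have m: "m > 0" using True by (cases m) auto
    have pq: "p < m" "q < m" "r < k" "s < k" and ij: "i = p * k + r" "j = q * k + s"
      using True k by (auto simp: p_def q_def r_def s_def less_mult_imp_div_less)
    have "(\<Sum>x=m * k..<n. ?F $$ (i, x) * ?G $$ (x, j)) = 0"
      using True i j by (intro sum.neutral) (auto simp: block_circulant_index)
    then have "(\<Sum>x<n. ?F $$ (i, x) * ?G $$ (x, j)) = (\<Sum>p'<m. \<Sum>t<k. ?F $$ (i, p' * k + t) * ?G $$ (p' * k + t, j))"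
      unfolding sum_split_at[OF mk] by (simp add: sum_blocks)
    also have "\<dots> = (\<Sum>p'<m. \<Sum>t<k. (\<Sum>l<m. cnj (fourier m l p) * fourier m l p' * F l $$ (r, t)) / of_nat m *
        ((\<Sum>l<m. cnj (fourier m l p') * fourier m l q * G l $$ (t, s)) / of_nat m))"
      unfolding ij using pq mk by (intro sum.cong refl) (simp add: block_circulant_block_index)
    also have "\<dots> = (\<Sum>p'<m. \<Sum>t<k. \<Sum>l<m. \<Sum>l'<m. cnj (fourier m l p) * fourier m l' q * F l $$ (r, t) * G l' $$ (t, s)
        / (of_nat m)\<^sup>2 * (cnj (fourier m l' p') * fourier m l p'))"
      unfolding sum_divide_distrib sum_product
      by (intro sum.cong refl) (simp add: power2_eq_square field_simps)
    also have "\<dots> = (\<Sum>t<k. \<Sum>p'<m. \<Sum>l<m. \<Sum>l'<m. cnj (fourier m l p) * fourier m l' q * F l $$ (r, t) * G l' $$ (t, s)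
        / (of_nat m)\<^sup>2 * (cnj (fourier m l' p') * fourier m l p'))"
      by (rule sum.swap)
    also have "\<dots> = (\<Sum>t<k. \<Sum>l<m. \<Sum>p'<m. \<Sum>l'<m. cnj (fourier m l p) * fourier m l' q * F l $$ (r, t) * G l' $$ (t, s)
        / (of_nat m)\<^sup>2 * (cnj (fourier m l' p') * fourier m l p'))"
      by (rule sum.cong[OF refl], rule sum.swap)
    also have "\<dots> = (\<Sum>t<k. \<Sum>l<m. \<Sum>l'<m. \<Sum>p'<m. cnj (fourier m l p) * fourier m l' q * F l $$ (r, t) * G l' $$ (t, s)
        / (of_nat m)\<^sup>2 * (cnj (fourier m l' p') * fourier m l p'))"
      by (rule sum.cong[OF refl], rule sum.cong[OF refl], rule sum.swap)
    also have "\<dots> = (\<Sum>t<k. \<Sum>l<m. \<Sum>l'<m. cnj (fourier m l p) * fourier m l' q * F l $$ (r, t) * G l' $$ (t, s)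
        / (of_nat m)\<^sup>2 * (\<Sum>p'<m. cnj (fourier m l' p') * fourier m l p'))"
      by (simp only: sum_distrib_left)
    also have "\<dots> = (\<Sum>t<k. \<Sum>l<m. \<Sum>l'<m. if l' = l then
        cnj (fourier m l p) * fourier m l q * F l $$ (r, t) * G l $$ (t, s) / of_nat m else 0)"
    proof (intro sum.cong refl)
      fix t l l' assume "l \<in> {..<m}" "l' \<in> {..<m}"
      then have "(\<Sum>p'<m. cnj (fourier m l' p') * fourier m l p') = (if l' = l then of_nat m else 0)"
        using fourier_orthogonal[of l' m l] by (simp add: fourier_sym[of m _ l] fourier_sym[of m _ l'])
      then show "cnj (fourier m l p) * fourier m l' q * F l $$ (r, t) * G l' $$ (t, s)
          / (of_nat m)\<^sup>2 * (\<Sum>p'<m. cnj (fourier m l' p') * fourier m l p') = (if l' = l then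
        cnj (fourier m l p) * fourier m l q * F l $$ (r, t) * G l $$ (t, s) / of_nat m else 0)"
        using m by (simp add: power2_eq_square)
    qed
    also have "\<dots> = (\<Sum>t<k. \<Sum>l<m. cnj (fourier m l p) * fourier m l q * F l $$ (r, t) * G l $$ (t, s) / of_nat m)"
      by (simp add: sum.delta)
    also have "\<dots> = (\<Sum>l<m. \<Sum>t<k. cnj (fourier m l p) * fourier m l q * F l $$ (r, t) * G l $$ (t, s) / of_nat m)"
      by (rule sum.swap)
    also have "\<dots> = (\<Sum>l<m. cnj (fourier m l p) * fourier m l q * (F l * G l) $$ (r, s)) / of_nat m"
      unfolding sum_divide_distrib
      by (intro sum.cong refl)
        (simp add: mat_mult_index_sum[OF F G pq(3,4)] sum_distrib_left sum_divide_distrib mult_ac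
          del: index_mult_mat(1))
    also have "\<dots> = ?H $$ (i, j)"
      unfolding ij using pq mk by (simp add: block_circulant_block_index)
    finally show ?thesis .
  qed
  finally show "(?F * ?G) $$ (i, j) = ?H $$ (i, j)" .
qed (auto simp: block_circulant_def)

lemma block_circulant_scalar_add:
  assumes k: "k > 0" and mk: "m * k \<le> n" and F: "\<And>l. l < m \<Longrightarrow> F l \<in> carrier_mat k k"
  shows "c \<cdot>\<^sub>m 1\<^sub>m n + block_circulant n k m z F = block_circulant n k m (c + z) (\<lambda>l. c \<cdot>\<^sub>m 1\<^sub>m k + F l)"
    (is "?L = ?R")
proof (rule eq_matI)
  fix i j assume "i < dim_row ?R" "j < dim_col ?R"
  then have i: "i < n" and j: "j < n" by (auto simp: block_circulant_def)
  show "?L $$ (i, j) = ?R $$ (i, j)"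
  proof (cases "i < m * k \<and> j < m * k")
    case False
    then show ?thesis using i j by (auto simp: block_circulant_index block_circulant_def)
  next
    case True
    define p r q s where "p = i div k" and "r = i mod k" and "q = j div k" and "s = j mod k"
    have m: "m > 0" using True by (cases m) auto
    have pq: "p < m" "q < m" "r < k" "s < k" and ij: "i = p * k + r" "j = q * k + s"
      using True k by (auto simp: p_def q_def r_def s_def less_mult_imp_div_less)
    have eq: "i = j \<longleftrightarrow> p = q \<and> r = s" using ij p_def q_def r_def s_def by metis
    have "?R $$ (i, j) = (\<Sum>l<m. cnj (fourier m l p) * fourier m l q * (c \<cdot>\<^sub>m 1\<^sub>m k + F l) $$ (r, s)) / of_nat m"
      unfolding ij using pq mk by (simp add: block_circulant_block_index)
    also have "\<dots> = (\<Sum>l<m. cnj (fourier m l p) * fourier m l q * (if r = s then c else 0)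
        + cnj (fourier m l p) * fourier m l q * F l $$ (r, s)) / of_nat m"
      using pq F by (intro arg_cong2[of _ _ _ _ "(/)"] sum.cong refl) (auto simp: algebra_simps carrier_matD[OF F])
    also have "\<dots> = (\<Sum>l<m. cnj (fourier m l p) * fourier m l q) * (if r = s then c else 0) / of_nat m
        + (\<Sum>l<m. cnj (fourier m l p) * fourier m l q * F l $$ (r, s)) / of_nat m"
      by (simp only: sum.distrib add_divide_distrib sum_distrib_right)
    also have "(\<Sum>l<m. cnj (fourier m l p) * fourier m l q) * (if r = s then c else 0) / of_nat m = (if i = j then c else 0)"
      using m by (simp add: fourier_orthogonal[OF pq(1,2)] eq)
    also have "(\<Sum>l<m. cnj (fourier m l p) * fourier m l q * F l $$ (r, s)) / of_nat m = block_circulant n k m z F $$ (i, j)"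
      unfolding ij using pq mk by (simp add: block_circulant_block_index)
    finally show ?thesis using i j by (simp add: block_circulant_def)
  qed
qed (auto simp: block_circulant_def)

text \<open>Polynomials are evaluated frequency by frequency, since sums and products of symbols are.\<close>

lemma poly_mat_block_circulant:
  assumes k: "k > 0" and mk: "m * k \<le> n" and F: "\<And>l. l < m \<Longrightarrow> F l \<in> carrier_mat k k"
  shows "poly_mat p (block_circulant n k m z F) = block_circulant n k m (poly p z) (\<lambda>l. poly_mat p (F l))"
proof (induction p)
  case 0
  have "block_circulant n k m 0 (\<lambda>l. poly_mat 0 (F l)) = 0\<^sub>m n n"
  proof (rule eq_matI)
    fix i j assume "i < dim_row (0\<^sub>m n n :: complex mat)" "j < dim_col (0\<^sub>m n n :: complex mat)"
    then show "block_circulant n k m 0 (\<lambda>l. poly_mat 0 (F l)) $$ (i, j) = 0\<^sub>m n n $$ (i, j)"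
      using k by (auto simp: block_circulant_index poly_mat_0[OF F])
  qed (auto simp: block_circulant_def)
  then show ?case by (simp add: poly_mat_0[OF block_circulant_carrier])
next
  case (pCons c p)
  have PF: "poly_mat p (F l) \<in> carrier_mat k k" if "l < m" for l using F[OF that] by (rule poly_mat_carrier)
  have FPF: "F l * poly_mat p (F l) \<in> carrier_mat k k" if "l < m" for l using F[OF that] PF[OF that] by simp
  have "poly_mat (pCons c p) (block_circulant n k m z F)
      = c \<cdot>\<^sub>m 1\<^sub>m n + block_circulant n k m z F * block_circulant n k m (poly p z) (\<lambda>l. poly_mat p (F l))"
    by (simp only: poly_mat_pCons[OF block_circulant_carrier] pCons.IH)
  also have "\<dots> = block_circulant n k m (c + z * poly p z) (\<lambda>l. c \<cdot>\<^sub>m 1\<^sub>m k + F l * poly_mat p (F l))"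
    by (simp only: block_circulant_mult[OF k mk F PF] block_circulant_scalar_add[OF k mk FPF])
  also have "\<dots> = block_circulant n k m (poly (pCons c p) z) (\<lambda>l. poly_mat (pCons c p) (F l))"
    unfolding poly_pCons by (rule block_circulant_cong[OF k]) (simp add: poly_mat_pCons[OF F])
  finally show ?case .
qed

text \<open>Diagonal blocks are averages over the frequencies, so their traces add up to the traces of all F l.\<close>

lemma trace_block_circulant:
  assumes k: "k > 0" and mk: "m * k \<le> n"
  shows "(\<Sum>a<n. block_circulant n k m z F $$ (a, a)) = (\<Sum>l<m. \<Sum>r<k. F l $$ (r, r)) + of_nat (n - m * k) * z"
proof -
  have "(\<Sum>a<m * k. block_circulant n k m z F $$ (a, a)) =
      (\<Sum>p<m. \<Sum>r<k. (\<Sum>l<m. cnj (fourier m l p) * fourier m l p * F l $$ (r, r)) / of_nat m)"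
    unfolding sum_blocks using mk by (intro sum.cong refl) (simp add: block_circulant_block_index)
  also have "\<dots> = (\<Sum>p<m. \<Sum>r<k. (\<Sum>l<m. F l $$ (r, r)) / of_nat m)"
    by (simp add: fourier_def cis_cnj cis_mult)
  also have "\<dots> = (\<Sum>r<k. \<Sum>l<m. F l $$ (r, r))"
    by (simp add: sum_divide_distrib[symmetric])
  also have "\<dots> = (\<Sum>l<m. \<Sum>r<k. F l $$ (r, r))" by (rule sum.swap)
  moreover have "(\<Sum>x=m * k..<n. block_circulant n k m z F $$ (x, x)) = of_nat (n - m * k) * z"
    by (simp add: block_circulant_index)
  ultimately show ?thesis by (simp add: sum_split_at[OF mk])
qed

text \<open>The form splits into the forms of the symbol values, evaluated at the block Fourier transform of v.
  Sign conditions on all F l therefore pass to the whole matrix.\<close>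

lemma qform_block_circulant:
  assumes k: "k > 0" and mk: "m * k \<le> n"
  shows "qform n (block_circulant n k m z F) v =
    (\<Sum>l<m. qform k (F l) (\<lambda>r. \<Sum>p<m. fourier m l p * v (p * k + r))) / of_nat m
    + z * of_real (\<Sum>x=m * k..<n. (cmod (v x))\<^sup>2)"
proof -
  let ?C = "block_circulant n k m z F"
  have "qform n ?C v = (\<Sum>a<m * k. \<Sum>b<n. cnj (v a) * ?C $$ (a, b) * v b) + (\<Sum>a=m * k..<n. \<Sum>b<n. cnj (v a) * ?C $$ (a, b) * v b)"
    unfolding qform_def by (rule sum_split_at[OF mk])
  also have "(\<Sum>a=m * k..<n. \<Sum>b<n. cnj (v a) * ?C $$ (a, b) * v b) = (\<Sum>a=m * k..<n. \<Sum>b<n. if b = a then z * (cnj (v a) * v a) else 0)"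
    by (intro sum.cong refl) (auto simp: block_circulant_index)
  also have "\<dots> = (\<Sum>a=m * k..<n. z * (cnj (v a) * v a))" by (simp add: sum.delta)
  also have "\<dots> = z * of_real (\<Sum>x=m * k..<n. (cmod (v x))\<^sup>2)"
    by (simp add: sum_distrib_left complex_norm_square mult_ac del: of_real_power flip: of_real_power)
  also have "(\<Sum>a<m * k. \<Sum>b<n. cnj (v a) * ?C $$ (a, b) * v b) = (\<Sum>a<m * k. \<Sum>b<m * k. cnj (v a) * ?C $$ (a, b) * v b)"
  proof (rule sum.cong[OF refl])
    fix a assume a: "a \<in> {..<m * k}"
    then have "(\<Sum>b=m * k..<n. cnj (v a) * ?C $$ (a, b) * v b) = 0"
      using mk by (intro sum.neutral) (auto simp: block_circulant_index)
    then show "(\<Sum>b<n. cnj (v a) * ?C $$ (a, b) * v b) = (\<Sum>b<m * k. cnj (v a) * ?C $$ (a, b) * v b)"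
      by (simp add: sum_split_at[OF mk])
  qed
  also have "\<dots> = (\<Sum>p<m. \<Sum>r<k. \<Sum>q<m. \<Sum>s<k. \<Sum>l<m. cnj (fourier m l p * v (p * k + r)) * F l $$ (r, s) * (fourier m l q * v (q * k + s)) / of_nat m)"
    unfolding sum_blocks using mk
    by (intro sum.cong refl)
      (simp add: block_circulant_block_index sum_distrib_left sum_distrib_right sum_divide_distrib mult_ac)
  also have "\<dots> = (\<Sum>p<m. \<Sum>r<k. \<Sum>q<m. \<Sum>l<m. \<Sum>s<k. cnj (fourier m l p * v (p * k + r)) * F l $$ (r, s) * (fourier m l q * v (q * k + s)) / of_nat m)"
    by (rule sum.cong[OF refl], rule sum.cong[OF refl], rule sum.cong[OF refl], rule sum.swap)
  also have "\<dots> = (\<Sum>p<m. \<Sum>r<k. \<Sum>l<m. \<Sum>q<m. \<Sum>s<k. cnj (fourier m l p * v (p * k + r)) * F l $$ (r, s) * (fourier m l q * v (q * k + s)) / of_nat m)"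
    by (rule sum.cong[OF refl], rule sum.cong[OF refl], rule sum.swap)
  also have "\<dots> = (\<Sum>p<m. \<Sum>l<m. \<Sum>r<k. \<Sum>q<m. \<Sum>s<k. cnj (fourier m l p * v (p * k + r)) * F l $$ (r, s) * (fourier m l q * v (q * k + s)) / of_nat m)"
    by (rule sum.cong[OF refl], rule sum.swap)
  also have "\<dots> = (\<Sum>l<m. \<Sum>p<m. \<Sum>r<k. \<Sum>q<m. \<Sum>s<k. cnj (fourier m l p * v (p * k + r)) * F l $$ (r, s) * (fourier m l q * v (q * k + s)) / of_nat m)"
    by (rule sum.swap)
  also have "\<dots> = (\<Sum>l<m. \<Sum>r<k. \<Sum>p<m. \<Sum>q<m. \<Sum>s<k. cnj (fourier m l p * v (p * k + r)) * F l $$ (r, s) * (fourier m l q * v (q * k + s)) / of_nat m)"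
    by (rule sum.cong[OF refl], rule sum.swap)
  also have "\<dots> = (\<Sum>l<m. \<Sum>r<k. \<Sum>p<m. \<Sum>s<k. \<Sum>q<m. cnj (fourier m l p * v (p * k + r)) * F l $$ (r, s) * (fourier m l q * v (q * k + s)) / of_nat m)"
    by (rule sum.cong[OF refl], rule sum.cong[OF refl], rule sum.cong[OF refl], rule sum.swap)
  also have "\<dots> = (\<Sum>l<m. \<Sum>r<k. \<Sum>s<k. \<Sum>p<m. \<Sum>q<m. cnj (fourier m l p * v (p * k + r)) * F l $$ (r, s) * (fourier m l q * v (q * k + s)) / of_nat m)"
    by (rule sum.cong[OF refl], rule sum.cong[OF refl], rule sum.swap)
  also have "\<dots> = (\<Sum>l<m. qform k (F l) (\<lambda>r. \<Sum>p<m. fourier m l p * v (p * k + r))) / of_nat m"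
    unfolding qform_def cnj_sum sum_distrib_left sum_distrib_right sum_divide_distrib
    by (rule sum.cong[OF refl], rule sum.cong[OF refl], rule sum.cong[OF refl], rule sum.swap)
  finally show ?thesis .
qed

section \<open>Measurable labelling of real roots\<close>

lemma poly_char_poly_eq_prod:
  assumes A: "A \<in> carrier_mat n n"
  obtains as where "length as = n" "mset as = eigvals A" "char_poly A = (\<Prod>a\<leftarrow>as. [:- a, 1:])"
proof -
  obtain as where as: "char_poly A = (\<Prod>a\<leftarrow>as. [:- a, 1:])" "length as = n"
    using char_poly_factorized[OF A] by auto
  then have "mset as = eigvals A" by (simp add: eigvals_def proots_linear_factors)
  with as that show ?thesis by blast
qed

text \<open>The modulus of the value is the product of the distances from z to the roots.\<close>

lemma root_near_small_value:
  assumes "cmod (poly (\<Prod>a\<leftarrow>as. [:- a, 1:]) z) < d ^ length as" "d > 0"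
  shows "\<exists>a\<in>set as. cmod (z - a) < d"
proof (rule ccontr)
  assume "\<not> ?thesis"
  then have "\<forall>a\<in>set as. cmod (z - a) \<ge> d" by force
  then have "cmod (poly (\<Prod>a\<leftarrow>as. [:- a, 1:]) z) \<ge> d ^ length as"
  proof (induction as)
    case (Cons a as)
    have "d * d ^ length as \<le> cmod (z - a) * cmod (poly (\<Prod>a\<leftarrow>as. [:- a, 1:]) z)"
      using Cons assms(2) by (intro mult_mono) auto
    moreover have "poly (\<Prod>a\<leftarrow>a # as. [:- a, 1:]) z = (z - a) * poly (\<Prod>a\<leftarrow>as. [:- a, 1:]) z"
      by (simp add: algebra_simps)
    ultimately show ?case by (simp add: norm_mult del: mult_pCons_left)
  qed simp
  with assms(1) show False by simp
qed

text \<open>The right-hand side uses countably many evaluations of the polynomial, so the smallest root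
  is measurable whenever the polynomial depends measurably on a parameter. All evaluations take place off the real axis, where
  no root can spoil the division by a linear factor in the next lemma.\<close>

lemma smallest_root_le_iff:
  fixes as :: "complex list"
  assumes real: "\<forall>a\<in>set as. Im a = 0" and ne: "as \<noteq> []"
  shows "Min (Re ` set as) \<le> x \<longleftrightarrow> (\<forall>n. \<exists>q::rat. \<exists>N. of_rat q \<le> x \<and>
    cmod (poly (\<Prod>a\<leftarrow>as. [:- a, 1:]) (Complex (of_rat q) (1 / real (Suc N)))) < (1 / real (Suc n)) ^ length as)"
    (is "?L \<longleftrightarrow> ?R")
proof
  assume ?L
  then obtain a where a: "a \<in> set as" "Re a \<le> x" using ne by (auto simp: Min_le_iff)
  show ?R
  proof
    fix n
    define P where "P = (\<Prod>a\<leftarrow>as. [:- a, 1:])"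
    have "poly P a = 0" using a(1) unfolding P_def by (induction as) (auto simp: algebra_simps)
    moreover have "isCont (\<lambda>z. poly P z) a" by simp
    ultimately have "((\<lambda>z. poly P z) \<longlongrightarrow> 0) (at a)" by (simp add: isCont_def)
    moreover have "(1 / real (Suc n)) ^ length as > 0" by simp
    ultimately have "eventually (\<lambda>z. dist (poly P z) 0 < (1 / real (Suc n)) ^ length as) (at a)"
      by (rule tendstoD)
    then obtain d where d: "d > 0" "\<And>z. z \<noteq> a \<Longrightarrow> dist z a < d \<Longrightarrow> cmod (poly P z) < (1 / real (Suc n)) ^ length as"
      by (auto simp: eventually_at)
    obtain q where q: "Re a - d / 2 < of_rat q" "of_rat q < Re a"
      using of_rat_dense[of "Re a - d / 2" "Re a"] d(1) by auto
    obtain N where N: "1 / real (Suc N) < d / 2"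
      using d(1) nat_approx_posE[of "d / 2"] by auto
    let ?z = "Complex (of_rat q) (1 / real (Suc N))"
    have "dist ?z a \<le> \<bar>of_rat q - Re a\<bar> + \<bar>1 / real (Suc N) - Im a\<bar>"
      using cmod_le[of "?z - a"] by (simp add: dist_norm)
    also have "\<dots> < d" using q N real a(1) by auto
    finally have "cmod (poly P ?z) < (1 / real (Suc n)) ^ length as"
      using q by (intro d(2)) (auto simp: complex_eq_iff)
    then show "\<exists>q. \<exists>N. of_rat q \<le> x \<and>
      cmod (poly (\<Prod>a\<leftarrow>as. [:- a, 1:]) (Complex (of_rat q) (1 / real (Suc N)))) < (1 / real (Suc n)) ^ length as"
      using q(2) a(2) unfolding P_def by (intro exI[of _ q] exI[of _ N]) auto
  qed
next
  assume R: ?R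
  show ?L
  proof (rule field_le_epsilon)
    fix e :: real assume "e > 0"
    then obtain n where n: "1 / real (Suc n) < e" using nat_approx_posE by blast
    from R obtain q N where q: "of_rat q \<le> x"
      "cmod (poly (\<Prod>a\<leftarrow>as. [:- a, 1:]) (Complex (of_rat q) (1 / real (Suc N)))) < (1 / real (Suc n)) ^ length as"
      by blast
    obtain a where a: "a \<in> set as" "cmod (Complex (of_rat q) (1 / real (Suc N)) - a) < 1 / real (Suc n)"
      using root_near_small_value[OF q(2)] by auto
    have "Re a - of_rat q < 1 / real (Suc n)"
      using abs_Re_le_cmod[of "Complex (of_rat q) (1 / real (Suc N)) - a"] a(2) by simp
    then have "Re a \<le> x + e" using q(1) n by linarith
    then show "Min (Re ` set as) \<le> x + e" using a(1) ne by (auto simp: Min_le_iff)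
  qed
qed

text \<open>The smallest root is measurable and can be divided out. At a nonreal point the value of the quotient
  is the quotient of the values, so the quotient satisfies the same hypotheses with one root less.\<close>

lemma measurable_real_roots:
  fixes p :: "'a \<Rightarrow> complex poly"
  assumes "\<And>x. x \<in> space M \<Longrightarrow> \<exists>as. length as = k \<and> (\<forall>a\<in>set as. Im a = 0) \<and> p x = (\<Prod>a\<leftarrow>as. [:- a, 1:])"
    and "\<And>z. Im z \<noteq> 0 \<Longrightarrow> (\<lambda>x. poly (p x) z) \<in> borel_measurable M"
  shows "\<exists>lam. (\<forall>j<k. lam j \<in> borel_measurable M) \<and>
    (\<forall>x\<in>space M. image_mset (\<lambda>j. lam j x) (mset_set {..<k}) = proots (p x))"
  using assms
proof (induction k arbitrary: p)
  case 0
  have "proots (p x) = {#}" if "x \<in> space M" for x using 0(1)[OF that] by auto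
  then show ?case by auto
next
  case (Suc k)
  have "\<forall>x\<in>space M. \<exists>as. length as = Suc k \<and> (\<forall>a\<in>set as. Im a = 0) \<and> p x = (\<Prod>a\<leftarrow>as. [:- a, 1:])"
    using Suc.prems(1) by blast
  from bchoice[OF this] obtain as where as: "\<And>x. x \<in> space M \<Longrightarrow> length (as x) = Suc k"
    "\<And>x a. x \<in> space M \<Longrightarrow> a \<in> set (as x) \<Longrightarrow> Im a = 0" "\<And>x. x \<in> space M \<Longrightarrow> p x = (\<Prod>a\<leftarrow>as x. [:- a, 1:])"
    by blast
  have ne: "as x \<noteq> []" if "x \<in> space M" for x using as(1)[OF that] by auto
  define \<mu> where "\<mu> x = Min (Re ` set (as x))" for x
  have mu_in: "complex_of_real (\<mu> x) \<in> set (as x)" if "x \<in> space M" for x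
  proof -
    have "\<mu> x \<in> Re ` set (as x)" unfolding \<mu>_def using ne[OF that] by (intro Min_in) auto
    then obtain a where a: "a \<in> set (as x)" "\<mu> x = Re a" by auto
    then have "complex_of_real (\<mu> x) = a" using as(2)[OF that a(1)] by (simp add: complex_eq_iff)
    then show ?thesis using a by simp
  qed
  have mu_meas [measurable]: "\<mu> \<in> borel_measurable M"
    unfolding borel_measurable_iff_le
  proof
    fix y
    have "{x \<in> space M. \<mu> x \<le> y} = {x \<in> space M. \<forall>n. \<exists>q::rat. \<exists>N. of_rat q \<le> y \<and>
        cmod (poly (p x) (Complex (of_rat q) (1 / real (Suc N)))) < (1 / real (Suc n)) ^ Suc k}"
    proof (intro Collect_cong conj_cong refl)
      fix x assume x: "x \<in> space M"
      have "\<forall>a\<in>set (as x). Im a = 0" using as(2)[OF x] by blast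
      from smallest_root_le_iff[OF this ne[OF x], of y]
      show "(\<mu> x \<le> y) = (\<forall>n. \<exists>q::rat. \<exists>N. of_rat q \<le> y \<and>
        cmod (poly (p x) (Complex (of_rat q) (1 / real (Suc N)))) < (1 / real (Suc n)) ^ Suc k)"
        unfolding \<mu>_def as(1)[OF x] as(3)[OF x, symmetric] .
    qed
    also have "\<dots> \<in> sets M"
    proof -
      have [measurable]: "(\<lambda>x. poly (p x) (Complex (of_rat q) (1 / real (Suc N)))) \<in> borel_measurable M" for q N
        by (rule Suc.prems(2)) simp
      show ?thesis by measurable
    qed
    finally show "{x \<in> space M. \<mu> x \<le> y} \<in> sets M" .
  qed
  \<comment> \<open>The quotient is written as a product over the remaining roots, which keeps it split.\<close>
  define p' where "p' x = (\<Prod>a\<leftarrow>remove1 (complex_of_real (\<mu> x)) (as x). [:- a, 1:])" for x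
  have p': "p x = [:- complex_of_real (\<mu> x), 1:] * p' x" if "x \<in> space M" for x
    unfolding as(3)[OF that] p'_def using mu_in[OF that] by (rule prod_list_map_remove1)
  have "\<exists>lam. (\<forall>j<k. lam j \<in> borel_measurable M) \<and>
    (\<forall>x\<in>space M. image_mset (\<lambda>j. lam j x) (mset_set {..<k}) = proots (p' x))"
  proof (rule Suc.IH)
    fix x assume x: "x \<in> space M"
    show "\<exists>as. length as = k \<and> (\<forall>a\<in>set as. Im a = 0) \<and> p' x = (\<Prod>a\<leftarrow>as. [:- a, 1:])"
      using as(1,2)[OF x] mu_in[OF x]
      by (intro exI[of _ "remove1 (complex_of_real (\<mu> x)) (as x)"]) (auto simp: p'_def length_remove1 dest!: set_remove1_subset[THEN subsetD])
  next
    fix z :: complex assume z: "Im z \<noteq> 0"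
    have [measurable]: "(\<lambda>x. poly (p x) z) \<in> borel_measurable M" by (rule Suc.prems(2)[OF z])
    have "(\<lambda>x. poly (p x) z / (z - complex_of_real (\<mu> x))) \<in> borel_measurable M" by measurable
    moreover have "poly (p' x) z = poly (p x) z / (z - complex_of_real (\<mu> x))" if "x \<in> space M" for x
    proof -
      have "z - complex_of_real (\<mu> x) \<noteq> 0" using z by (auto simp: complex_eq_iff)
      moreover have "poly (p x) z = (z - complex_of_real (\<mu> x)) * poly (p' x) z"
        by (simp add: p'[OF that] algebra_simps)
      ultimately show ?thesis by simp
    qed
    ultimately show "(\<lambda>x. poly (p' x) z) \<in> borel_measurable M" by (simp cong: measurable_cong)
  qed
  then obtain lam where lam: "\<forall>j<k. lam j \<in> borel_measurable M"
    "\<forall>x\<in>space M. image_mset (\<lambda>j. lam j x) (mset_set {..<k}) = proots (p' x)" by blast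
  define lam' where "lam' j = (if j = k then (\<lambda>x. complex_of_real (\<mu> x)) else lam j)" for j
  have "lam' j \<in> borel_measurable M" if "j < Suc k" for j
    using that lam(1) by (auto simp: lam'_def)
  moreover have "image_mset (\<lambda>j. lam' j x) (mset_set {..<Suc k}) = proots (p x)" if x: "x \<in> space M" for x
  proof -
    have "p' x \<noteq> 0" by (auto simp: p'_def prod_list_zero_iff)
    then have "proots (p x) = add_mset (complex_of_real (\<mu> x)) (proots (p' x))"
      unfolding p'[OF x] by (subst proots_mult) auto
    moreover have "image_mset (\<lambda>j. lam' j x) (mset_set {..<k}) = image_mset (\<lambda>j. lam j x) (mset_set {..<k})"
      by (intro image_mset_cong) (auto simp: lam'_def)
    ultimately show ?thesis using lam(2) x by (simp add: lessThan_Suc) (simp add: lam'_def)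
  qed
  ultimately show ?case by blast
qed

section \<open>Essential range of a periodic Hermitian symbol\<close>

text \<open>The Hermitian symmetry makes the eigenvalues real; continuity and periodicity in t identify the
  essential range with the closure of the set of all eigenvalues of all symbol values.\<close>

locale hermitian_symbol =
  fixes k :: nat and \<theta> :: "real \<Rightarrow> complex mat"
  assumes k: "k \<ge> 1"
    and carrier: "\<And>t. \<theta> t \<in> carrier_mat k k"
    and herm: "\<And>t i j. i < k \<Longrightarrow> j < k \<Longrightarrow> \<theta> t $$ (j, i) = cnj (\<theta> t $$ (i, j))"
    and cont: "\<And>i j. i < k \<Longrightarrow> j < k \<Longrightarrow> continuous_on UNIV (\<lambda>t. \<theta> t $$ (i, j))"
    and periodic: "\<And>t. \<theta> (t + 2 * pi) = \<theta> t"
begin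

abbreviation S where "S \<equiv> matrix_ess_range k {-pi..pi} \<theta>"

lemma eigval_real: "z \<in># eigvals (\<theta> t) \<Longrightarrow> Im z = 0"
  using hermitian_spectral(1)[OF carrier herm] by blast

lemma char_poly_continuous: "continuous_on UNIV (\<lambda>t. poly (char_poly (\<theta> t)) z)"
proof -
  have eq: "poly (char_poly (\<theta> t)) z = (\<Sum>\<pi> | \<pi> permutes {0..<k}. signof \<pi> *
      (\<Prod>i = 0..<k. (if i = \<pi> i then z else 0) - \<theta> t $$ (i, \<pi> i)))" for t
  proof -
    have c: "- char_matrix (\<theta> t) z \<in> carrier_mat k k" using carrier by simp
    show ?thesis unfolding char_poly_matrix[OF carrier] det_def'[OF c]
    proof (intro sum.cong refl arg_cong2[of _ _ _ _ "(*)"] prod.cong)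
      fix \<pi> i assume "\<pi> \<in> {\<pi>. \<pi> permutes {0..<k}}" "i \<in> {0..<k}"
      then have "i < k" "\<pi> i < k" using permutes_in_image[of \<pi> "{0..<k}" i] by auto
      then show "(- char_matrix (\<theta> t) z) $$ (i, \<pi> i) = (if i = \<pi> i then z else 0) - \<theta> t $$ (i, \<pi> i)"
        using carrier_matD[OF carrier[of t]] by (auto simp: char_matrix_def)
    qed
  qed
  have "continuous_on UNIV (\<lambda>t. (if i = \<pi> i then z else 0) - \<theta> t $$ (i, \<pi> i))"
    if "\<pi> permutes {0..<k}" "i \<in> {0..<k}" for \<pi> i
    using that permutes_in_image[OF that(1), of i]
    by (intro continuous_on_diff continuous_on_const cont) simp_all
  then show ?thesis unfolding eq
    by (intro continuous_on_sum continuous_on_mult continuous_on_prod continuous_on_const) auto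
qed

lemma eigval_iff_root: "z \<in># eigvals (\<theta> t) \<longleftrightarrow> poly (char_poly (\<theta> t)) z = 0"
proof -
  have "char_poly (\<theta> t) \<noteq> 0" using degree_monic_char_poly[OF carrier, of t] by auto
  then show ?thesis by (simp add: eigvals_def)
qed

text \<open>If z is an eigenvalue at t, then the determinant of z - \<theta>(t') is small for t' close to t; as it is the
  product of the differences of z and the eigenvalues, one of them is close to z.\<close>

lemma open_eigval_near: "open {t. \<exists>z\<in>#eigvals (\<theta> t). cmod (z - s) < \<epsilon>}"
proof (subst open_subopen, rule ballI)
  fix t assume "t \<in> {t. \<exists>z\<in>#eigvals (\<theta> t). cmod (z - s) < \<epsilon>}"
  then obtain z where z: "z \<in># eigvals (\<theta> t)" "cmod (z - s) < \<epsilon>" by auto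
  define d where "d = \<epsilon> - cmod (z - s)"
  have d: "d > 0" using z by (simp add: d_def)
  define U where "U = {t'. cmod (poly (char_poly (\<theta> t')) z) < d ^ k}"
  have "open U" unfolding U_def
    by (intro open_Collect_less continuous_intros char_poly_continuous)
  moreover have "t \<in> U" using z d by (simp add: U_def eigval_iff_root)
  moreover have "U \<subseteq> {t. \<exists>z\<in>#eigvals (\<theta> t). cmod (z - s) < \<epsilon>}"
  proof
    fix t' assume t': "t' \<in> U"
    obtain as where as: "length as = k" "mset as = eigvals (\<theta> t')" "char_poly (\<theta> t') = (\<Prod>a\<leftarrow>as. [:- a, 1:])"
      using poly_char_poly_eq_prod[OF carrier] .
    obtain a where a: "a \<in> set as" "cmod (z - a) < d"
      using root_near_small_value[of as z d] t' d as by (auto simp: U_def)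
    have "cmod (a - s) \<le> cmod (z - a) + cmod (z - s)"
      using norm_triangle_ineq[of "a - z" "z - s"] by (simp add: norm_minus_commute)
    then have "cmod (a - s) < \<epsilon>" using a(2) by (simp add: d_def)
    moreover have "a \<in># eigvals (\<theta> t')" using a(1) as(2) by (metis set_mset_mset)
    ultimately show "t' \<in> {t. \<exists>z\<in>#eigvals (\<theta> t). cmod (z - s) < \<epsilon>}" by blast
  qed
  ultimately show "\<exists>T. open T \<and> t \<in> T \<and> T \<subseteq> {t. \<exists>z\<in>#eigvals (\<theta> t). cmod (z - s) < \<epsilon>}" by blast
qed

lemma labelling_exists: "\<exists>lam. measurable_eigenvalue_labelling k {-pi..pi} \<theta> lam"
proof -
  have sp: "space (lebesgue_on {-pi..pi}) = {-pi..pi}" by simp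
  have "\<exists>lam. (\<forall>j<k. lam j \<in> borel_measurable (lebesgue_on {-pi..pi})) \<and>
    (\<forall>t\<in>space (lebesgue_on {-pi..pi}). image_mset (\<lambda>j. lam j t) (mset_set {..<k}) = proots (char_poly (\<theta> t)))"
  proof (rule measurable_real_roots)
    fix t
    obtain as where as: "length as = k" "mset as = eigvals (\<theta> t)" "char_poly (\<theta> t) = (\<Prod>a\<leftarrow>as. [:- a, 1:])"
      using poly_char_poly_eq_prod[OF carrier] .
    have "\<forall>a\<in>set as. Im a = 0" using eigval_real as(2) by (metis set_mset_mset)
    with as show "\<exists>as. length as = k \<and> (\<forall>a\<in>set as. Im a = 0) \<and> char_poly (\<theta> t) = (\<Prod>a\<leftarrow>as. [:- a, 1:])" by blast
  next
    fix z :: complex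
    have "continuous_on {-pi..pi} (\<lambda>t. poly (char_poly (\<theta> t)) z)"
      using char_poly_continuous continuous_on_subset by blast
    then show "(\<lambda>t. poly (char_poly (\<theta> t)) z) \<in> borel_measurable (lebesgue_on {-pi..pi})"
      by (rule continuous_imp_measurable_on_sets_lebesgue) simp
  qed
  then show ?thesis unfolding measurable_eigenvalue_labelling_def eigvals_def sp by blast
qed

text \<open>With one measurable labelling at hand, the union of the essential ranges no longer refers to it.\<close>

lemma S_eq: "S = {s. \<forall>\<epsilon>>0. emeasure lebesgue {t \<in> {-pi..pi}. \<exists>z\<in>#eigvals (\<theta> t). cmod (z - s) < \<epsilon>} > 0}"
proof -
  obtain lam where lam: "measurable_eigenvalue_labelling k {-pi..pi} \<theta> lam" using labelling_exists by blast
  have G: "{-pi..pi} \<in> sets lebesgue" by simp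
  show ?thesis unfolding matrix_ess_range_eq[OF G lam] by (rule labelling_ess_range[OF G lam])
qed

lemma near_sets: "{t \<in> {-pi..pi}. \<exists>z\<in>#eigvals (\<theta> t). cmod (z - s) < \<epsilon>} \<in> sets lebesgue"
proof -
  have "{t \<in> {-pi..pi}. \<exists>z\<in>#eigvals (\<theta> t). cmod (z - s) < \<epsilon>} = {-pi..pi} \<inter> {t. \<exists>z\<in>#eigvals (\<theta> t). cmod (z - s) < \<epsilon>}"
    by auto
  also have "\<dots> \<in> sets lebesgue"
  proof (rule sets.Int)
    show "{t. \<exists>z\<in>#eigvals (\<theta> t). cmod (z - s) < \<epsilon>} \<in> sets lebesgue"
      using borel_open[OF open_eigval_near[of s \<epsilon>]] by (simp only: sets_completionI_sets sets_lborel)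
  qed simp
  finally show ?thesis .
qed

lemma eigval_near_S:
  assumes "s \<in> S" "\<epsilon> > 0"
  shows "\<exists>t\<in>{-pi..pi}. \<exists>z\<in>#eigvals (\<theta> t). cmod (z - s) < \<epsilon>"
proof -
  have "emeasure lebesgue {t \<in> {-pi..pi}. \<exists>z\<in>#eigvals (\<theta> t). cmod (z - s) < \<epsilon>} > 0"
    using assms unfolding S_eq by blast
  then have "{t \<in> {-pi..pi}. \<exists>z\<in>#eigvals (\<theta> t). cmod (z - s) < \<epsilon>} \<noteq> {}" by (metis emeasure_empty less_irrefl)
  then show ?thesis by blast
qed

lemma periodic_int: "\<theta> (t + 2 * pi * of_int i) = \<theta> t"
proof (induction i rule: int_induct[of _ 0])
  case base
  show ?case by simp
next
  case (step1 i)
  then show ?case using periodic[of "t + 2 * pi * of_int i"] by (simp add: algebra_simps)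
next
  case (step2 i)
  then show ?case using periodic[of "t + 2 * pi * of_int (i - 1)"] by (simp add: algebra_simps)
qed

text \<open>After a shift by a period, the parameters with an eigenvalue close to z form an open set that meets
  the interior of the interval, and nonempty open sets have positive measure.\<close>

lemma eigval_in_S:
  assumes z: "z \<in># eigvals (\<theta> t)"
  shows "z \<in> S"
proof -
  \<comment> \<open>The shift by i periods moves t into the interval from -\<pi> to \<pi>.\<close>
  define i where "i = \<lfloor>(t + pi) / (2 * pi)\<rfloor>"
  define t' where "t' = t + 2 * pi * of_int (- i)"
  have "of_int i \<le> (t + pi) / (2 * pi)" "(t + pi) / (2 * pi) < of_int i + 1" by (auto simp: i_def)
  then have t': "-pi \<le> t'" "t' \<le> pi" by (auto simp: t'_def field_simps)
  have z': "z \<in># eigvals (\<theta> t')" unfolding t'_def periodic_int by (rule z)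
  have pos: "emeasure lebesgue {t \<in> {-pi..pi}. \<exists>z'\<in>#eigvals (\<theta> t). cmod (z' - z) < \<epsilon>} > 0" if e: "\<epsilon> > 0" for \<epsilon>
  proof -
    define U where "U = {t. \<exists>z'\<in>#eigvals (\<theta> t). cmod (z' - z) < \<epsilon>}"
    have U: "open U" unfolding U_def by (rule open_eigval_near)
    have "t' \<in> U" using z' e by (auto simp: U_def intro!: bexI[of _ z])
    moreover have "t' \<in> closure {-pi<..<pi}" using t' by simp
    ultimately have "U \<inter> {-pi<..<pi} \<noteq> {}" using open_Int_closure_eq_empty[OF U, of "{-pi<..<pi}"] by blast
    moreover have op: "open (U \<inter> {-pi<..<pi})" using U by (intro open_Int) auto
    ultimately have "\<not> negligible (U \<inter> {-pi<..<pi})" by (intro open_not_negligible)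
    moreover have "U \<inter> {-pi<..<pi} \<in> sets lebesgue" using op by auto
    ultimately have "emeasure lebesgue (U \<inter> {-pi<..<pi}) > 0"
      by (simp add: negligible_iff_emeasure0 zero_less_iff_neq_zero)
    also have "\<dots> \<le> emeasure lebesgue {t \<in> {-pi..pi}. \<exists>z'\<in>#eigvals (\<theta> t). cmod (z' - z) < \<epsilon>}"
      by (intro emeasure_mono near_sets) (auto simp: U_def)
    finally show ?thesis .
  qed
  show ?thesis unfolding S_eq mem_Collect_eq
  proof (intro allI impI)
    fix \<epsilon> :: real assume "\<epsilon> > 0"
    then show "0 < emeasure lebesgue {t \<in> {-pi..pi}. \<exists>z'\<in>#eigvals (\<theta> t). cmod (z' - z) < \<epsilon>}" by (rule pos)
  qed
qed

lemma S_nonempty: "S \<noteq> {}"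
proof -
  have "size (eigvals (\<theta> 0)) = k" by (rule size_eigvals[OF carrier])
  then have "eigvals (\<theta> 0) \<noteq> {#}" using k by auto
  then obtain z where "z \<in># eigvals (\<theta> 0)" by blast
  then show ?thesis using eigval_in_S by blast
qed

lemma S_closed: "closed S"
  unfolding closed_sequential_limits
proof (intro allI impI, elim conjE)
  fix x l assume x: "\<forall>n. x n \<in> S" and lim: "x \<longlonglongrightarrow> l"
  have pos: "emeasure lebesgue {t \<in> {-pi..pi}. \<exists>z\<in>#eigvals (\<theta> t). cmod (z - l) < \<epsilon>} > 0" if e: "\<epsilon> > 0" for \<epsilon>
  proof -
    from lim obtain n where n: "dist (x n) l < \<epsilon> / 2" using e unfolding lim_sequentially by (meson half_gt_zero order_refl)
    have "x n \<in> S" using x by blast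
    then have "0 < emeasure lebesgue {t \<in> {-pi..pi}. \<exists>z\<in>#eigvals (\<theta> t). cmod (z - x n) < \<epsilon> / 2}"
      unfolding S_eq mem_Collect_eq using half_gt_zero[OF e] by (elim allE impE)
    also have "\<dots> \<le> emeasure lebesgue {t \<in> {-pi..pi}. \<exists>z\<in>#eigvals (\<theta> t). cmod (z - l) < \<epsilon>}"
    proof (intro emeasure_mono near_sets subsetI)
      fix t assume "t \<in> {t \<in> {-pi..pi}. \<exists>z\<in>#eigvals (\<theta> t). cmod (z - x n) < \<epsilon> / 2}"
      then obtain z where z: "t \<in> {-pi..pi}" "z \<in># eigvals (\<theta> t)" "cmod (z - x n) < \<epsilon> / 2" by blast
      have "cmod (z - l) < \<epsilon>" using n z(3) norm_triangle_ineq[of "z - x n" "x n - l"] by (simp add: dist_norm)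
      with z show "t \<in> {t \<in> {-pi..pi}. \<exists>z\<in>#eigvals (\<theta> t). cmod (z - l) < \<epsilon>}" by blast
    qed
    finally show ?thesis .
  qed
  show "l \<in> S" unfolding S_eq mem_Collect_eq
  proof (intro allI impI)
    fix \<epsilon> :: real assume "\<epsilon> > 0"
    then show "0 < emeasure lebesgue {t \<in> {-pi..pi}. \<exists>z\<in>#eigvals (\<theta> t). cmod (z - l) < \<epsilon>}" by (rule pos)
  qed
qed

lemma S_real: 
  assumes s: "s \<in> S" 
  shows "Im s = 0"
proof (rule ccontr)
  assume "Im s \<noteq> 0"
  then obtain t z where "z \<in># eigvals (\<theta> t)" "cmod (z - s) < \<bar>Im s\<bar>" using eigval_near_S[OF s, of "\<bar>Im s\<bar>"] by auto
  then show False using eigval_real abs_Im_le_cmod[of "z - s"] by fastforce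
qed

lemma S_bounded:
  assumes "\<And>t i j. i < k \<Longrightarrow> j < k \<Longrightarrow> cmod (\<theta> t $$ (i, j)) \<le> M" and s: "s \<in> S"
  shows "cmod s \<le> real k * M"
proof (rule field_le_epsilon)
  fix e :: real assume "e > 0"
  then obtain t z where z: "z \<in># eigvals (\<theta> t)" "cmod (z - s) < e" using eigval_near_S[OF s] by blast
  have "row_bounded k (real k * M) (\<theta> t)" unfolding row_bounded_def
    using assms(1) by (auto intro!: order_trans[OF sum_bounded_above[where K = M]])
  moreover have "col_bounded k (real k * M) (\<theta> t)" unfolding col_bounded_def
    using assms(1) by (auto intro!: order_trans[OF sum_bounded_above[where K = M]])
  ultimately have "cmod z \<le> real k * M" using norm_eigval_le[OF carrier] z(1) by blast
  then show "cmod s \<le> real k * M + e" using z(2) norm_triangle_ineq2[of s z] by (simp add: norm_minus_commute)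
qed

text \<open>The interval is placed inside one period that starts at 0, because the sampling points 2 \<pi> l / m
  with l < m lie there.\<close>

lemma eigval_near_on_interval:
  assumes s: "s \<in> S" and e: "\<epsilon> > 0"
  obtains u v where "0 \<le> u" "u < v" "v < 2 * pi" "\<And>t. u \<le> t \<Longrightarrow> t \<le> v \<Longrightarrow> \<exists>z\<in>#eigvals (\<theta> t). cmod (z - s) < \<epsilon>"
proof -
  obtain t where "t \<in> {-pi..pi}" and t3: "\<exists>z\<in>#eigvals (\<theta> t). cmod (z - s) < \<epsilon>"
    using eigval_near_S[OF s e] by (rule bexE)
  then have t: "-pi \<le> t" "t \<le> pi" by auto
  define u where "u = (if t < 0 then t + 2 * pi else t)"
  have u: "0 \<le> u" "u < 2 * pi" using t pi_gt_zero by (auto simp: u_def simp del: pi_gt_zero)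
  have "\<theta> u = \<theta> t" by (simp add: u_def periodic)
  then have "u \<in> {t. \<exists>z\<in>#eigvals (\<theta> t). cmod (z - s) < \<epsilon>}" using t3 by simp
  then obtain d where d: "d > 0" "\<And>t'. dist t' u < d \<Longrightarrow> \<exists>z\<in>#eigvals (\<theta> t'). cmod (z - s) < \<epsilon>"
    using open_eigval_near[of s \<epsilon>] unfolding open_dist by blast
  define v where "v = min (u + d / 2) ((u + 2 * pi) / 2)"
  show ?thesis
  proof (rule that[of u v])
    fix t' assume "u \<le> t'" "t' \<le> v"
    then show "\<exists>z\<in>#eigvals (\<theta> t'). cmod (z - s) < \<epsilon>" using d by (intro d(2)) (auto simp: dist_real_def v_def)
  qed (use u d in \<open>auto simp: v_def min_def\<close>)
qed

end

section \<open>The circulant of the generating function\<close>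

lemma block_index_eq_iff:
  assumes "r < k" "s < (k::nat)"
  shows "p * k + r = q * k + s \<longleftrightarrow> p = q \<and> r = s"
proof
  assume eq: "p * k + r = q * k + s"
  have "(p * k + r) div k = p" "(q * k + s) div k = q" "(p * k + r) mod k = r" "(q * k + s) mod k = s"
    using assms by auto
  with eq show "p = q \<and> r = s" by metis
qed simp

lemma block_index_Suc_iff:
  assumes "r < k" "s < (k::nat)"
  shows "p * k + r = q * k + s + 1 \<longleftrightarrow> (p = q \<and> r = s + 1) \<or> (p = q + 1 \<and> r = 0 \<and> s = k - 1)"
proof (cases "s + 1 < k")
  case True
  then show ?thesis using block_index_eq_iff[OF assms(1) True, of p q] by auto
next
  case False
  then have s: "s = k - 1" "q * k + s + 1 = (q + 1) * k + 0" using assms by auto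
  show ?thesis unfolding s(2) using block_index_eq_iff[OF assms(1), of 0 p "q + 1"] assms s(1) by auto
qed

lemma periodic_block:
  fixes f :: "nat \<Rightarrow> 'a"
  assumes "\<forall>n. f (n + k) = f n"
  shows "f (p * k + r) = f r"
proof (induction p)
  case (Suc p)
  have "f (Suc p * k + r) = f (p * k + r + k)" by (simp add: algebra_simps)
  then show ?case using assms Suc by simp
qed simp

lemma symmetric_jacobi_index:
  "symmetric_jacobi_matrix a b i j = complex_of_real
    (if i = j then b i else if i = j + 1 then a i else if j = i + 1 then a j else 0)"
  by (simp add: symmetric_jacobi_matrix_def jacobi_matrix_def)

text \<open>Periodicity makes all diagonal blocks equal. Neighbouring blocks interact only through the entry
  a 0 in one corner.\<close>

lemma symmetric_jacobi_block:
  assumes a: "\<forall>n. a (n + k) = a n" and b: "\<forall>n. b (n + k) = b n" and rs: "r < k" "s < k"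
  shows "symmetric_jacobi_matrix a b (p * k + r) (q * k + s) =
    (if p = q then symmetric_jacobi_matrix a b r s else 0)
    + (if p = q + 1 \<and> r = 0 \<and> s = k - 1 then of_real (a 0) else 0)
    + (if q = p + 1 \<and> r = k - 1 \<and> s = 0 then of_real (a 0) else 0)"
proof -
  have e0: "p * k + r = q * k + s \<longleftrightarrow> p = q \<and> r = s" by (rule block_index_eq_iff[OF rs])
  have e1: "p * k + r = q * k + s + 1 \<longleftrightarrow> (p = q \<and> r = s + 1) \<or> (p = q + 1 \<and> r = 0 \<and> s = k - 1)"
    by (rule block_index_Suc_iff[OF rs])
  have e2: "q * k + s = p * k + r + 1 \<longleftrightarrow> (q = p \<and> s = r + 1) \<or> (q = p + 1 \<and> s = 0 \<and> r = k - 1)"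
    by (rule block_index_Suc_iff[OF rs(2,1)])
  show ?thesis
    unfolding symmetric_jacobi_index e0 e1 e2 periodic_block[of a, OF a] periodic_block[of b, OF b]
    by auto
qed

lemma generating_function_index:
  assumes "r < k" "s < k"
  shows "generating_function k a b t $$ (r, s) = symmetric_jacobi_matrix a b r s
    + (if r = 0 \<and> s = k - 1 then of_real (a 0) else 0) * cis t
    + (if r = k - 1 \<and> s = 0 then of_real (a 0) else 0) * cnj (cis t)"
  using assms by (simp add: generating_function_def leading_block_def matrix_unit_def cis_conv_exp exp_cnj)

lemma generating_function_carrier: "generating_function k a b t \<in> carrier_mat k k"
  by (simp add: generating_function_def leading_block_def matrix_unit_def)

lemma hermitian_symbol_generating_function:
  assumes "k \<ge> 1"
  shows "hermitian_symbol k (generating_function k a b)"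
proof
  fix t
  show "generating_function k a b (t + 2 * pi) = generating_function k a b t"
    by (rule eq_matI)
      (auto simp: generating_function_carrier[THEN carrier_matD(1)] generating_function_carrier[THEN carrier_matD(2)]
        generating_function_index cis_mult[symmetric] simp flip: cis_cnj)
next
  fix t i j assume "i < k" "j < k"
  then show "generating_function k a b t $$ (j, i) = cnj (generating_function k a b t $$ (i, j))"
    by (auto simp: generating_function_index symmetric_jacobi_index)
next
  fix i j assume "i < k" "j < k"
  then show "continuous_on UNIV (\<lambda>t. generating_function k a b t $$ (i, j))"
    unfolding generating_function_index[OF \<open>i < k\<close> \<open>j < k\<close>] by (intro continuous_intros)
qed (use assms generating_function_carrier in auto)

text \<open>At the sampled frequencies, e^{it} and e^{-it} are values of characters and shift the block index by
  one, which puts the corner entries of the symbol into the neighbouring blocks. The shift is cyclic and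
  produces the two additional corner entries.\<close>

lemma block_circulant_generating_function:
  assumes a: "\<forall>n. a (n + k) = a n" and b: "\<forall>n. b (n + k) = b n" and k: "k \<ge> 1"
    and mk: "m * k \<le> n" and ij: "i < m * k" "j < m * k"
  shows "block_circulant n k m z (\<lambda>l. generating_function k a b (2 * pi * real l / real m)) $$ (i, j) =
    symmetric_jacobi_matrix a b i j
    + (if i = 0 \<and> j = m * k - 1 then of_real (a 0) else 0)
    + (if i = m * k - 1 \<and> j = 0 then of_real (a 0) else 0)"
proof -
  define p r q s where "p = i div k" and "r = i mod k" and "q = j div k" and "s = j mod k"
  have m: "m > 0" using ij by (cases m) auto
  have pq: "p < m" "q < m" and rs: "r < k" "s < k" and ijd: "i = p * k + r" "j = q * k + s"
    using ij k by (auto simp: p_def q_def r_def s_def less_mult_imp_div_less)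
  define X where "X x y = (\<Sum>l<m. cnj (fourier m l x) * fourier m l y) / of_nat m" for x y
  have X: "X x y = (if x = y then 1 else 0)" if "x < m" "y < m" for x y
    using m by (simp add: X_def fourier_orthogonal[OF that])
  have X1: "X x (y + 1) = (if x = y + 1 \<or> x = 0 \<and> y = m - 1 then 1 else 0)" if "x < m" "y < m" for x y
  proof (cases "y + 1 = m")
    case True
    have "X x (y + 1) = X x 0" unfolding True X_def using m by (simp add: fourier_period)
    then show ?thesis using X[OF that(1) m] that True by auto
  next
    case False
    then have "y + 1 < m" using that by simp
    then show ?thesis using X[OF that(1) \<open>y + 1 < m\<close>] False that by auto
  qed
  have X2: "X (x + 1) y = (if y = x + 1 \<or> y = 0 \<and> x = m - 1 then 1 else 0)" if "x < m" "y < m" for x y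
  proof -
    have "X (x + 1) y = cnj (X y (x + 1))" by (simp add: X_def mult.commute)
    then show ?thesis unfolding X1[OF that(2,1)] by simp
  qed
  have zero: "x * k + y = 0 \<longleftrightarrow> x = 0 \<and> y = 0" for x y using k by auto
  have last: "x * k + y = m * k - 1 \<longleftrightarrow> x = m - 1 \<and> y = k - 1" if "y < k" for x y
  proof -
    have "m * k > 0" using m k by simp
    then have "x * k + y = m * k - 1 \<longleftrightarrow> m * k + 0 = x * k + y + 1" by linarith
    also have "\<dots> \<longleftrightarrow> x = m - 1 \<and> y = k - 1"
      using block_index_Suc_iff[of 0 k y m x] that k m by auto
    finally show ?thesis .
  qed
  define A B B' where "A = symmetric_jacobi_matrix a b r s"
    and "B = (if r = 0 \<and> s = k - 1 then complex_of_real (a 0) else 0)"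
    and "B' = (if r = k - 1 \<and> s = 0 then complex_of_real (a 0) else 0)"
  have "block_circulant n k m z (\<lambda>l. generating_function k a b (2 * pi * real l / real m)) $$ (i, j)
      = (\<Sum>l<m. cnj (fourier m l p) * fourier m l q * (A + B * fourier m l 1 + B' * cnj (fourier m l 1))) / of_nat m"
    unfolding ijd
    by (simp add: block_circulant_block_index[OF pq rs mk] generating_function_index[OF rs] A_def B_def B'_def fourier_def)
  also have "\<dots> = (\<Sum>l<m. A * (cnj (fourier m l p) * fourier m l q) + B * (cnj (fourier m l p) * fourier m l (q + 1))
      + B' * (cnj (fourier m l (p + 1)) * fourier m l q)) / of_nat m"
    unfolding fourier_add by (intro arg_cong2[of _ _ _ _ "(/)"] sum.cong refl) (simp add: algebra_simps)
  also have "\<dots> = A * X p q + B * X p (q + 1) + B' * X (p + 1) q"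
    by (simp add: X_def sum.distrib sum_distrib_left[symmetric] add_divide_distrib)
  also have "\<dots> = symmetric_jacobi_matrix a b i j + (if p = 0 \<and> q = m - 1 then B else 0) + (if q = 0 \<and> p = m - 1 then B' else 0)"
    unfolding X[OF pq] X1[OF pq] X2[OF pq] ijd symmetric_jacobi_block[OF a b rs] A_def B_def B'_def
    using m by (auto split: if_splits)
  also have "(if p = 0 \<and> q = m - 1 then B else 0) = (if i = 0 \<and> j = m * k - 1 then of_real (a 0) else 0)"
    using zero[of p r] last[OF rs(2), of q] by (auto simp: B_def ijd)
  also have "(if q = 0 \<and> p = m - 1 then B' else 0) = (if i = m * k - 1 \<and> j = 0 then of_real (a 0) else 0)"
    using zero[of q s] last[OF rs(1), of p] by (auto simp: B'_def ijd)
  finally show ?thesis .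
qed

section \<open>Trace class perturbations of a periodic Jacobi matrix\<close>

lemma sum_of_bool_le_1:
  assumes "\<And>x y. P x \<Longrightarrow> P y \<Longrightarrow> x = y"
  shows "(\<Sum>j<n::nat. of_bool (P j)) \<le> (1::real)"
proof -
  have "card ({..<n} \<inter> {x. P x}) \<le> Suc 0"
    by (subst card_le_Suc0_iff_eq) (use assms in auto)
  then show ?thesis by (simp add: sum_of_bool_eq)
qed

text \<open>The tridiagonal pattern, and below it the pattern of the two positions at which a circulant of size N
  wraps around; for N = 1 both of these are the same position, which is then counted twice.\<close>

definition band :: "nat \<Rightarrow> nat \<Rightarrow> real" where
  "band i j = of_bool (i = j) + of_bool (i = j + 1) + of_bool (j = i + 1)"

definition corner :: "nat \<Rightarrow> nat \<Rightarrow> nat \<Rightarrow> real" where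
  "corner N i j = of_bool (i = 0 \<and> j = N - 1) + of_bool (i = N - 1 \<and> j = 0)"

lemma band_nonneg: "band i j \<ge> 0" and corner_nonneg: "corner N i j \<ge> 0"
  by (auto simp: band_def corner_def)

lemma band_sums: "(\<Sum>j<n. band i j) \<le> 3" "(\<Sum>i<n. band i j) \<le> 3"
proof -
  have "(\<Sum>j<n. band i j) \<le> 1 + 1 + 1" unfolding band_def sum.distrib
    by (intro add_mono sum_of_bool_le_1) auto
  then show "(\<Sum>j<n. band i j) \<le> 3" by simp
  have "(\<Sum>i<n. band i j) \<le> 1 + 1 + 1" unfolding band_def sum.distrib
    by (intro add_mono sum_of_bool_le_1) auto
  then show "(\<Sum>i<n. band i j) \<le> 3" by simp
qed

lemma corner_sums: "(\<Sum>j<n. corner N i j) \<le> 2" "(\<Sum>i<n. \<Sum>j<n. corner N i j) \<le> 2"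
proof -
  have "(\<Sum>j<n. corner N i j) \<le> 1 + 1" unfolding corner_def sum.distrib
    by (intro add_mono sum_of_bool_le_1) auto
  then show "(\<Sum>j<n. corner N i j) \<le> 2" by simp
  have one: "(\<Sum>i<n. \<Sum>j<n. of_bool (i = c \<and> j = d)) \<le> (1::real)" for c d
  proof -
    have "(\<Sum>i<n. \<Sum>j<n. of_bool (i = c \<and> j = d)) \<le> (\<Sum>i<n. of_bool (i = c) :: real)"
    proof (rule sum_mono)
      fix i
      have "(\<Sum>j<n. of_bool (i = c \<and> j = d)) = of_bool (i = c) * (\<Sum>j<n. of_bool (j = d) :: real)"
        by (simp add: sum_distrib_left of_bool_conj)
      also have "\<dots> \<le> of_bool (i = c) * 1" by (intro mult_left_mono sum_of_bool_le_1) auto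
      finally show "(\<Sum>j<n. of_bool (i = c \<and> j = d)) \<le> (of_bool (i = c) :: real)" by simp
    qed
    also have "\<dots> \<le> 1" by (rule sum_of_bool_le_1) simp
    finally show ?thesis .
  qed
  have "(\<Sum>i<n. \<Sum>j<n. corner N i j) \<le> 1 + 1" unfolding corner_def sum.distrib
    by (intro add_mono one)
  then show "(\<Sum>i<n. \<Sum>j<n. corner N i j) \<le> 2" by simp
qed

lemma sum_from_1:
  fixes f :: "nat \<Rightarrow> real"
  assumes "\<And>i. f i \<ge> 0"
  shows "(\<Sum>i<n. of_bool (1 \<le> i) * f i) \<le> (\<Sum>i=1..n. f i)"
proof -
  have "(\<Sum>i<Suc n. of_bool (1 \<le> i) * f i) = (\<Sum>i=1..n. f i)" by (induction n) auto
  moreover have "0 \<le> of_bool (1 \<le> n) * f n" using assms by simp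
  ultimately show ?thesis by simp
qed

text \<open>Only g has an entry of index 0: the first row contains no subdiagonal entry and the first column no
  superdiagonal one.\<close>

lemma l1_tridiagonal_le:
  fixes f g h :: "nat \<Rightarrow> real"
  assumes nn: "\<And>i. f i \<ge> 0" "\<And>i. g i \<ge> 0" "\<And>i. h i \<ge> 0"
  shows "(\<Sum>i<n. \<Sum>j<n. of_bool (i = j) * g i + of_bool (i = j + 1) * f i + of_bool (j = i + 1) * h j)
    \<le> g 0 + (\<Sum>i=1..n. f i + g i + h i)"
proof -
  have row: "(\<Sum>j<n. of_bool (i = j + 1) :: real) \<le> of_bool (1 \<le> i)" for i
  proof (cases "1 \<le> i")
    case True
    then show ?thesis using sum_of_bool_le_1[of "\<lambda>j. i = j + 1" n] by simp
  qed simp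
  have "(\<Sum>i<n. \<Sum>j<n. of_bool (i = j) * g i) = (\<Sum>i<n. (\<Sum>j<n. of_bool (i = j)) * g i)"
    by (simp only: sum_distrib_right)
  also have "\<dots> \<le> (\<Sum>i<n. 1 * g i)"
    using nn by (intro sum_mono mult_right_mono sum_of_bool_le_1) auto
  also have "\<dots> = (\<Sum>i<n. of_bool (i = 0) * g 0 + of_bool (1 \<le> i) * g i)"
    by (intro sum.cong refl) (auto simp: Suc_le_eq)
  also have "\<dots> = (\<Sum>i<n. of_bool (i = 0)) * g 0 + (\<Sum>i<n. of_bool (1 \<le> i) * g i)"
    by (simp only: sum.distrib sum_distrib_right)
  also have "\<dots> \<le> 1 * g 0 + (\<Sum>i=1..n. g i)"
    using nn by (intro add_mono mult_right_mono sum_of_bool_le_1 sum_from_1) auto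
  finally have G: "(\<Sum>i<n. \<Sum>j<n. of_bool (i = j) * g i) \<le> g 0 + (\<Sum>i=1..n. g i)" by simp
  have off: "(\<Sum>i<n. \<Sum>j<n. of_bool (i = j + 1) * f' i) \<le> (\<Sum>i=1..n. f' i)" if "\<And>i. f' i \<ge> 0" for f' :: "nat \<Rightarrow> real"
  proof -
    have "(\<Sum>i<n. \<Sum>j<n. of_bool (i = j + 1) * f' i) = (\<Sum>i<n. (\<Sum>j<n. of_bool (i = j + 1)) * f' i)"
      by (simp only: sum_distrib_right)
    also have "\<dots> \<le> (\<Sum>i<n. of_bool (1 \<le> i) * f' i)"
      using that row by (intro sum_mono mult_right_mono) auto
    also have "\<dots> \<le> (\<Sum>i=1..n. f' i)" by (rule sum_from_1[OF that])
    finally show ?thesis .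
  qed
  have "(\<Sum>i<n. \<Sum>j<n. of_bool (j = i + 1) * h j) = (\<Sum>j<n. \<Sum>i<n. of_bool (j = i + 1) * h j)" by (rule sum.swap)
  also have "\<dots> \<le> (\<Sum>i=1..n. h i)" by (rule off[OF nn(3)])
  finally show ?thesis using G off[of f, OF nn(1)] by (simp add: sum.distrib)
qed

lemma card_nat_interval_ge:
  fixes x y :: real
  assumes "0 \<le> x"
  shows "real (card {l::nat. x \<le> real l \<and> real l \<le> y}) \<ge> y - x - 1"
proof (cases "x \<le> y")
  case False
  then show ?thesis by simp
next
  case True
  have "{l::nat. x \<le> real l \<and> real l \<le> y} = {nat \<lceil>x\<rceil>..nat \<lfloor>y\<rfloor>}"
    using assms True by (auto simp: nat_le_iff ceiling_le_iff le_nat_iff le_floor_iff)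
  then have "real (card {l::nat. x \<le> real l \<and> real l \<le> y}) = real (Suc (nat \<lfloor>y\<rfloor>) - nat \<lceil>x\<rceil>)" by simp
  also have "\<dots> \<ge> real (Suc (nat \<lfloor>y\<rfloor>)) - real (nat \<lceil>x\<rceil>)" by linarith
  moreover have "real (nat \<lfloor>y\<rfloor>) = of_int \<lfloor>y\<rfloor>" "real (nat \<lceil>x\<rceil>) = of_int \<lceil>x\<rceil>" using assms True by auto
  ultimately show ?thesis by linarith
qed

locale periodic_background =
  fixes k :: nat and a0 b0 :: "nat \<Rightarrow> real"
  assumes k1: "k \<ge> 1"
    and a0_per: "\<forall>n. a0 (n + k) = a0 n" and b0_per: "\<forall>n. b0 (n + k) = b0 n"
begin

sublocale hermitian_symbol k "generating_function k a0 b0"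
  by (rule hermitian_symbol_generating_function[OF k1])

definition sample :: "nat \<Rightarrow> nat \<Rightarrow> complex mat" where
  "sample n l = generating_function k a0 b0 (2 * pi * real l / real (n div k))"

text \<open>The circulant takes up the largest multiple of k that fits into n, and the remaining diagonal entries
  are z; for z in S the whole spectrum then lies in S.\<close>

definition model :: "complex \<Rightarrow> nat \<Rightarrow> complex mat" where
  "model z n = block_circulant n k (n div k) z (sample n)"

lemma k_pos: "k > 0" using k1 by simp

lemma div_le: "n div k * k \<le> n" by simp

lemma sample_carrier: "sample n l \<in> carrier_mat k k"
  by (simp add: sample_def carrier)

lemma poly_mat_model: "poly_mat p (model z n) = block_circulant n k (n div k) (poly p z) (\<lambda>l. poly_mat p (sample n l))"
  unfolding model_def by (rule poly_mat_block_circulant[OF k_pos div_le sample_carrier])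

lemma sample_eigval: "z \<in># eigvals (sample n l) \<Longrightarrow> z \<in> S"
  unfolding sample_def by (rule eigval_in_S)

lemma model_negative:
  assumes z: "z \<in> S" and p: "\<And>s. s \<in> S \<Longrightarrow> Re (poly p s) \<le> 0"
  shows "Re (qform n (poly_mat p (model z n)) v) \<le> 0"
proof -
  have herm': "sample n l $$ (j, i) = cnj (sample n l $$ (i, j))" if "i < k" "j < k" for i j l
    unfolding sample_def using that by (rule herm)
  have neg: "Re (qform k (poly_mat p (sample n l)) w) \<le> 0" for l w
    by (rule hermitian_spectral(2)[OF sample_carrier herm']) (use p sample_eigval in blast)+
  have "Re (\<Sum>l<n div k. qform k (poly_mat p (sample n l)) (w l)) \<le> 0" for w
    unfolding Re_sum by (intro sum_nonpos neg)
  then have blocks: "Re ((\<Sum>l<n div k. qform k (poly_mat p (sample n l)) (w l)) / of_nat (n div k)) \<le> 0" for w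
    unfolding Re_divide_of_nat by (intro divide_nonpos_nonneg) auto
  have "Re (poly p z) * (\<Sum>x=n div k * k..<n. (cmod (v x))\<^sup>2) \<le> 0"
    using p[OF z] by (intro mult_nonpos_nonneg sum_nonneg) auto
  then have rest: "Re (poly p z * of_real (\<Sum>x=n div k * k..<n. (cmod (v x))\<^sup>2)) \<le> 0"
    by (simp del: of_real_sum)
  show ?thesis
    unfolding poly_mat_model qform_block_circulant[OF k_pos div_le] plus_complex.sel
    by (intro add_nonpos_nonpos blocks rest)
qed

text \<open>On a whole interval of parameters the symbol has an eigenvalue near s, and the number of sampling
  points in it grows linearly with n. Each of them contributes at least \<alpha> to the trace, and all other
  contributions are nonnegative.\<close>

lemma model_trace_lower:
  assumes s: "s \<in> S" and z: "z \<in> S" and e: "\<epsilon> > 0"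
  shows "\<exists>c>0. \<exists>n0. \<forall>n\<ge>n0. \<forall>p \<alpha>. \<alpha> \<ge> 0 \<longrightarrow> (\<forall>x\<in>S. Re (poly p x) \<ge> 0) \<longrightarrow>
      (\<forall>x\<in>S. cmod (x - s) < \<epsilon> \<longrightarrow> Re (poly p x) \<ge> \<alpha>) \<longrightarrow>
      Re (\<Sum>a<n. poly_mat p (model z n) $$ (a, a)) \<ge> \<alpha> * c * real n"
proof -
  obtain u v where uv: "0 \<le> u" "u < v" "v < 2 * pi"
    "\<And>t. u \<le> t \<Longrightarrow> t \<le> v \<Longrightarrow> \<exists>z\<in>#eigvals (generating_function k a0 b0 t). cmod (z - s) < \<epsilon>"
    using eigval_near_on_interval[OF s e] by blast
  define w where "w = (v - u) / (2 * pi)"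
  have w: "w > 0" using uv by (simp add: w_def)
  \<comment> \<open>About w n / k sampling points lie in the interval; half of this absorbs the rounding errors.\<close>
  define c where "c = w / (2 * real k)"
  have c: "c > 0" using w k_pos by (simp add: c_def)
  obtain n0 :: nat where n0: "(w + 1) / c \<le> real n0" using real_arch_simple by blast
  have "Re (\<Sum>a<n. poly_mat p (model z n) $$ (a, a)) \<ge> \<alpha> * c * real n"
    if n: "n \<ge> n0" and al: "\<alpha> \<ge> 0" and p: "\<forall>x\<in>S. Re (poly p x) \<ge> 0"
      "\<forall>x\<in>S. cmod (x - s) < \<epsilon> \<longrightarrow> Re (poly p x) \<ge> \<alpha>" for n p \<alpha>
  proof -
    define m where "m = n div k"
    define L where "L = {l. l < m \<and> (\<exists>z\<in>#eigvals (sample n l). cmod (z - s) < \<epsilon>)}"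
    have nonneg: "0 \<le> (\<Sum>z\<in>#M. Re (poly p z))" if "\<And>z. z \<in># M \<Longrightarrow> z \<in> S" for M
      using that by (induction M) (use p(1) in auto)
    have contrib: "(if l \<in> L then \<alpha> else 0) \<le> (\<Sum>z\<in>#eigvals (sample n l). Re (poly p z))" for l
    proof (cases "l \<in> L")
      case True
      then obtain x where x: "x \<in># eigvals (sample n l)" "cmod (x - s) < \<epsilon>" by (auto simp: L_def)
      obtain N where N: "eigvals (sample n l) = add_mset x N" using multi_member_split[OF x(1)] by blast
      have "\<alpha> \<le> Re (poly p x)" using p(2) x sample_eigval by blast
      moreover have "0 \<le> (\<Sum>z\<in>#N. Re (poly p z))"
      proof (rule nonneg)
        fix z assume "z \<in># N"
        then have "z \<in># eigvals (sample n l)" by (simp add: N)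
        then show "z \<in> S" by (rule sample_eigval)
      qed
      ultimately show ?thesis using True by (simp add: N)
    next
      case False
      then show ?thesis using nonneg[OF sample_eigval] by simp
    qed
    have "real m * w - 1 \<le> real (card L)"
    proof (cases "m = 0")
      case True
      then show ?thesis by simp
    next
      case False
      define I where "I = {l::nat. real m * u / (2 * pi) \<le> real l \<and> real l \<le> real m * v / (2 * pi)}"
      have "I \<subseteq> L"
      proof
        fix l assume "l \<in> I"
        then have l: "u \<le> 2 * pi * real l / real m" "2 * pi * real l / real m \<le> v"
          using False by (auto simp: I_def field_simps)
        then have "2 * pi * real l / real m < 2 * pi" using uv by linarith
        then have "l < m" using False by (simp add: field_simps)
        then show "l \<in> L" using uv(4)[OF l] by (simp add: L_def sample_def m_def)
      qed
      then have "card I \<le> card L" by (intro card_mono) (auto simp: L_def)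
      moreover have "real m * v / (2 * pi) - real m * u / (2 * pi) - 1 \<le> real (card I)"
        unfolding I_def using uv by (intro card_nat_interval_ge) simp
      moreover have "real m * v / (2 * pi) - real m * u / (2 * pi) = real m * w"
        by (simp add: w_def field_simps)
      ultimately show ?thesis by linarith
    qed
    moreover have "real m \<ge> real n / real k - 1"
    proof -
      have "n < Suc m * k" using dividend_less_div_times[OF k_pos, of n] by (simp add: m_def)
      then have "real n < (real m + 1) * real k" by (metis of_nat_Suc of_nat_less_iff of_nat_mult add.commute)
      then show ?thesis using k_pos by (simp add: field_simps)
    qed
    then have "real m * w \<ge> (real n / real k - 1) * w" using w by (intro mult_right_mono) auto
    moreover have "(real n / real k - 1) * w = 2 * c * real n - w" using k_pos by (simp add: c_def field_simps)
    moreover have "w + 1 \<le> c * real n"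
    proof -
      have "w + 1 \<le> c * real n0" using n0 c by (simp add: field_simps)
      also have "\<dots> \<le> c * real n" using n c by (intro mult_left_mono) auto
      finally show ?thesis .
    qed
    ultimately have cL: "c * real n \<le> real (card L)" by linarith
    have "\<alpha> * c * real n \<le> \<alpha> * real (card L)" using mult_left_mono[OF cL al] by (simp add: mult_ac)
    also have "\<dots> = (\<Sum>l<m. if l \<in> L then \<alpha> else 0)"
    proof -
      have "(\<Sum>l<m. if l \<in> L then \<alpha> else 0) = (\<Sum>l\<in>{..<m} \<inter> L. \<alpha>)"
        by (rule sum.inter_restrict[symmetric]) simp
      also have "{..<m} \<inter> L = L" by (auto simp: L_def)
      finally show ?thesis by simp
    qed
    also have "\<dots> \<le> (\<Sum>l<m. \<Sum>z\<in>#eigvals (sample n l). Re (poly p z))" by (intro sum_mono contrib)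
    also have "\<dots> = Re (\<Sum>l<m. \<Sum>r<k. poly_mat p (sample n l) $$ (r, r))"
      by (simp add: trace_poly_mat[OF sample_carrier] Re_sum_mset)
    also have "\<dots> \<le> Re (\<Sum>l<m. \<Sum>r<k. poly_mat p (sample n l) $$ (r, r)) + real (n - m * k) * Re (poly p z)"
      using p(1) z by simp
    also have "\<dots> = Re (\<Sum>a<n. poly_mat p (model z n) $$ (a, a))"
      unfolding poly_mat_model trace_block_circulant[OF k_pos div_le] by (simp add: m_def)
    finally show ?thesis .
  qed
  with c show ?thesis by blast
qed

lemma background_bounded: "\<exists>M. \<forall>n. \<bar>a0 n\<bar> \<le> M \<and> \<bar>b0 n\<bar> \<le> M"
proof -
  define M where "M = Max ((\<lambda>r. \<bar>a0 r\<bar> + \<bar>b0 r\<bar>) ` {..<k})"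
  have "\<bar>a0 n\<bar> \<le> M \<and> \<bar>b0 n\<bar> \<le> M" for n
  proof -
    have n: "n = n div k * k + n mod k" by simp
    have "a0 n = a0 (n mod k)" "b0 n = b0 (n mod k)"
      by (subst n, rule periodic_block[of a0, OF a0_per], subst n, rule periodic_block[of b0, OF b0_per])
    moreover have "\<bar>a0 (n mod k)\<bar> + \<bar>b0 (n mod k)\<bar> \<le> M"
      unfolding M_def using k_pos by (intro Max_ge) auto
    ultimately show ?thesis by auto
  qed
  then show ?thesis by blast
qed

lemma symmetric_jacobi_le_band:
  assumes M: "\<And>n. \<bar>a0 n\<bar> \<le> M \<and> \<bar>b0 n\<bar> \<le> M"
  shows "cmod (symmetric_jacobi_matrix a0 b0 i j) \<le> M * band i j"
  using M[of i] M[of j] by (auto simp: symmetric_jacobi_index band_def)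

text \<open>Within the circulant block only the two corners differ from the periodic Jacobi matrix. All other
  discrepancies sit in the last n mod k rows and columns and follow the tridiagonal pattern.\<close>

lemma model_index_close:
  assumes M: "\<And>n. \<bar>a0 n\<bar> \<le> M \<and> \<bar>b0 n\<bar> \<le> M" and ij: "i < n" "j < n"
  shows "cmod (symmetric_jacobi_matrix a0 b0 i j - model z n $$ (i, j)) \<le> M * corner (n div k * k) i j +
      (M + cmod z) * (of_bool (n div k * k \<le> i) * band i j + of_bool (n div k * k \<le> j) * band i j)"
proof (cases "i < n div k * k \<and> j < n div k * k")
  case True
  then have eq: "model z n $$ (i, j) = symmetric_jacobi_matrix a0 b0 i j
    + (if i = 0 \<and> j = n div k * k - 1 then of_real (a0 0) else 0)
    + (if i = n div k * k - 1 \<and> j = 0 then of_real (a0 0) else 0)"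
    unfolding model_def sample_def
    by (intro block_circulant_generating_function[OF a0_per b0_per k1 div_le]) auto
  have "cmod (symmetric_jacobi_matrix a0 b0 i j - model z n $$ (i, j)) \<le> \<bar>a0 0\<bar> * corner (n div k * k) i j"
    unfolding eq corner_def by (auto simp: norm_minus_commute simp flip: of_real_add of_real_minus of_real_diff)
  also have "\<dots> \<le> M * corner (n div k * k) i j" using M[of 0] by (intro mult_right_mono corner_nonneg) auto
  finally show ?thesis using True by simp
next
  case False
  have outside: "model z n $$ (i, j) = (if i = j then z else 0)"
    unfolding model_def block_circulant_index[OF ij] by (rule if_not_P[OF False])
  have M0: "M \<ge> 0" using M[of 0] by linarith
  have "cmod (symmetric_jacobi_matrix a0 b0 i j - model z n $$ (i, j)) \<le> cmod (symmetric_jacobi_matrix a0 b0 i j) + cmod (model z n $$ (i, j))"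
    by (rule norm_triangle_ineq4)
  also have "cmod (symmetric_jacobi_matrix a0 b0 i j) \<le> M * band i j" by (rule symmetric_jacobi_le_band[OF M])
  also have "cmod (model z n $$ (i, j)) \<le> cmod z * band i j"
    unfolding outside by (simp add: band_def)
  finally have le: "cmod (symmetric_jacobi_matrix a0 b0 i j - model z n $$ (i, j)) \<le> (M + cmod z) * band i j"
    by (simp add: algebra_simps)
  also have "\<dots> \<le> (M + cmod z) * (of_bool (n div k * k \<le> i) * band i j + of_bool (n div k * k \<le> j) * band i j)"
    using False M0 band_nonneg[of i j] by (intro mult_left_mono) auto
  finally show ?thesis using mult_nonneg_nonneg[OF M0 corner_nonneg[of "n div k * k" i j]] by linarith
qed

lemma model_row_bounded:
  assumes M: "\<And>n. \<bar>a0 n\<bar> \<le> M \<and> \<bar>b0 n\<bar> \<le> M"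
  shows "row_bounded n (3 * M + 2 * M + 6 * (M + cmod z)) (model z n)"
  unfolding row_bounded_def
proof (intro allI impI)
  fix i assume i: "i < n"
  have M0: "M \<ge> 0" using M[of 0] by linarith
  have "(\<Sum>j<n. cmod (model z n $$ (i, j))) \<le> (\<Sum>j<n. M * band i j + M * corner (n div k * k) i j + (M + cmod z) * (band i j + band i j))"
  proof (rule sum_mono)
    fix j assume "j \<in> {..<n}"
    then have j: "j < n" by simp
    have "cmod (model z n $$ (i, j)) \<le> cmod (symmetric_jacobi_matrix a0 b0 i j) + cmod (symmetric_jacobi_matrix a0 b0 i j - model z n $$ (i, j))"
      by (metis norm_triangle_sub norm_minus_commute)
    also have "\<dots> \<le> M * band i j + (M * corner (n div k * k) i j + (M + cmod z) * (of_bool (n div k * k \<le> i) * band i j + of_bool (n div k * k \<le> j) * band i j))"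
      by (intro add_mono symmetric_jacobi_le_band[OF M] model_index_close[OF M i j])
    also have "\<dots> \<le> M * band i j + (M * corner (n div k * k) i j + (M + cmod z) * (band i j + band i j))"
      using M0 band_nonneg[of i j] by (intro add_left_mono mult_left_mono add_mono) auto
    finally show "cmod (model z n $$ (i, j)) \<le> M * band i j + M * corner (n div k * k) i j + (M + cmod z) * (band i j + band i j)"
      by simp
  qed
  also have "\<dots> = M * (\<Sum>j<n. band i j) + M * (\<Sum>j<n. corner (n div k * k) i j) + (M + cmod z) * ((\<Sum>j<n. band i j) + (\<Sum>j<n. band i j))"
    by (simp only: sum.distrib sum_distrib_left[symmetric])
  also have "\<dots> \<le> M * 3 + M * 2 + (M + cmod z) * (3 + 3)"
    using M0 by (intro add_mono mult_left_mono band_sums corner_sums) auto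
  finally show "(\<Sum>j<n. cmod (model z n $$ (i, j))) \<le> 3 * M + 2 * M + 6 * (M + cmod z)" by simp
qed

lemma l1_background_model:
  assumes M: "\<And>n. \<bar>a0 n\<bar> \<le> M \<and> \<bar>b0 n\<bar> \<le> M"
  shows "(\<Sum>i<n. \<Sum>j<n. cmod (symmetric_jacobi_matrix a0 b0 i j - model z n $$ (i, j)))
    \<le> M * 2 + (M + cmod z) * (3 * real k + 3 * real k)"
proof -
  define N where "N = n div k * k"
  have M0: "M \<ge> 0" using M[of 0] by linarith
  have tail: "(\<Sum>i<n. of_bool (N \<le> i)) \<le> real k"
  proof -
    have "n < N + k" using dividend_less_div_times[OF k_pos, of n] by (simp add: N_def)
    moreover have "{..<n} \<inter> {i. N \<le> i} = {N..<n}" by auto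
    ultimately show ?thesis by (simp add: sum_of_bool_eq)
  qed
  have rows: "(\<Sum>i<n. \<Sum>j<n. of_bool (N \<le> i) * band i j) \<le> 3 * real k"
  proof -
    have "(\<Sum>i<n. \<Sum>j<n. of_bool (N \<le> i) * band i j) \<le> (\<Sum>i<n. of_bool (N \<le> i) * 3)"
      unfolding sum_distrib_left[symmetric] by (intro sum_mono mult_left_mono band_sums) auto
    also have "\<dots> = (\<Sum>i<n. of_bool (N \<le> i)) * 3" by (simp only: sum_distrib_right)
    finally show ?thesis using tail by linarith
  qed
  have cols: "(\<Sum>i<n. \<Sum>j<n. of_bool (N \<le> j) * band i j) \<le> 3 * real k"
  proof -
    have "(\<Sum>i<n. \<Sum>j<n. of_bool (N \<le> j) * band i j) = (\<Sum>j<n. \<Sum>i<n. of_bool (N \<le> j) * band i j)"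
      by (rule sum.swap)
    also have "\<dots> \<le> (\<Sum>j<n. of_bool (N \<le> j) * 3)"
      unfolding sum_distrib_left[symmetric] by (intro sum_mono mult_left_mono band_sums) auto
    also have "\<dots> = (\<Sum>j<n. of_bool (N \<le> j)) * 3" by (simp only: sum_distrib_right)
    finally show ?thesis using tail by linarith
  qed
  have "(\<Sum>i<n. \<Sum>j<n. cmod (symmetric_jacobi_matrix a0 b0 i j - model z n $$ (i, j))) \<le>
    (\<Sum>i<n. \<Sum>j<n. M * corner N i j + (M + cmod z) * (of_bool (N \<le> i) * band i j + of_bool (N \<le> j) * band i j))"
    unfolding N_def by (intro sum_mono model_index_close[OF M]) auto
  also have "\<dots> = M * (\<Sum>i<n. \<Sum>j<n. corner N i j) + (M + cmod z) *
      ((\<Sum>i<n. \<Sum>j<n. of_bool (N \<le> i) * band i j) + (\<Sum>i<n. \<Sum>j<n. of_bool (N \<le> j) * band i j))"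
    by (simp only: sum.distrib sum_distrib_left[symmetric])
  also have "\<dots> \<le> M * 2 + (M + cmod z) * (3 * real k + 3 * real k)"
    using M0 rows cols by (intro add_mono mult_left_mono corner_sums) auto
  finally show ?thesis .
qed

end

text \<open>Partial sums of nonnegative terms increase, so an eventual bound holds from the start.\<close>

lemma limsup_partial_sums_bounded:
  fixes f :: "nat \<Rightarrow> real"
  assumes nn: "\<And>j. f j \<ge> 0" and "limsup (\<lambda>n. ereal (\<Sum>j=1..n. f j)) < \<infinity>"
  shows "\<exists>M. \<forall>n. (\<Sum>j=1..n. f j) \<le> M"
proof -
  obtain M :: nat where "limsup (\<lambda>n. ereal (\<Sum>j=1..n. f j)) < ereal (real M)"
    using assms(2) less_PInf_Ex_of_nat by (metis less_irrefl)
  then have "eventually (\<lambda>n. ereal (\<Sum>j=1..n. f j) < ereal (real M)) sequentially" by (rule Limsup_lessD)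
  then obtain N where N: "\<And>n. n \<ge> N \<Longrightarrow> (\<Sum>j=1..n. f j) < real M"
    by (auto simp: eventually_sequentially)
  have "(\<Sum>j=1..n. f j) \<le> real M" for n
  proof -
    have "(\<Sum>j=1..n. f j) \<le> (\<Sum>j=1..max n N. f j)" using nn by (intro sum_mono2) auto
    also have "\<dots> < real M" by (rule N) simp
    finally show ?thesis by simp
  qed
  then show ?thesis by blast
qed

theorem theorem4p6:
  fixes k :: nat
    and a0 b0 :: "nat \<Rightarrow> real"
    and a b c :: "nat \<Rightarrow> complex"
  assumes "k \<ge> 1"
    and "\<forall>n. a0 n > 0"
    and "\<forall>n. a0 (n + k) = a0 n"
    and "\<forall>n. b0 (n + k) = b0 n"
    and "limsup (\<lambda>n. ereal (\<Sum>j=1..n. cmod (a j - complex_of_real (a0 j))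
            + cmod (b j - complex_of_real (b0 j)) + cmod (c j - complex_of_real (a0 j)))) < \<infinity>"
  defines "J \<equiv> leading_block (jacobi_matrix a b c)"
    and "S \<equiv> matrix_ess_range k {-pi..pi} (generating_function k a0 b0)"
  shows "strongly_clustered J S \<and> (\<forall>s\<in>S. strongly_attracts s J)"
proof -
  interpret periodic_background k a0 b0
    by unfold_locales (use assms in auto)
  define f where "f j = cmod (a j - complex_of_real (a0 j))" for j
  define g where "g j = cmod (b j - complex_of_real (b0 j))" for j
  define h where "h j = cmod (c j - complex_of_real (a0 j))" for j
  have nn: "f j \<ge> 0" "g j \<ge> 0" "h j \<ge> 0" for j by (auto simp: f_def g_def h_def)
  obtain M1 where M1: "\<And>n. (\<Sum>j=1..n. f j + g j + h j) \<le> M1"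
    using limsup_partial_sums_bounded[of "\<lambda>j. f j + g j + h j"] assms(5) nn
    by (auto simp: f_def g_def h_def)
  \<comment> \<open>The sum in the hypothesis starts at 1, while the matrix also contains b 0; the constant D takes
    care of this entry.\<close>
  define D where "D = g 0 + M1"
  obtain M where M: "\<And>n. \<bar>a0 n\<bar> \<le> M \<and> \<bar>b0 n\<bar> \<le> M" using background_bounded by blast
  have M0: "M \<ge> 0" using M[of 0] by linarith
  have single: "f j + g j + h j \<le> M1" if "j \<ge> 1" for j
  proof -
    have "f j + g j + h j \<le> (\<Sum>j=1..j. f j + g j + h j)"
      using that nn by (intro member_le_sum[of j "{1..j}" "\<lambda>j. f j + g j + h j"]) auto
    then show ?thesis using M1[of j] by linarith
  qed
  have M1nn: "M1 \<ge> 0" using M1[of 0] by simp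
  have D: "D \<ge> 0" using nn(2)[of 0] M1nn by (simp add: D_def)
  have Jc: "J n \<in> carrier_mat n n" for n by (simp add: J_def leading_block_def)
  have Jij: "J n $$ (i, j) = jacobi_matrix a b c i j" if "i < n" "j < n" for n i j
    using that by (simp add: J_def leading_block_def)
  have diff: "cmod (jacobi_matrix a b c i j - symmetric_jacobi_matrix a0 b0 i j) =
      of_bool (i = j) * g i + of_bool (i = j + 1) * f i + of_bool (j = i + 1) * h j" for i j
    by (auto simp: jacobi_matrix_def symmetric_jacobi_matrix_def f_def g_def h_def)
  have diff_band: "of_bool (i = j) * g i + of_bool (i = j + 1) * f i + of_bool (j = i + 1) * h j \<le> D * band i j" for i j
  proof -
    have gi: "g i \<le> D" 
    proof (cases "i = 0")
      case True
      then show ?thesis using M1nn by (simp add: D_def)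
    next
      case False
      then show ?thesis using single[of i] nn(1,3)[of i] nn(2)[of 0] by (simp add: D_def)
    qed
    have fi: "f i \<le> D" if "i = j + 1" using single[of i] nn(2,3)[of i] nn(2)[of 0] that by (simp add: D_def)
    have hj: "h j \<le> D" if "j = i + 1" using single[of j] nn(1,2)[of j] nn(2)[of 0] that by (simp add: D_def)
    show ?thesis unfolding band_def distrib_left
      using gi fi hj by (intro add_mono) auto
  qed
  have J_band: "cmod (J n $$ (i, j)) \<le> (M + D) * band i j" if "i < n" "j < n" for n i j
  proof -
    have "cmod (J n $$ (i, j)) \<le> cmod (symmetric_jacobi_matrix a0 b0 i j) + cmod (jacobi_matrix a b c i j - symmetric_jacobi_matrix a0 b0 i j)"
      unfolding Jij[OF that] by (metis norm_triangle_sub)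
    also have "\<dots> \<le> M * band i j + D * band i j"
      unfolding diff by (intro add_mono symmetric_jacobi_le_band[OF M] diff_band)
    finally show ?thesis by (simp add: algebra_simps)
  qed
  obtain z where z: "z \<in> S" using S_nonempty unfolding S_def by blast
  \<comment> \<open>The three summands bound the rows of the model, those of J n, and the points of S.\<close>
  define K where "K = (3 * M + 2 * M + 6 * (M + cmod z)) + 3 * (M + D) + real k * (3 * M)"
  have K: "3 * M + 2 * M + 6 * (M + cmod z) \<le> K" "(M + D) * 3 \<le> K" "real k * (3 * M) \<le> K"
    using M0 D by (auto simp: K_def)
  define B where "B = D + (M * 2 + (M + cmod z) * (3 * real k + 3 * real k))"
  have model: "hermitian_model J (model z) S K B"
  proof
    fix n
    show "J n \<in> carrier_mat n n" by (rule Jc)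
    show "model z n \<in> carrier_mat n n" by (simp add: model_def)
    show "row_bounded n K (J n)" unfolding row_bounded_def
    proof (intro allI impI)
      fix i assume "i < n"
      then have "(\<Sum>j<n. cmod (J n $$ (i, j))) \<le> (\<Sum>j<n. (M + D) * band i j)" by (intro sum_mono J_band) auto
      also have "\<dots> \<le> (M + D) * 3" unfolding sum_distrib_left[symmetric]
        using M0 D by (intro mult_left_mono band_sums) auto
      finally show "(\<Sum>j<n. cmod (J n $$ (i, j))) \<le> K" using K(2) by linarith
    qed
    show "col_bounded n K (J n)" unfolding col_bounded_def
    proof (intro allI impI)
      fix j assume "j < n"
      then have "(\<Sum>i<n. cmod (J n $$ (i, j))) \<le> (\<Sum>i<n. (M + D) * band i j)" by (intro sum_mono J_band) auto
      also have "\<dots> \<le> (M + D) * 3" unfolding sum_distrib_left[symmetric]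
        using M0 D by (intro mult_left_mono band_sums) auto
      finally show "(\<Sum>i<n. cmod (J n $$ (i, j))) \<le> K" using K(2) by linarith
    qed
    show "row_bounded n K (model z n)"
      using model_row_bounded[OF M, of n z] K(1) unfolding row_bounded_def by force
    show "l1_norm n (J n - model z n) \<le> B"
    proof -
      have "l1_norm n (J n - model z n) \<le> (\<Sum>i<n. \<Sum>j<n.
          cmod (jacobi_matrix a b c i j - symmetric_jacobi_matrix a0 b0 i j)
          + cmod (symmetric_jacobi_matrix a0 b0 i j - model z n $$ (i, j)))"
        unfolding l1_norm_def
      proof (intro sum_mono)
        fix i j assume "i \<in> {..<n}" "j \<in> {..<n}"
        then have "(J n - model z n) $$ (i, j) = (jacobi_matrix a b c i j - symmetric_jacobi_matrix a0 b0 i j)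
            + (symmetric_jacobi_matrix a0 b0 i j - model z n $$ (i, j))"
          using Jc[of n] by (simp add: model_def Jij carrier_matD[OF block_circulant_carrier])
        then show "cmod ((J n - model z n) $$ (i, j)) \<le> cmod (jacobi_matrix a b c i j - symmetric_jacobi_matrix a0 b0 i j)
          + cmod (symmetric_jacobi_matrix a0 b0 i j - model z n $$ (i, j))"
          using norm_triangle_ineq by metis
      qed
      also have "\<dots> = (\<Sum>i<n. \<Sum>j<n. of_bool (i = j) * g i + of_bool (i = j + 1) * f i + of_bool (j = i + 1) * h j)
          + (\<Sum>i<n. \<Sum>j<n. cmod (symmetric_jacobi_matrix a0 b0 i j - model z n $$ (i, j)))"
        by (simp only: diff sum.distrib)
      also have "\<dots> \<le> (g 0 + (\<Sum>i=1..n. f i + g i + h i)) + (M * 2 + (M + cmod z) * (3 * real k + 3 * real k))"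
        by (intro add_mono l1_tridiagonal_le nn l1_background_model[OF M])
      also have "\<dots> \<le> B" using M1[of n] by (simp add: B_def D_def)
      finally show ?thesis .
    qed
  next
    show "S \<noteq> {}" using z by blast
    show "closed S" unfolding S_def by (rule S_closed)
  next
    fix s assume s: "s \<in> S"
    then show "Im s = 0" unfolding S_def by (rule S_real)
    have "cmod (generating_function k a0 b0 t $$ (i, j)) \<le> 3 * M" if ij: "i < k" "j < k" for t i j
    proof -
      let ?x = "if i = 0 \<and> j = k - 1 then complex_of_real (a0 0) else 0"
      let ?y = "if i = k - 1 \<and> j = 0 then complex_of_real (a0 0) else 0"
      have "cmod (symmetric_jacobi_matrix a0 b0 i j) \<le> M"
        using M M0 by (auto simp: symmetric_jacobi_index)
      moreover have "cmod (?x * cis t) \<le> M" "cmod (?y * cnj (cis t)) \<le> M" using M[of 0] M0 by (auto simp: norm_mult)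
      ultimately show ?thesis unfolding generating_function_index[OF ij]
        using norm_triangle_ineq[of "symmetric_jacobi_matrix a0 b0 i j + ?x * cis t" "?y * cnj (cis t)"]
          norm_triangle_ineq[of "symmetric_jacobi_matrix a0 b0 i j" "?x * cis t"] by linarith
    qed
    from S_bounded[OF this] s K(3) show "cmod s \<le> K" unfolding S_def by force
  next
    fix p n v assume "\<And>s. s \<in> S \<Longrightarrow> Re (poly p s) \<le> 0"
    then show "Re (qform n (poly_mat p (model z n)) v) \<le> 0"
      using z unfolding S_def by (intro model_negative)
  qed
  have "strongly_attracts s J" if s: "s \<in> S" for s
    using hermitian_model.attracted[OF model s] model_trace_lower s z unfolding S_def by blast
  with hermitian_model.clustered[OF model] show ?thesis by blast
qed

end
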